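(* Suppose that $F$ has a minimizer $x_*\in\mathbb{R}^d$, that $F$ is $L$-smooth, that $\{f_{i,p}\}$ has $\mathcal{V}$-bounded variance and that $F$ is $\mu$-strongly convex. Consider S-SNAG-EF with constant parameters $\eta_t=\eta$, $\lambda_t=\lambda=\frac12\sqrt{\eta/\mu}$, $\alpha_t=\alpha=\frac{\lambda\mu}{2+\lambda\mu}$, $\beta_t=\beta=\frac{\lambda\mu}{1+\lambda\mu}$, and with $\gamma=\Theta(k/d)$ sufficiently small. Then, for every $\varepsilon>0$, with an appropriate choice of $\eta>0$, the number $T$ of iterations of S-SNAG-EF needed to achieve $\mathbb{E}[F(x_{\mathrm{out}})-F(x_* )]\le\varepsilon$, where $x_{\mathrm{out}}=x_T$, is $$\widetilde O\left(\sqrt{\frac{L}{\mu}}+\frac{\mathcal{V}}{P}\frac{1}{\mu\varepsilon}+\frac{d}{k}+\frac{d^{3/2}}{k^{3/2}\sqrt{P}}\sqrt{\frac{L}{\mu}}+\frac{d^{4/3}}{k^{4/3}P^{1/3}}\frac{L^{2/3}}{\mu^{2/3}}+\frac{d}{kP^{1/4}}\frac{(L^2\mathcal{V})^{1/4}}{\mu^{3/4}\varepsilon^{1/4}}\right).$$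
   Context: Problem. $d,N,P$ are positive integers, $[m]=\{1,\dots,m\}$, $\|\cdot\|$ is the Euclidean norm, $f_{i,p}:\mathbb{R}^d\to\mathbb{R}$ ($i\in[N]$, $p\in[P]$) are differentiable, and $F(x)=\frac1P\sum_{p=1}^P\frac1N\sum_{i=1}^N f_{i,p}(x)$. Assumptions. $F$ is $L$-smooth ($L>0$): $\|\nabla F(x)-\nabla F(y)\|\le L\|x-y\|$ for all $x,y$. $\mathcal{V}$-bounded variance: $\frac1{NP}\sum_{i,p}\|\nabla f_{i,p}(x)-\nabla F(x)\|^2\le\mathcal{V}$ for all $x$. $F$ is $\mu$-strongly convex ($\mu>0$): $F(y)-(F(x)+\langle\nabla F(x),y-x\rangle)\ge\frac\mu2\|x-y\|^2$ for all $x,y$. Random compression. For $x\in\mathbb{R}^d$ and an integer $1\le q\le d$, $\mathrm{RandComp}(x,q)$ is the random vector obtained by drawing a subset $J\subset[d]$ uniformly among all subsets with $q$ elements (independently at each call) and setting the $j$-th coordinate to $(d/q)x_j$ if $j\in J$ and to $0$ otherwise. S-SNAG-EF. Inputs: $x_{\mathrm{in}}\in\mathbb{R}^d$, step sizes $\eta_t,\lambda_t>0$, $\alpha_t,\beta_t\in[0,1]$, $\gamma>0$, an (even) integer $k$, and $T$. Set $x_0=y_0=z_0=x_{\mathrm{in}}$ and $m_{0,p}=m^{(y)}_{0,p}=m^{(z)}_{0,p}=0$ for $p\in[P]$. For $t=1,\dots,T$: for each $p$ draw $i_{t,p}$ uniformly from $[N]$ (independently over $t,p$), and let $h_{t,p}=\nabla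 f_{i_{t,p},p}(x_{t-1})$. Put $g^{(y)}_{t,p}=h_{t,p}+\frac{\gamma}{\eta_t}m_{t-1,p}$, $g^{(z)}_{t,p}=h_{t,p}+\frac{\gamma}{\lambda_t}\big((1-\beta_t)m^{(z)}_{t-1,p}+\beta_t m_{t-1,p}\big)$, $\bar g^{(y)}_{t,p}=\mathrm{RandComp}(g^{(y)}_{t,p},k/2)$, $\bar g^{(z)}_{t,p}=\mathrm{RandComp}(g^{(z)}_{t,p},k/2)$. Update the cumulative compression errors: $m^{(y)}_{t,p}=m_{t-1,p}-\eta_t(\bar g^{(y)}_{t,p}-h_{t,p})$, $m^{(z)}_{t,p}=(1-\beta_t)m^{(z)}_{t-1,p}+\beta_t m_{t-1,p}-\lambda_t(\bar g^{(z)}_{t,p}-h_{t,p})$, $m_{t,p}=(1-\alpha_t)m^{(y)}_{t,p}+\alpha_t m^{(z)}_{t,p}$. Update the solutions: $y_t=x_{t-1}-\eta_t\frac1P\sum_p\bar g^{(y)}_{t,p}$, $z_t=(1-\beta_t)z_{t-1}+\beta_t x_{t-1}-\lambda_t\frac1P\sum_p\bar g^{(z)}_{t,p}$, $x_t=(1-\alpha_t)y_t+\alpha_t z_t$. Conventions. "$\gamma=\Theta(k/d)$ sufficiently small" means $\gamma=c\,k/d$ with $c>0$ a sufficiently small absolute constant. $\widetilde O$ hides absolute constants and additional logarithmic factors in the problem parameters ($L,\mu,\mathcal{V},P,d,k,1/\varepsilon,\|x_0-x_*\|$). *)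

theory Defs
  imports "HOL-Probability.Probability"
begin

section \<open>Euclidean spaces of all dimensions inside one type\<close>

text \<open>
  The complexity bound holds with absolute constants, uniformly in the dimension \<open>d\<close>, so \<open>d\<close> has to be
  quantified below the existential quantifiers for these constants and cannot be a type.  All spaces
  \<open>\<real>^d\<close> are therefore realised as the subspaces \<open>Rd d\<close> of the inner product space of finitely
  supported real sequences; coordinates are numbered \<open>1, \<dots>, d\<close>.
\<close>

typedef fvec = "{x :: nat \<Rightarrow> real. finite {j. x j \<noteq> 0}}"
  morphisms coord Fvec
  by (rule exI[of _ "\<lambda>_. 0"]) simp

setup_lifting type_definition_fvec

lemma finite_coord: "finite {j. coord x j \<noteq> 0}"
  using coord[of x] by simp

lemma fvec_eqI: "(\<And>j. coord x j = coord y j) \<Longrightarrow> x = y"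
  by (metis coord_inject ext)

instantiation fvec :: real_vector
begin

lift_definition zero_fvec :: fvec is "\<lambda>_. 0" by simp

lift_definition plus_fvec :: "fvec \<Rightarrow> fvec \<Rightarrow> fvec" is "\<lambda>x y j. x j + y j"
  subgoal for x y by (rule finite_subset[of _ "{j. x j \<noteq> 0} \<union> {j. y j \<noteq> 0}"]) auto
  done

lift_definition uminus_fvec :: "fvec \<Rightarrow> fvec" is "\<lambda>x j. - x j" by simp

lift_definition minus_fvec :: "fvec \<Rightarrow> fvec \<Rightarrow> fvec" is "\<lambda>x y j. x j - y j"
  subgoal for x y by (rule finite_subset[of _ "{j. x j \<noteq> 0} \<union> {j. y j \<noteq> 0}"]) auto
  done

lift_definition scaleR_fvec :: "real \<Rightarrow> fvec \<Rightarrow> fvec" is "\<lambda>a x j. a * x j"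
  by (rule finite_subset[rotated]) auto

instance
  by standard (transfer; simp add: algebra_simps fun_eq_iff)+

end

lemma coord_simps [simp]:
  "coord 0 j = 0" "coord (x + y) j = coord x j + coord y j" "coord (- x) j = - coord x j"
  "coord (x - y) j = coord x j - coord y j" "coord (a *\<^sub>R x) j = a * coord x j"
  by (transfer; simp)+

lemma coord_sum [simp]: "coord (\<Sum>i\<in>A. v i) j = (\<Sum>i\<in>A. coord (v i) j)"
  by (induction A rule: infinite_finite_induct) auto

instantiation fvec :: real_inner
begin

definition inner_fvec :: "fvec \<Rightarrow> fvec \<Rightarrow> real" where
  "inner_fvec x y = (\<Sum>j | coord x j \<noteq> 0. coord x j * coord y j)"

definition norm_fvec :: "fvec \<Rightarrow> real" where
  "norm_fvec x = sqrt (inner x x)"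

definition sgn_fvec :: "fvec \<Rightarrow> fvec" where
  "sgn_fvec x = x /\<^sub>R norm x"

definition dist_fvec :: "fvec \<Rightarrow> fvec \<Rightarrow> real" where
  "dist_fvec x y = norm (x - y)"

definition uniformity_fvec :: "(fvec \<times> fvec) filter" where
  "uniformity_fvec = (INF e\<in>{0 <..}. principal {(x, y). dist x y < e})"

definition open_fvec :: "fvec set \<Rightarrow> bool" where
  "open_fvec U \<longleftrightarrow> (\<forall>x\<in>U. eventually (\<lambda>(x', y). x' = x \<longrightarrow> y \<in> U) uniformity)"

lemma inner_fvec_superset:
  assumes "finite A" "{j. coord x j \<noteq> 0} \<subseteq> A"
  shows "inner x y = (\<Sum>j\<in>A. coord x j * coord y j)"
  unfolding inner_fvec_def using assms by (intro sum.mono_neutral_left) auto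

instance
proof
  fix x y z :: fvec and r :: real
  let ?A = "{j. coord x j \<noteq> 0} \<union> {j. coord y j \<noteq> 0}"
  have fin: "finite ?A" by (simp add: finite_coord)
  have "inner x y = (\<Sum>j\<in>?A. coord x j * coord y j)"
    by (rule inner_fvec_superset[OF fin]) auto
  also have "\<dots> = inner y x"
    by (subst inner_fvec_superset[OF fin]) (auto simp: mult.commute)
  finally show "inner x y = inner y x" .
  have "inner (x + y) z = (\<Sum>j\<in>?A. coord (x + y) j * coord z j)"
    by (rule inner_fvec_superset[OF fin]) auto
  also have "\<dots> = (\<Sum>j\<in>?A. coord x j * coord z j) + (\<Sum>j\<in>?A. coord y j * coord z j)"
    by (simp add: algebra_simps sum.distrib)
  also have "\<dots> = inner x z + inner y z"
    by (subst (1 2) inner_fvec_superset[OF fin]) auto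
  finally show "inner (x + y) z = inner x z + inner y z" .
  show "inner (r *\<^sub>R x) y = r * inner x y"
    by (subst inner_fvec_superset[OF finite_coord[of x]])
       (auto simp: inner_fvec_def sum_distrib_left mult.assoc)
  show "0 \<le> inner x x"
    unfolding inner_fvec_def by (intro sum_nonneg) auto
  have "inner x x = 0 \<longleftrightarrow> (\<forall>j\<in>{j. coord x j \<noteq> 0}. coord x j * coord x j = 0)"
    unfolding inner_fvec_def by (rule sum_nonneg_eq_0_iff[OF finite_coord]) simp
  also have "\<dots> \<longleftrightarrow> x = 0"
    by (auto intro: fvec_eqI)
  finally show "inner x x = 0 \<longleftrightarrow> x = 0" .
qed (simp_all add: norm_fvec_def sgn_fvec_def dist_fvec_def uniformity_fvec_def open_fvec_def)

end

definition Rd :: "nat \<Rightarrow> fvec set" where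
  "Rd d = {x. \<forall>j. j \<notin> {1..d} \<longrightarrow> coord x j = 0}"

lemma subspace_Rd: "subspace (Rd d)"
  by (auto simp: subspace_def Rd_def)

lemma inner_Rd: "x \<in> Rd d \<Longrightarrow> inner x y = (\<Sum>j=1..d. coord x j * coord y j)"
  by (rule inner_fvec_superset) (auto simp: Rd_def)

lift_definition unit_fvec :: "nat \<Rightarrow> fvec" is "\<lambda>i j. if j = i then 1 else 0"
  by (rule finite_subset[rotated, of "{i}" for i]) auto

lemma coord_unit_fvec: "coord (unit_fvec i) j = (if j = i then 1 else 0)"
  by transfer simp

lemma unit_fvec_in_Rd: "i \<in> {1..d} \<Longrightarrow> unit_fvec i \<in> Rd d"
  by (auto simp: Rd_def coord_unit_fvec)

lemma Rd_expansion:
  assumes "x \<in> Rd d"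
  shows "x = (\<Sum>i=1..d. coord x i *\<^sub>R unit_fvec i)"
proof (rule fvec_eqI)
  fix j
  have "coord (\<Sum>i=1..d. coord x i *\<^sub>R unit_fvec i) j = (\<Sum>i=1..d. if i = j then coord x i else 0)"
    unfolding coord_sum by (intro sum.cong) (auto simp: coord_unit_fvec)
  also have "\<dots> = (if j \<in> {1..d} then coord x j else 0)"
    by (simp add: sum.delta)
  also have "\<dots> = coord x j"
    using assms by (auto simp: Rd_def)
  finally show "coord x j = coord (\<Sum>i=1..d. coord x i *\<^sub>R unit_fvec i) j" by simp
qed


section \<open>Gradients and the assumptions on the objective\<close>

text \<open>
  Only the values of \<open>f\<close> on \<open>Rd d\<close> matter.  The lemmas below show that the gradient exists for every
  function that is differentiable on \<open>Rd d\<close> and that it is unique.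
\<close>

definition grad :: "nat \<Rightarrow> (fvec \<Rightarrow> real) \<Rightarrow> fvec \<Rightarrow> fvec" where
  "grad d f x = (THE g. g \<in> Rd d \<and> (f has_derivative inner g) (at x within Rd d))"

lemma gradient_unique:
  assumes x: "x \<in> Rd d" and g: "g \<in> Rd d" and g': "g' \<in> Rd d"
    and D: "(f has_derivative inner g) (at x within Rd d)"
    and D': "(f has_derivative inner g') (at x within Rd d)"
  shows "g = g'"
proof -
  define v where "v = g - g'"
  have v: "v \<in> Rd d" unfolding v_def using subspace_Rd g g' by (rule subspace_diff)
  have line: "(\<lambda>t. x + t *\<^sub>R v) ` UNIV \<subseteq> Rd d"
    using x v subspace_Rd by (auto intro!: subspace_add subspace_scale)
  have line_deriv: "((\<lambda>t::real. x + t *\<^sub>R v) has_derivative (\<lambda>t. t *\<^sub>R v)) (at 0)"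
    by (auto intro!: derivative_eq_intros)
  have *: "((\<lambda>t. f (x + t *\<^sub>R v)) has_derivative (\<lambda>t. inner h (t *\<^sub>R v))) (at 0)"
    if "(f has_derivative inner h) (at x within Rd d)" for h
    using has_derivative_in_compose[OF line_deriv, of f "inner h"]
      has_derivative_subset[OF that line] by simp
  have "(\<lambda>t. inner g (t *\<^sub>R v)) = (\<lambda>t. inner g' (t *\<^sub>R v))"
    using *[OF D] *[OF D'] by (rule has_derivative_unique)
  from fun_cong[OF this, of 1] have "inner g v = inner g' v" by simp
  then have "inner v v = 0" by (simp add: v_def inner_diff_left)
  then show ?thesis by (simp add: v_def)
qed

lemma grad_eqI:
  assumes "x \<in> Rd d" "g \<in> Rd d" "(f has_derivative inner g) (at x within Rd d)"
  shows "grad d f x = g"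
  unfolding grad_def using assms by (intro the_equality) (auto intro: gradient_unique)

lemma grad_works:
  assumes x: "x \<in> Rd d" and "f differentiable (at x within Rd d)"
  shows "grad d f x \<in> Rd d" "(f has_derivative inner (grad d f x)) (at x within Rd d)"
proof -
  obtain D where D: "(f has_derivative D) (at x within Rd d)"
    using assms(2) by (auto simp: differentiable_def)
  interpret D: bounded_linear D using D by (rule has_derivative_bounded_linear)
  define g where "g = (\<Sum>i=1..d. D (unit_fvec i) *\<^sub>R unit_fvec i)"
  have g: "g \<in> Rd d"
    unfolding g_def
    by (intro subspace_sum subspace_Rd subspace_scale unit_fvec_in_Rd) auto
  have g_coord: "coord g j = D (unit_fvec j)" if "j \<in> {1..d}" for j
  proof -
    have "coord g j = (\<Sum>i=1..d. if i = j then D (unit_fvec i) else 0)"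
      unfolding g_def coord_sum by (intro sum.cong) (auto simp: coord_unit_fvec)
    also have "\<dots> = D (unit_fvec j)" using that by (simp add: sum.delta)
    finally show ?thesis .
  qed
  have eq: "D h = inner g h" if "h \<in> Rd d" for h
  proof -
    have "D h = (\<Sum>i=1..d. coord h i * D (unit_fvec i))"
      by (subst Rd_expansion[OF that]) (simp add: D.sum D.scaleR)
    also have "\<dots> = inner g h"
      by (simp add: inner_Rd[OF g] g_coord mult.commute)
    finally show ?thesis .
  qed
  have "(f has_derivative inner g) (at x within Rd d)"
    unfolding has_derivative_within
  proof
    show "bounded_linear (inner g)" by (rule bounded_linear_inner_right)
    have "((\<lambda>y. (1 / norm (y - x)) *\<^sub>R (f y - (f x + D (y - x)))) \<longlongrightarrow> 0) (at x within Rd d)"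
      using D by (simp add: has_derivative_within)
    then show "((\<lambda>y. (1 / norm (y - x)) *\<^sub>R (f y - (f x + inner g (y - x)))) \<longlongrightarrow> 0) (at x within Rd d)"
      by (rule Lim_transform_within[OF _ zero_less_one])
         (use x in \<open>auto simp: eq subspace_diff[OF subspace_Rd]\<close>)
  qed
  with x g grad_eqI[OF x g]
  show "grad d f x \<in> Rd d" "(f has_derivative inner (grad d f x)) (at x within Rd d)"
    by auto
qed

text \<open>\<open>f i p\<close> is the \<open>i\<close>-th local loss of worker \<open>p\<close>, for \<open>i\<close> in \<open>{1..N}\<close> and \<open>p\<close> in \<open>{1..P}\<close>.\<close>

definition objective :: "nat \<Rightarrow> nat \<Rightarrow> (nat \<Rightarrow> nat \<Rightarrow> fvec \<Rightarrow> real) \<Rightarrow> fvec \<Rightarrow> real" where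
  "objective N P f x = (1 / real P) * (\<Sum>p=1..P. (1 / real N) * (\<Sum>i=1..N. f i p x))"

definition smooth :: "nat \<Rightarrow> real \<Rightarrow> (fvec \<Rightarrow> real) \<Rightarrow> bool" where
  "smooth d L F \<longleftrightarrow>
     (\<forall>x\<in>Rd d. \<forall>y\<in>Rd d. norm (grad d F x - grad d F y) \<le> L * norm (x - y))"

definition bounded_variance ::
  "nat \<Rightarrow> nat \<Rightarrow> nat \<Rightarrow> real \<Rightarrow> (nat \<Rightarrow> nat \<Rightarrow> fvec \<Rightarrow> real) \<Rightarrow> bool" where
  "bounded_variance d N P V f \<longleftrightarrow>
     (\<forall>x\<in>Rd d. (1 / (real N * real P)) *
        (\<Sum>p=1..P. \<Sum>i=1..N. (norm (grad d (f i p) x - grad d (objective N P f) x))\<^sup>2) \<le> V)"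

definition strongly_convex :: "nat \<Rightarrow> real \<Rightarrow> (fvec \<Rightarrow> real) \<Rightarrow> bool" where
  "strongly_convex d \<mu> F \<longleftrightarrow>
     (\<forall>x\<in>Rd d. \<forall>y\<in>Rd d. F y - (F x + inner (grad d F x) (y - x)) \<ge> \<mu> / 2 * (norm (x - y))\<^sup>2)"


section \<open>The algorithm\<close>

lift_definition scaled_restriction :: "real \<Rightarrow> nat set \<Rightarrow> fvec \<Rightarrow> fvec" is
  "\<lambda>a J x j. if j \<in> J then a * x j else 0"
  by (rule finite_subset[rotated]) auto

definition rand_comp :: "nat \<Rightarrow> fvec \<Rightarrow> nat \<Rightarrow> fvec pmf" where
  "rand_comp d x q =
     map_pmf (\<lambda>J. scaled_restriction (real d / real q) J x)
       (pmf_of_set {J. J \<subseteq> {1..d} \<and> card J = q})"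

text \<open>
  The state after \<open>t\<close> rounds: the solutions \<open>x\<^sub>t, y\<^sub>t, z\<^sub>t\<close> and, for every worker \<open>p\<close>, the cumulative
  compression errors.  The values of the error components at indices outside \<open>{1..P}\<close> are never used.
\<close>

record snag_state =
  sol_x :: fvec
  sol_y :: fvec
  sol_z :: fvec
  err :: "nat \<Rightarrow> fvec"
  err_y :: "nat \<Rightarrow> fvec"
  err_z :: "nat \<Rightarrow> fvec"

definition snag_init :: "fvec \<Rightarrow> snag_state" where
  "snag_init x_in =
     \<lparr>sol_x = x_in, sol_y = x_in, sol_z = x_in, err = (\<lambda>_. 0), err_y = (\<lambda>_. 0), err_z = (\<lambda>_. 0)\<rparr>"

text \<open>
  One round with step sizes \<open>\<eta>, \<lambda>\<close> (the latter written \<open>lam\<close>) and weights \<open>\<alpha>, \<beta>\<close>.  The product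
  distributions \<open>Pi_pmf\<close> make the draws of the individual workers independent.
\<close>

definition snag_step ::
  "nat \<Rightarrow> nat \<Rightarrow> nat \<Rightarrow> (nat \<Rightarrow> nat \<Rightarrow> fvec \<Rightarrow> real) \<Rightarrow> nat \<Rightarrow> real \<Rightarrow>
   real \<Rightarrow> real \<Rightarrow> real \<Rightarrow> real \<Rightarrow> snag_state \<Rightarrow> snag_state pmf" where
  "snag_step d N P f k \<gamma> \<eta> lam \<alpha> \<beta> s =
     do {
       i \<leftarrow> Pi_pmf {1..P} 0 (\<lambda>p. pmf_of_set {1..N});
       let h = (\<lambda>p. grad d (f (i p) p) (sol_x s));
       let e_z = (\<lambda>p. (1 - \<beta>) *\<^sub>R err_z s p + \<beta> *\<^sub>R err s p);
       gy \<leftarrow> Pi_pmf {1..P} 0 (\<lambda>p. rand_comp d (h p + (\<gamma> / \<eta>) *\<^sub>R err s p) (k div 2));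
       gz \<leftarrow> Pi_pmf {1..P} 0 (\<lambda>p. rand_comp d (h p + (\<gamma> / lam) *\<^sub>R e_z p) (k div 2));
       let m_y = (\<lambda>p. err s p - \<eta> *\<^sub>R (gy p - h p));
       let m_z = (\<lambda>p. e_z p - lam *\<^sub>R (gz p - h p));
       let y = sol_x s - \<eta> *\<^sub>R ((1 / real P) *\<^sub>R (\<Sum>p=1..P. gy p));
       let z = (1 - \<beta>) *\<^sub>R sol_z s + \<beta> *\<^sub>R sol_x s - lam *\<^sub>R ((1 / real P) *\<^sub>R (\<Sum>p=1..P. gz p));
       return_pmf
         \<lparr>sol_x = (1 - \<alpha>) *\<^sub>R y + \<alpha> *\<^sub>R z, sol_y = y, sol_z = z,
          err = (\<lambda>p. (1 - \<alpha>) *\<^sub>R m_y p + \<alpha> *\<^sub>R m_z p), err_y = m_y, err_z = m_z\<rparr>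
     }"

text \<open>The joint distribution of the state after \<open>t\<close> rounds; round \<open>t\<close> uses \<open>\<eta>\<^sub>t, \<lambda>\<^sub>t, \<alpha>\<^sub>t, \<beta>\<^sub>t\<close> for \<open>t \<ge> 1\<close>.\<close>

fun s_snag_ef ::
  "nat \<Rightarrow> nat \<Rightarrow> nat \<Rightarrow> (nat \<Rightarrow> nat \<Rightarrow> fvec \<Rightarrow> real) \<Rightarrow> fvec \<Rightarrow> nat \<Rightarrow> real \<Rightarrow>
   (nat \<Rightarrow> real) \<Rightarrow> (nat \<Rightarrow> real) \<Rightarrow> (nat \<Rightarrow> real) \<Rightarrow> (nat \<Rightarrow> real) \<Rightarrow> nat \<Rightarrow> snag_state pmf" where
  "s_snag_ef d N P f x_in k \<gamma> \<eta> lam \<alpha> \<beta> 0 = return_pmf (snag_init x_in)"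
| "s_snag_ef d N P f x_in k \<gamma> \<eta> lam \<alpha> \<beta> (Suc t) =
     s_snag_ef d N P f x_in k \<gamma> \<eta> lam \<alpha> \<beta> t \<bind>
       snag_step d N P f k \<gamma> (\<eta> (Suc t)) (lam (Suc t)) (\<alpha> (Suc t)) (\<beta> (Suc t))"


section \<open>The complexity bound\<close>

text \<open>
  The logarithmic factors hidden in the \<open>O\<close>-tilde notation are powers (with an absolute exponent) of the
  following quantity, where \<open>R\<close> stands for the distance of the starting point from the minimizer.  The
  summand \<open>exp 1\<close> makes it at least \<open>1\<close>; the summand \<open>1 / \<mu>\<close> makes it control \<open>ln (1 / \<mu>)\<close> as well.
\<close>

definition log_factor ::
  "real \<Rightarrow> real \<Rightarrow> real \<Rightarrow> nat \<Rightarrow> nat \<Rightarrow> nat \<Rightarrow> real \<Rightarrow> real \<Rightarrow> real" where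
  "log_factor L \<mu> V P d k \<epsilon> R =
     ln (exp 1 + L + \<mu> + 1 / \<mu> + V + real P + real d + real k + 1 / \<epsilon> + R)"

definition complexity ::
  "real \<Rightarrow> real \<Rightarrow> real \<Rightarrow> nat \<Rightarrow> nat \<Rightarrow> nat \<Rightarrow> real \<Rightarrow> real" where
  "complexity L \<mu> V P d k \<epsilon> =
     sqrt (L / \<mu>)
     + V / real P * (1 / (\<mu> * \<epsilon>))
     + real d / real k
     + real d powr (3/2) / (real k powr (3/2) * sqrt (real P)) * sqrt (L / \<mu>)
     + real d powr (4/3) / (real k powr (4/3) * real P powr (1/3))
         * (L powr (2/3) / \<mu> powr (2/3))
     + real d / (real k * real P powr (1/4))
         * ((L\<^sup>2 * V) powr (1/4) / (\<mu> powr (3/4) * \<epsilon> powr (1/4)))"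

end

(*
  Without the accumulated compression errors, the solutions follow Nesterov's accelerated method with
  stochastic gradients that are evaluated at a point perturbed by the averaged error.  An inexact
  gradient costs O(lam L^2 |error|^2) per round in the usual potential, which contracts at rate
  lam mu / 4 and also gains eta/8 |grad F|^2.  The errors contract at the faster rate gamma / 4; since
  the compressions are unbiased and independent across workers, the noise that enters them is
  O(eta^2 (|grad F|^2 + V) / (gamma^3 P)).  For eta small enough the gain in |grad F|^2 absorbs the
  first part of this noise, and the second part only contributes to the stationary accuracy.
*)
theory Submission
  imports Defs
begin

section \<open>Expectations over finitely supported distributions\<close>

text \<open>The six terms of \<open>complexity\<close> are six upper bounds on one scale, s =
  sqrt(\<eta> \<mu>), at which the solutions contract at rate s/8. The term sqrt(L/\<mu>) is the
  smoothness condition \<eta> L \<le> 1/4, and d/k makes the errors contract faster than the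
  solutions. The terms with d^(3/2) and d^(4/3) keep the error noise below the gradient gain for two
  different weights of the error: L, needed to evaluate F at \<open>sol_x\<close> rather than at the
  error-corrected point, and lam L^2/\<gamma>, its accumulated weight in the potential. The two
  terms with \<epsilon> are the stationary effect of V, once directly and once through the errors.
  The power \<gamma>^3 comes from the z-errors: their noise scales with lam^2, far above \<eta>^2,
  but they reach the gradients only through the mixing weight \<alpha>. A small weight on them
  compensates this, at the price of a factor 1/\<gamma>^2 on top of the compression variance of
  order 1/\<gamma>. The final constant may depend on c, but on nothing else: 1/s is taken as
  \<open>complexity\<close> times 100/c^2.\<close>

abbreviation expect :: "'a pmf \<Rightarrow> ('a \<Rightarrow> real) \<Rightarrow> real" where
  "expect p f \<equiv> measure_pmf.expectation p f"

abbreviation finite_pmf :: "'a pmf \<Rightarrow> bool" where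
  "finite_pmf p \<equiv> finite (set_pmf p)"

lemma expect_add:
  "finite_pmf p \<Longrightarrow> expect p (\<lambda>x. f x + g x) = expect p f + expect p g"
  by (intro Bochner_Integration.integral_add integrable_measure_pmf_finite)

lemma expect_diff:
  "finite_pmf p \<Longrightarrow> expect p (\<lambda>x. f x - g x) = expect p f - expect p g"
  by (intro Bochner_Integration.integral_diff integrable_measure_pmf_finite)

lemma expect_sum:
  "finite_pmf p \<Longrightarrow> expect p (\<lambda>x. \<Sum>i\<in>A. f i x) = (\<Sum>i\<in>A. expect p (f i))"
  by (intro Bochner_Integration.integral_sum integrable_measure_pmf_finite)

lemma expect_mono:
  assumes "finite_pmf p" "\<And>x. x \<in> set_pmf p \<Longrightarrow> f x \<le> g x"
  shows "expect p f \<le> expect p g"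
  using assms by (intro integral_mono_AE integrable_measure_pmf_finite) (auto simp: AE_measure_pmf_iff)

lemma expect_cong:
  assumes "\<And>x. x \<in> set_pmf p \<Longrightarrow> f x = g x"
  shows "expect p f = expect p g"
  using assms by (intro integral_cong_AE) (auto simp: AE_measure_pmf_iff)

lemma expect_bind:
  assumes "finite_pmf p" "\<And>x. x \<in> set_pmf p \<Longrightarrow> finite_pmf (f x)"
  shows "expect (p \<bind> f) h = expect p (\<lambda>x. expect (f x) h)"
  by (subst pmf_expectation_bind[OF assms(1)])
     (use assms in \<open>auto simp: integral_measure_pmf[OF assms(1)]\<close>)

lemma finite_pmf_Pi_pmf:
  assumes "finite A" "\<And>i. i \<in> A \<Longrightarrow> finite_pmf (p i)"
  shows "finite_pmf (Pi_pmf A dflt p)"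
  unfolding set_Pi_pmf[OF assms(1)] using assms by (intro finite_PiE_dflt) auto

lemma expect_Pi_pmf_component:
  assumes "finite A" "i \<in> A"
  shows "expect (Pi_pmf A dflt p) (\<lambda>y. f (y i)) = expect (p i) f"
proof -
  have "expect (p i) f = expect (map_pmf (\<lambda>y. y i) (Pi_pmf A dflt p)) f"
    using assms by (simp add: Pi_pmf_component)
  then show ?thesis by simp
qed

text \<open>
  The expectation of a vector valued function is expressed weakly, through inner products, because
  Bochner integrals are only available in complete spaces.
\<close>

lemma expect_norm_add_power2:
  fixes \<phi> :: "'a \<Rightarrow> 'b::real_inner"
  assumes fin: "finite_pmf p" and mean: "\<And>v. expect p (\<lambda>y. inner (\<phi> y) v) = 0"
  shows "expect p (\<lambda>y. (norm (a + \<phi> y))\<^sup>2) = (norm a)\<^sup>2 + expect p (\<lambda>y. (norm (\<phi> y))\<^sup>2)"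
proof -
  have "expect p (\<lambda>y. (norm (a + \<phi> y))\<^sup>2)
      = expect p (\<lambda>y. ((norm a)\<^sup>2 + 2 * inner (\<phi> y) a) + (norm (\<phi> y))\<^sup>2)"
    by (intro expect_cong) (simp add: power2_norm_eq_inner inner_simps inner_commute)
  also have "\<dots> = (norm a)\<^sup>2 + 2 * expect p (\<lambda>y. inner (\<phi> y) a) + expect p (\<lambda>y. (norm (\<phi> y))\<^sup>2)"
    by (simp add: expect_add[OF fin])
  finally show ?thesis by (simp add: mean)
qed

text \<open>Independence and zero means remove every cross term. The base point \<open>a\<close>
  varies in the induction because a draw that is split off the product becomes part of the base
  point for the remaining factors.\<close>

lemma expect_norm_sum_power2:
  fixes \<phi> :: "'i \<Rightarrow> 'a \<Rightarrow> 'b::real_inner"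
  assumes A: "finite A" and fin: "\<And>i. i \<in> A \<Longrightarrow> finite_pmf (p i)"
    and mean: "\<And>i v. i \<in> A \<Longrightarrow> expect (p i) (\<lambda>y. inner (\<phi> i y) v) = 0"
  shows "expect (Pi_pmf A dflt p) (\<lambda>y. (norm (a + (\<Sum>i\<in>A. \<phi> i (y i))))\<^sup>2)
       = (norm a)\<^sup>2 + (\<Sum>i\<in>A. expect (p i) (\<lambda>y. (norm (\<phi> i y))\<^sup>2))"
  using assms
proof (induction A arbitrary: a rule: finite_induct)
  case empty
  then show ?case by simp
next
  case (insert x A)
  have finA: "finite_pmf (Pi_pmf A dflt p)"
    using insert by (intro finite_pmf_Pi_pmf) auto
  have *: "(\<Sum>i\<in>insert x A. \<phi> i ((f(x := y)) i)) = \<phi> x y + (\<Sum>i\<in>A. \<phi> i (f i))" for f y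
    using insert by (auto intro!: sum.cong)
  have "expect (Pi_pmf (insert x A) dflt p) (\<lambda>y. (norm (a + (\<Sum>i\<in>insert x A. \<phi> i (y i))))\<^sup>2)
     = expect (p x) (\<lambda>y. expect (Pi_pmf A dflt p)
         (\<lambda>f. (norm ((a + \<phi> x y) + (\<Sum>i\<in>A. \<phi> i (f i))))\<^sup>2))"
    unfolding Pi_pmf_insert'[OF insert.hyps]
    using insert finA by (subst expect_bind, simp, simp)+ (simp add: * add.assoc del: fun_upd_apply sum.insert)
  also have "\<dots> = expect (p x) (\<lambda>y. (norm (a + \<phi> x y))\<^sup>2)
      + (\<Sum>i\<in>A. expect (p i) (\<lambda>y. (norm (\<phi> i y))\<^sup>2))"
    using insert by (simp add: insert.IH expect_add)
  also have "\<dots> = (norm a)\<^sup>2 + (\<Sum>i\<in>insert x A. expect (p i) (\<lambda>y. (norm (\<phi> i y))\<^sup>2))"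
    using insert by (simp add: expect_norm_add_power2)
  finally show ?case .
qed

section \<open>Random compression\<close>

text \<open>Deleting \<open>j\<close> matches these sets with the subsets of size
  \<open>q - 1\<close> of the other \<open>d - 1\<close> coordinates; binomial absorption does the
  rest.\<close>

lemma card_subsets_containing:
  assumes "j \<in> {1..d::nat}" "1 \<le> q"
  shows "real (card {J. J \<subseteq> {1..d} \<and> card J = q \<and> j \<in> J}) * real d = real q * real (d choose q)"
proof -
  have "bij_betw (insert j) {B. B \<subseteq> {1..d} - {j} \<and> card B = q - 1}
          {J. J \<subseteq> {1..d} \<and> card J = q \<and> j \<in> J}"
  proof (rule bij_betwI[where g = "\<lambda>J. J - {j}"])
    show "insert j \<in> {B. B \<subseteq> {1..d} - {j} \<and> card B = q - 1} \<rightarrow> {J. J \<subseteq> {1..d} \<and> card J = q \<and> j \<in> J}"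
    proof
      fix B assume B: "B \<in> {B. B \<subseteq> {1..d} - {j} \<and> card B = q - 1}"
      then have "finite B" "j \<notin> B" using finite_subset by auto
      with B assms show "insert j B \<in> {J. J \<subseteq> {1..d} \<and> card J = q \<and> j \<in> J}" by auto
    qed
  qed (use assms in auto)
  then have "card {J. J \<subseteq> {1..d} \<and> card J = q \<and> j \<in> J} = (d - 1) choose (q - 1)"
    using assms by (simp add: bij_betw_same_card[symmetric] n_subsets)
  moreover have "d * ((d - 1) choose (q - 1)) = q * (d choose q)"
    using assms binomial_absorption[of "q - 1" d] by simp
  ultimately show ?thesis
    by (metis mult.commute of_nat_mult)
qed

lemma coord_scaled_restriction:
  "coord (scaled_restriction a J x) j = (if j \<in> J then a * coord x j else 0)"
  by transfer simp

lemma scaled_restriction_Rd: "x \<in> Rd d \<Longrightarrow> scaled_restriction a J x \<in> Rd d"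
  by (auto simp: Rd_def coord_scaled_restriction)

context
  fixes d q :: nat
  assumes q: "1 \<le> q" "q \<le> d"
begin

lemma subsets_finite_nonempty:
  "finite {J. J \<subseteq> {1..d} \<and> card J = q}" "{J. J \<subseteq> {1..d} \<and> card J = q} \<noteq> {}"
proof -
  show "finite {J. J \<subseteq> {1..d} \<and> card J = q}" by (rule finite_subset[of _ "Pow {1..d}"]) auto
  have "{1..q} \<in> {J. J \<subseteq> {1..d} \<and> card J = q}" using q by auto
  then show "{J. J \<subseteq> {1..d} \<and> card J = q} \<noteq> {}" by blast
qed

lemma set_pmf_rand_comp:
  "set_pmf (rand_comp d x q)
     = (\<lambda>J. scaled_restriction (real d / real q) J x) ` {J. J \<subseteq> {1..d} \<and> card J = q}"
  using subsets_finite_nonempty by (simp add: rand_comp_def)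

lemma finite_pmf_rand_comp: "finite_pmf (rand_comp d x q)"
  using subsets_finite_nonempty by (simp add: set_pmf_rand_comp)

lemma rand_comp_Rd: "x \<in> Rd d \<Longrightarrow> y \<in> set_pmf (rand_comp d x q) \<Longrightarrow> y \<in> Rd d"
  by (auto simp: set_pmf_rand_comp scaled_restriction_Rd)

lemma prob_coordinate_kept:
  assumes "j \<in> {1..d}"
  shows "expect (pmf_of_set {J. J \<subseteq> {1..d} \<and> card J = q}) (\<lambda>J. if j \<in> J then b else 0)
       = real q / real d * b"
proof -
  let ?S = "{J. J \<subseteq> {1..d} \<and> card J = q}"
  have card: "card ?S = d choose q" by (simp add: n_subsets)
  have "expect (pmf_of_set ?S) (\<lambda>J. if j \<in> J then b else 0)
      = (\<Sum>J\<in>?S. if j \<in> J then b else 0) / real (card ?S)"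
    using subsets_finite_nonempty by (simp add: integral_pmf_of_set)
  also have "(\<Sum>J\<in>?S. if j \<in> J then b else 0) = real (card {J \<in> ?S. j \<in> J}) * b"
    using subsets_finite_nonempty(1) by (subst sum.inter_filter[symmetric]) auto
  also have "{J \<in> ?S. j \<in> J} = {J. J \<subseteq> {1..d} \<and> card J = q \<and> j \<in> J}" by auto
  also have "real (card \<dots>) = real q * real (d choose q) / real d"
    using card_subsets_containing[OF assms q(1)] q by (simp add: field_simps)
  finally show ?thesis using q by (simp add: card[simplified] field_simps)
qed

lemma expect_inner_rand_comp:
  assumes x: "x \<in> Rd d"
  shows "expect (rand_comp d x q) (\<lambda>y. inner y v) = inner x v"
proof -
  let ?p = "pmf_of_set {J. J \<subseteq> {1..d} \<and> card J = q}"
  have fin: "finite_pmf ?p" using subsets_finite_nonempty by simp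
  have "expect (rand_comp d x q) (\<lambda>y. inner y v)
      = expect ?p (\<lambda>J. \<Sum>j=1..d. if j \<in> J then real d / real q * coord x j * coord v j else 0)"
    unfolding rand_comp_def integral_map_pmf
    by (intro expect_cong, subst inner_Rd[OF scaled_restriction_Rd[OF x]])
       (auto intro!: sum.cong simp: coord_scaled_restriction)
  also have "\<dots> = (\<Sum>j=1..d. real q / real d * (real d / real q * coord x j * coord v j))"
    by (simp add: expect_sum[OF fin] prob_coordinate_kept del: One_nat_def times_divide_eq_right times_divide_eq_left)
  also have "\<dots> = inner x v"
    using q by (simp add: inner_Rd[OF x])
  finally show ?thesis .
qed

text \<open>The square of a kept coordinate is inflated by (d/q)^2, but it is kept only with
  probability q/d.\<close>

lemma expect_norm_rand_comp:
  assumes x: "x \<in> Rd d"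
  shows "expect (rand_comp d x q) (\<lambda>y. (norm y)\<^sup>2) = real d / real q * (norm x)\<^sup>2"
proof -
  let ?p = "pmf_of_set {J. J \<subseteq> {1..d} \<and> card J = q}"
  have fin: "finite_pmf ?p" using subsets_finite_nonempty by simp
  have "expect (rand_comp d x q) (\<lambda>y. (norm y)\<^sup>2)
      = expect ?p (\<lambda>J. \<Sum>j=1..d. if j \<in> J then (real d / real q)\<^sup>2 * (coord x j)\<^sup>2 else 0)"
    unfolding rand_comp_def integral_map_pmf power2_norm_eq_inner
    by (intro expect_cong, subst inner_Rd[OF scaled_restriction_Rd[OF x]])
       (auto intro!: sum.cong simp: coord_scaled_restriction power2_eq_square)
  also have "\<dots> = (\<Sum>j=1..d. real q / real d * ((real d / real q)\<^sup>2 * (coord x j)\<^sup>2))"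
    by (simp add: expect_sum[OF fin] prob_coordinate_kept del: One_nat_def times_divide_eq_right times_divide_eq_left)
  also have "\<dots> = real d / real q * (norm x)\<^sup>2"
    unfolding power2_norm_eq_inner inner_Rd[OF x] sum_distrib_left
    using q by (intro sum.cong) (auto simp: power2_eq_square)
  finally show ?thesis .
qed

lemma expect_inner_rand_comp_error:
  assumes "x \<in> Rd d"
  shows "expect (rand_comp d x q) (\<lambda>y. inner (y - x) v) = 0"
  by (simp add: inner_diff_left expect_diff[OF finite_pmf_rand_comp] expect_inner_rand_comp[OF assms])

text \<open>Unbiasedness splits the second moment into the squared norm of \<open>x\<close> and the
  variance. The exact factor is thus d/q - 1, and the -1 is given away.\<close>

lemma expect_norm_rand_comp_error:
  assumes x: "x \<in> Rd d"
  shows "expect (rand_comp d x q) (\<lambda>y. (norm (y - x))\<^sup>2) \<le> real d / real q * (norm x)\<^sup>2"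
proof -
  have "real d / real q * (norm x)\<^sup>2 = expect (rand_comp d x q) (\<lambda>y. (norm (x + (y - x)))\<^sup>2)"
    by (simp add: expect_norm_rand_comp[OF x])
  also have "\<dots> = (norm x)\<^sup>2 + expect (rand_comp d x q) (\<lambda>y. (norm (y - x))\<^sup>2)"
    by (intro expect_norm_add_power2 finite_pmf_rand_comp expect_inner_rand_comp_error x)
  finally show ?thesis by simp
qed

end

section \<open>Families of error vectors\<close>

definition fam_avg :: "nat \<Rightarrow> (nat \<Rightarrow> fvec) \<Rightarrow> fvec" where
  "fam_avg P M = (1 / real P) *\<^sub>R (\<Sum>p=1..P. M p)"

text \<open>
  The squared norm that contracts for the compression errors: the average is what perturbs the
  gradients, but its noise is fed by all single errors, with the weight \<open>1/P\<^sup>2\<close> that the independence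
  of the workers gives.
\<close>

definition fam_sq :: "nat \<Rightarrow> (nat \<Rightarrow> fvec) \<Rightarrow> real" where
  "fam_sq P M = (norm (fam_avg P M))\<^sup>2 + (1 / (real P)\<^sup>2) * (\<Sum>p=1..P. (norm (M p))\<^sup>2)"

lemma fam_avg_add: "fam_avg P (\<lambda>p. M p + M' p) = fam_avg P M + fam_avg P M'"
  by (simp add: fam_avg_def sum.distrib scaleR_add_right)

lemma fam_avg_diff: "fam_avg P (\<lambda>p. M p - M' p) = fam_avg P M - fam_avg P M'"
  by (simp add: fam_avg_def sum_subtractf scaleR_diff_right)

lemma fam_avg_scaleR: "fam_avg P (\<lambda>p. c *\<^sub>R M p) = c *\<^sub>R fam_avg P M"
  by (simp add: fam_avg_def scaleR_sum_right mult.commute)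

lemma fam_avg_Rd:
  assumes "\<And>p. p \<in> {1..P} \<Longrightarrow> M p \<in> Rd d"
  shows "fam_avg P M \<in> Rd d"
  unfolding fam_avg_def using assms by (intro subspace_scale subspace_sum subspace_Rd) auto

lemma norm_fam_avg_le_fam_sq: "(norm (fam_avg P M))\<^sup>2 \<le> fam_sq P M"
  by (simp add: fam_sq_def sum_nonneg)

lemma sum_norm_le_fam_sq: "(1 / (real P)\<^sup>2) * (\<Sum>p=1..P. (norm (M p))\<^sup>2) \<le> fam_sq P M"
  by (simp add: fam_sq_def)

lemma fam_sq_nonneg: "0 \<le> fam_sq P M"
  by (simp add: fam_sq_def sum_nonneg)

lemma fam_sq_zero: "fam_sq P (\<lambda>_. 0) = 0"
  by (simp add: fam_sq_def fam_avg_def)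

lemma fam_sq_scaleR: "fam_sq P (\<lambda>p. c *\<^sub>R M p) = c\<^sup>2 * fam_sq P M"
  by (simp add: fam_sq_def fam_avg_scaleR power_mult_distrib sum_distrib_left distrib_left mult_ac)

text \<open>\<open>fam_sq\<close> is a nonnegative combination of squared norms of vectors that
  depend linearly on the family, so a quadratic inequality for single vectors carries over with the
  same constants.\<close>

lemma fam_sq_lincomb_le:
  assumes norm_le: "\<And>x y :: fvec. (norm (a *\<^sub>R x + b *\<^sub>R y))\<^sup>2 \<le> A * (norm x)\<^sup>2 + B * (norm y)\<^sup>2"
  shows "fam_sq P (\<lambda>p. a *\<^sub>R M p + b *\<^sub>R M' p) \<le> A * fam_sq P M + B * fam_sq P M'"
proof -
  have "(\<Sum>p=1..P. (norm (a *\<^sub>R M p + b *\<^sub>R M' p))\<^sup>2)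
      \<le> (\<Sum>p=1..P. A * (norm (M p))\<^sup>2 + B * (norm (M' p))\<^sup>2)"
    by (intro sum_mono norm_le)
  also have "\<dots> = A * (\<Sum>p=1..P. (norm (M p))\<^sup>2) + B * (\<Sum>p=1..P. (norm (M' p))\<^sup>2)"
    by (simp add: sum.distrib sum_distrib_left)
  finally have "(1 / (real P)\<^sup>2) * (\<Sum>p=1..P. (norm (a *\<^sub>R M p + b *\<^sub>R M' p))\<^sup>2)
     \<le> (1 / (real P)\<^sup>2) * (A * (\<Sum>p=1..P. (norm (M p))\<^sup>2) + B * (\<Sum>p=1..P. (norm (M' p))\<^sup>2))"
    by (intro mult_left_mono) auto
  with norm_le[of "fam_avg P M" "fam_avg P M'"] show ?thesis
    by (simp add: fam_sq_def fam_avg_add fam_avg_scaleR algebra_simps)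
qed

lemma norm_add_young:
  fixes x y :: "'a::real_inner"
  assumes "s > 0"
  shows "(norm (x + y))\<^sup>2 \<le> (1 + s) * (norm x)\<^sup>2 + (1 + 1 / s) * (norm y)\<^sup>2"
proof -
  have "0 \<le> (1 / s) * (norm (s *\<^sub>R x - y))\<^sup>2" using assms by simp
  also have "\<dots> = s * (norm x)\<^sup>2 - 2 * inner x y + (1 / s) * (norm y)\<^sup>2"
    using assms by (simp add: power2_norm_eq_inner inner_simps inner_commute field_simps)
  finally show ?thesis
    by (simp add: power2_norm_eq_inner inner_simps inner_commute algebra_simps)
qed

lemma norm_convex_comb:
  fixes x y :: "'a::real_inner"
  assumes "0 \<le> b" "b \<le> 1"
  shows "(norm ((1 - b) *\<^sub>R x + b *\<^sub>R y))\<^sup>2 \<le> (1 - b) * (norm x)\<^sup>2 + b * (norm y)\<^sup>2"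
proof -
  have "0 \<le> b * (1 - b) * (norm (x - y))\<^sup>2" using assms by simp
  also have "\<dots> = (1 - b) * (norm x)\<^sup>2 + b * (norm y)\<^sup>2 - (norm ((1 - b) *\<^sub>R x + b *\<^sub>R y))\<^sup>2"
    by (simp add: power2_norm_eq_inner inner_simps inner_commute algebra_simps)
  finally show ?thesis by simp
qed

lemma fam_sq_convex_comb:
  assumes "0 \<le> b" "b \<le> 1"
  shows "fam_sq P (\<lambda>p. (1 - b) *\<^sub>R M p + b *\<^sub>R M' p) \<le> (1 - b) * fam_sq P M + b * fam_sq P M'"
  by (intro fam_sq_lincomb_le norm_convex_comb assms)

lemma fam_sq_young:
  assumes "s > 0"
  shows "fam_sq P (\<lambda>p. a *\<^sub>R M p + b *\<^sub>R M' p)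
    \<le> (1 + s) * a\<^sup>2 * fam_sq P M + (1 + 1 / s) * b\<^sup>2 * fam_sq P M'"
proof (rule fam_sq_lincomb_le)
  fix x y :: fvec
  show "(norm (a *\<^sub>R x + b *\<^sub>R y))\<^sup>2 \<le> (1 + s) * a\<^sup>2 * (norm x)\<^sup>2 + (1 + 1 / s) * b\<^sup>2 * (norm y)\<^sup>2"
    using norm_add_young[OF assms, of "a *\<^sub>R x" "b *\<^sub>R y"]
    by (simp add: power_mult_distrib mult.assoc)
qed

text \<open>Averaging independent noises multiplies the sum of their variances by 1/P^2, which is
  exactly the weight of the single errors in \<open>fam_sq\<close>. The same noise term therefore
  appears twice, hence the factor 2.\<close>

lemma expect_fam_sq:
  assumes fin: "\<And>p. p \<in> {1..P} \<Longrightarrow> finite_pmf (D p)"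
    and mean: "\<And>p v. p \<in> {1..P} \<Longrightarrow> expect (D p) (\<lambda>y. inner (\<phi> p y) v) = 0"
  shows "expect (Pi_pmf {1..P} dflt D) (\<lambda>y. fam_sq P (\<lambda>p. C p + \<phi> p (y p)))
       = fam_sq P C + 2 / (real P)\<^sup>2 * (\<Sum>p=1..P. expect (D p) (\<lambda>y. (norm (\<phi> p y))\<^sup>2))"
proof -
  let ?D = "Pi_pmf {1..P} dflt D"
  have finD: "finite_pmf ?D" by (intro finite_pmf_Pi_pmf fin) auto
  have "expect ?D (\<lambda>y. (norm (fam_avg P (\<lambda>p. C p + \<phi> p (y p))))\<^sup>2)
      = expect ?D (\<lambda>y. (norm (fam_avg P C + (\<Sum>p=1..P. (1 / real P) *\<^sub>R \<phi> p (y p))))\<^sup>2)"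
    by (simp add: fam_avg_add) (simp add: fam_avg_def scaleR_sum_right)
  also have "\<dots> = (norm (fam_avg P C))\<^sup>2
      + (\<Sum>p=1..P. expect (D p) (\<lambda>y. (norm ((1 / real P) *\<^sub>R \<phi> p y))\<^sup>2))"
    by (intro expect_norm_sum_power2) (use fin mean in auto)
  also have "\<dots> = (norm (fam_avg P C))\<^sup>2
      + 1 / (real P)\<^sup>2 * (\<Sum>p=1..P. expect (D p) (\<lambda>y. (norm (\<phi> p y))\<^sup>2))"
    by (simp add: power_divide sum_divide_distrib)
  finally have 1: "expect ?D (\<lambda>y. (norm (fam_avg P (\<lambda>p. C p + \<phi> p (y p))))\<^sup>2)
      = (norm (fam_avg P C))\<^sup>2
      + 1 / (real P)\<^sup>2 * (\<Sum>p=1..P. expect (D p) (\<lambda>y. (norm (\<phi> p y))\<^sup>2))" .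
  have "expect ?D (\<lambda>y. \<Sum>p=1..P. (norm (C p + \<phi> p (y p)))\<^sup>2)
      = (\<Sum>p=1..P. expect (D p) (\<lambda>y. (norm (C p + \<phi> p y))\<^sup>2))"
    unfolding expect_sum[OF finD]
    by (intro sum.cong refl expect_Pi_pmf_component[where f = "\<lambda>y. (norm (C _ + \<phi> _ y))\<^sup>2"]) auto
  also have "\<dots> = (\<Sum>p=1..P. (norm (C p))\<^sup>2 + expect (D p) (\<lambda>y. (norm (\<phi> p y))\<^sup>2))"
    by (intro sum.cong refl expect_norm_add_power2 fin mean)
  finally have 2: "expect ?D (\<lambda>y. \<Sum>p=1..P. (norm (C p + \<phi> p (y p)))\<^sup>2)
      = (\<Sum>p=1..P. (norm (C p))\<^sup>2) + (\<Sum>p=1..P. expect (D p) (\<lambda>y. (norm (\<phi> p y))\<^sup>2))"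
    by (simp add: sum.distrib)
  show ?thesis
    unfolding fam_sq_def expect_add[OF finD] integral_mult_right_zero 1 2
    by (simp add: algebra_simps add_divide_distrib)
qed

section \<open>The objective and its stochastic gradients\<close>

lemma expect_inner_centered:
  fixes w :: "nat \<Rightarrow> 'b::real_inner"
  assumes "N > 0"
  shows "expect (pmf_of_set {1..N}) (\<lambda>i. inner (w i - (1 / real N) *\<^sub>R (\<Sum>i=1..N. w i)) v) = 0"
  using assms
  by (simp add: integral_pmf_of_set inner_diff_left sum_subtractf inner_sum_left)

locale snag_problem =
  fixes d N P :: nat and L \<mu> V :: real and f :: "nat \<Rightarrow> nat \<Rightarrow> fvec \<Rightarrow> real" and x_star :: fvec
  assumes d_pos: "d > 0" and N_pos: "N > 0" and P_pos: "P > 0" and L_pos: "L > 0" and mu_pos: "\<mu> > 0"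
    and differentiable: "\<And>i p. i \<in> {1..N} \<Longrightarrow> p \<in> {1..P} \<Longrightarrow> f i p differentiable_on Rd d"
    and x_star_Rd: "x_star \<in> Rd d"
    and minimizer: "\<And>x. x \<in> Rd d \<Longrightarrow> objective N P f x_star \<le> objective N P f x"
    and smooth: "smooth d L (objective N P f)"
    and variance: "bounded_variance d N P V f"
    and strongly_convex: "strongly_convex d \<mu> (objective N P f)"
begin

abbreviation F :: "fvec \<Rightarrow> real" where "F \<equiv> objective N P f"

abbreviation gF :: "fvec \<Rightarrow> fvec" where "gF \<equiv> grad d F"

definition stoch_grad :: "fvec \<Rightarrow> (nat \<Rightarrow> nat) \<Rightarrow> nat \<Rightarrow> fvec" where
  "stoch_grad x i = (\<lambda>p. grad d (f (i p) p) x)"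

definition sampling :: "(nat \<Rightarrow> nat) pmf" where
  "sampling = Pi_pmf {1..P} 0 (\<lambda>p. pmf_of_set {1..N})"

lemma finite_pmf_sampling: "finite_pmf sampling"
  unfolding sampling_def using N_pos by (intro finite_pmf_Pi_pmf) auto

lemma sampling_range:
  assumes "i \<in> set_pmf sampling" "p \<in> {1..P}"
  shows "i p \<in> {1..N}"
proof -
  have "i \<in> PiE_dflt {1..P} 0 (set_pmf \<circ> (\<lambda>p. pmf_of_set {1..N}))"
    using assms(1) by (simp add: sampling_def set_Pi_pmf)
  then have "i p \<in> set_pmf (pmf_of_set {1..N})"
    using assms(2) by (auto simp: PiE_dflt_def)
  then show ?thesis using N_pos by simp
qed

lemma grad_component:
  assumes "x \<in> Rd d" "i \<in> {1..N}" "p \<in> {1..P}"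
  shows "grad d (f i p) x \<in> Rd d" "(f i p has_derivative inner (grad d (f i p) x)) (at x within Rd d)"
  using grad_works[OF assms(1), of "f i p"] differentiable[OF assms(2,3)] assms(1)
  by (auto simp: differentiable_on_def)

lemma stoch_grad_Rd:
  "x \<in> Rd d \<Longrightarrow> i \<in> set_pmf sampling \<Longrightarrow> p \<in> {1..P} \<Longrightarrow> stoch_grad x i p \<in> Rd d"
  unfolding stoch_grad_def by (intro grad_component sampling_range)

lemma gF_eq:
  assumes x: "x \<in> Rd d"
  shows "gF x = fam_avg P (\<lambda>p. (1 / real N) *\<^sub>R (\<Sum>i=1..N. grad d (f i p) x))" (is "_ = ?g")
proof (rule grad_eqI[OF x])
  show "?g \<in> Rd d"
    by (intro fam_avg_Rd subspace_scale subspace_sum subspace_Rd grad_component x)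
  have "(F has_derivative (\<lambda>v. (1 / real P) * (\<Sum>p=1..P. (1 / real N) * (\<Sum>i=1..N. inner (grad d (f i p) x) v))))
     (at x within Rd d)"
    unfolding objective_def
    by (intro has_derivative_mult_right has_derivative_sum grad_component x)
  also have "(\<lambda>v. (1 / real P) * (\<Sum>p=1..P. (1 / real N) * (\<Sum>i=1..N. inner (grad d (f i p) x) v))) = inner ?g"
    by (simp add: fam_avg_def inner_sum_left fun_eq_iff)
  finally show "(F has_derivative inner ?g) (at x within Rd d)" .
qed

lemma gF_Rd: "x \<in> Rd d \<Longrightarrow> gF x \<in> Rd d"
  unfolding gF_eq by (intro fam_avg_Rd subspace_scale subspace_sum subspace_Rd grad_component)

lemma gF_lipschitz: "x \<in> Rd d \<Longrightarrow> y \<in> Rd d \<Longrightarrow> norm (gF x - gF y) \<le> L * norm (x - y)"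
  using smooth by (simp add: smooth_def)

lemma F_strongly_convex:
  "x \<in> Rd d \<Longrightarrow> y \<in> Rd d \<Longrightarrow> F x + inner (gF x) (y - x) + \<mu> / 2 * (norm (x - y))\<^sup>2 \<le> F y"
  using strongly_convex by (fastforce simp: strongly_convex_def)

lemma F_convex: "x \<in> Rd d \<Longrightarrow> y \<in> Rd d \<Longrightarrow> F x + inner (gF x) (y - x) \<le> F y"
  using F_strongly_convex[of x y] mu_pos by (smt (verit) mult_nonneg_nonneg zero_le_power2 divide_nonneg_pos)

text \<open>
  Using convexity at \<open>y\<close> instead of integrating the gradient along a segment costs a factor 2 in the
  quadratic term.
\<close>

lemma F_descent:
  assumes "x \<in> Rd d" "y \<in> Rd d"
  shows "F y \<le> F x + inner (gF x) (y - x) + L * (norm (y - x))\<^sup>2"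
proof -
  have "F y \<le> F x + inner (gF y) (y - x)"
    using F_convex[OF assms(2,1)] by (simp add: inner_diff_right)
  also have "inner (gF y) (y - x) = inner (gF x) (y - x) + inner (gF y - gF x) (y - x)"
    by (simp add: inner_diff_left)
  also have "inner (gF y - gF x) (y - x) \<le> norm (gF y - gF x) * norm (y - x)"
    by (rule norm_cauchy_schwarz)
  also have "\<dots> \<le> L * norm (y - x) * norm (y - x)"
    by (intro mult_right_mono gF_lipschitz assms) auto
  finally show ?thesis by (simp add: power2_eq_square)
qed

text \<open>A step of length 1/(2L) along the negative gradient minimises the bound of
  \<open>F_descent\<close>, and the value reached cannot fall below the minimum. The constant 4
  instead of the usual 2 is inherited from \<open>F_descent\<close>.\<close>

lemma norm_gF_le:
  assumes x: "x \<in> Rd d"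
  shows "(norm (gF x))\<^sup>2 \<le> 4 * L * (F x - F x_star)"
proof -
  let ?y = "x - (1 / (2 * L)) *\<^sub>R gF x"
  have y: "?y \<in> Rd d" by (intro subspace_diff subspace_scale subspace_Rd gF_Rd x)
  have "F x_star \<le> F ?y" by (rule minimizer[OF y])
  also have "\<dots> \<le> F x + inner (gF x) (?y - x) + L * (norm (?y - x))\<^sup>2" by (rule F_descent[OF x y])
  also have "\<dots> = F x - (norm (gF x))\<^sup>2 / (4 * L)"
    using L_pos by (simp add: power2_norm_eq_inner[symmetric] power_divide field_simps power2_eq_square)
  finally show ?thesis using L_pos by (simp add: field_simps)
qed

text \<open>\<open>norm_gF_le\<close> at \<open>x_star\<close> itself forces the gradient to vanish
  there, so the first-order term of \<open>F_descent\<close> disappears.\<close>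

lemma F_upper:
  assumes "x \<in> Rd d"
  shows "F x - F x_star \<le> L * (norm (x - x_star))\<^sup>2"
  using F_descent[OF x_star_Rd assms] norm_gF_le[OF x_star_Rd] by simp

text \<open>Strong convexity in both directions between two points bounds the gradient difference
  from below, smoothness bounds it from above. Two distinct points must exist; \<open>d > 0\<close>
  supplies the origin and a unit vector.\<close>

lemma mu_le_L: "\<mu> \<le> L"
proof -
  define v where "v = unit_fvec 1"
  have v: "v \<in> Rd d" unfolding v_def using d_pos by (intro unit_fvec_in_Rd) auto
  have z: "0 \<in> Rd d" using subspace_Rd by (rule subspace_0)
  have "coord v 1 \<noteq> 0" by (simp add: v_def coord_unit_fvec)
  then have "v \<noteq> 0" by auto
  have "\<mu> * (norm v)\<^sup>2 \<le> inner (gF v - gF 0) v"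
    using F_strongly_convex[OF z v] F_strongly_convex[OF v z] by (simp add: inner_diff_left)
  also have "\<dots> \<le> norm (gF v - gF 0) * norm v" by (rule norm_cauchy_schwarz)
  also have "\<dots> \<le> L * norm (v - 0) * norm v" by (intro mult_right_mono gF_lipschitz v z) auto
  finally show ?thesis using \<open>v \<noteq> 0\<close> by (simp add: power2_eq_square)
qed

lemma V_nonneg: "0 \<le> V"
proof -
  have "0 \<le> (1 / (real N * real P)) * (\<Sum>p=1..P. \<Sum>i=1..N. (norm (grad d (f i p) x_star - gF x_star))\<^sup>2)"
    by (intro mult_nonneg_nonneg sum_nonneg) auto
  also have "\<dots> \<le> V" using variance x_star_Rd by (simp add: bounded_variance_def)
  finally show ?thesis .
qed

lemma sum_variance_le:
  assumes "x \<in> Rd d"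
  shows "(\<Sum>p=1..P. (1 / real N) * (\<Sum>i=1..N. (norm (grad d (f i p) x - gF x))\<^sup>2)) \<le> real P * V"
proof -
  have "(1 / (real N * real P)) * (\<Sum>p=1..P. \<Sum>i=1..N. (norm (grad d (f i p) x - gF x))\<^sup>2) \<le> V"
    using variance assms by (simp add: bounded_variance_def)
  then show ?thesis
    unfolding sum_distrib_left[symmetric] using P_pos N_pos by (simp add: field_simps)
qed

lemma expect_component_sampling:
  assumes "p \<in> {1..P}"
  shows "expect sampling (\<lambda>i. \<psi> (i p)) = (1 / real N) * (\<Sum>i=1..N. \<psi> i)"
  unfolding sampling_def using assms N_pos
  by (subst expect_Pi_pmf_component[where f = \<psi>]) (auto simp: integral_pmf_of_set)

lemma expect_inner_stoch_grad:
  assumes x: "x \<in> Rd d"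
  shows "expect sampling (\<lambda>i. inner (fam_avg P (stoch_grad x i)) v) = inner (gF x) v"
proof -
  have "expect sampling (\<lambda>i. inner (fam_avg P (stoch_grad x i)) v)
      = (1 / real P) * (\<Sum>p=1..P. expect sampling (\<lambda>i. inner (grad d (f (i p) p) x) v))"
    by (simp add: fam_avg_def stoch_grad_def inner_sum_left expect_sum[OF finite_pmf_sampling])
  also have "\<dots> = (1 / real P) * (\<Sum>p=1..P. (1 / real N) * (\<Sum>i=1..N. inner (grad d (f i p) x) v))"
    by (intro arg_cong2[of _ _ _ _ "(*)"] sum.cong refl expect_component_sampling)
  also have "\<dots> = inner (gF x) v"
    by (simp add: gF_eq[OF x] fam_avg_def inner_sum_left)
  finally show ?thesis .
qed

text \<open>The mean gradients of the workers may differ, but they average exactly to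
  \<open>gF x\<close>. Only the sampling inside each worker contributes, and independence divides it
  by P.\<close>

lemma expect_norm_stoch_grad_avg:
  assumes x: "x \<in> Rd d"
  shows "expect sampling (\<lambda>i. (norm (fam_avg P (stoch_grad x i)))\<^sup>2) \<le> (norm (gF x))\<^sup>2 + V / real P"
proof -
  define m where "m p = (1 / real N) *\<^sub>R (\<Sum>i=1..N. grad d (f i p) x)" for p
  define X where "X p i = (1 / real P) *\<^sub>R (grad d (f i p) x - m p)" for p i
  let ?U = "pmf_of_set {1..N}"
  have fin: "finite_pmf ?U" using N_pos by simp
  have centered: "expect ?U (\<lambda>i. inner (grad d (f i p) x - m p) v) = 0" for p v
    unfolding m_def by (rule expect_inner_centered[OF N_pos])
  have "fam_avg P (stoch_grad x i) = gF x + (\<Sum>p=1..P. X p (i p))" for i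
    unfolding gF_eq[OF x] m_def[symmetric] X_def
    by (simp add: fam_avg_def stoch_grad_def scaleR_sum_right[symmetric] scaleR_add_right[symmetric]
        sum.distrib[symmetric])
  then have "expect sampling (\<lambda>i. (norm (fam_avg P (stoch_grad x i)))\<^sup>2)
      = expect sampling (\<lambda>i. (norm (gF x + (\<Sum>p=1..P. X p (i p))))\<^sup>2)" by simp
  also have "\<dots> = (norm (gF x))\<^sup>2 + (\<Sum>p=1..P. expect ?U (\<lambda>i. (norm (X p i))\<^sup>2))"
    unfolding sampling_def
    by (intro expect_norm_sum_power2) (use fin centered in \<open>auto simp: X_def\<close>)
  also have "(\<Sum>p=1..P. expect ?U (\<lambda>i. (norm (X p i))\<^sup>2))
      \<le> (\<Sum>p=1..P. (1 / (real P)\<^sup>2) * ((1 / real N) * (\<Sum>i=1..N. (norm (grad d (f i p) x - gF x))\<^sup>2)))"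
  proof (intro sum_mono)
    fix p
    have "expect ?U (\<lambda>i. (norm (X p i))\<^sup>2)
        = (1 / (real P)\<^sup>2) * expect ?U (\<lambda>i. (norm (grad d (f i p) x - m p))\<^sup>2)"
      by (simp add: X_def power_divide)
    \<comment> \<open>Recentring from the worker mean to \<open>gF x\<close> can only enlarge the
      second moment, and it produces the quantity that \<open>bounded_variance\<close>
      controls.\<close>
    also have "expect ?U (\<lambda>i. (norm (grad d (f i p) x - m p))\<^sup>2)
       \<le> expect ?U (\<lambda>i. (norm ((m p - gF x) + (grad d (f i p) x - m p)))\<^sup>2)"
      by (subst expect_norm_add_power2[OF fin centered]) simp
    also have "\<dots> = (1 / real N) * (\<Sum>i=1..N. (norm (grad d (f i p) x - gF x))\<^sup>2)"
      using N_pos by (simp add: integral_pmf_of_set)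
    finally show "expect ?U (\<lambda>i. (norm (X p i))\<^sup>2)
       \<le> (1 / (real P)\<^sup>2) * ((1 / real N) * (\<Sum>i=1..N. (norm (grad d (f i p) x - gF x))\<^sup>2))"
      by (simp add: divide_right_mono)
  qed
  also have "\<dots> \<le> (1 / (real P)\<^sup>2) * (real P * V)"
    by (subst sum_distrib_left[symmetric]) (intro mult_left_mono sum_variance_le x, simp)
  also have "\<dots> = V / real P" by (simp add: power2_eq_square)
  finally show ?thesis by simp
qed

text \<open>This bounds the size of the single vectors that get compressed, where averaging gives no
  gain. The deviations of one worker need not cancel, but their sum over all workers and samples
  does, which removes the cross terms.\<close>

lemma expect_sum_norm_stoch_grad:
  assumes x: "x \<in> Rd d"
  shows "expect sampling (\<lambda>i. \<Sum>p=1..P. (norm (stoch_grad x i p))\<^sup>2) \<le> real P * ((norm (gF x))\<^sup>2 + V)"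
proof -
  define D where "D i p = grad d (f i p) x - gF x" for i p
  have "(\<Sum>p=1..P. \<Sum>i=1..N. D i p) = 0"
  proof -
    have "(\<Sum>p=1..P. \<Sum>i=1..N. grad d (f i p) x) = (real P * real N) *\<^sub>R gF x"
      using N_pos P_pos by (simp add: gF_eq[OF x] fam_avg_def scaleR_sum_right[symmetric])
    then show ?thesis by (simp add: D_def sum_subtractf scaleR_conv_of_real sum_constant_scaleR)
  qed
  then have 0: "(\<Sum>p=1..P. \<Sum>i=1..N. inner (D i p) (gF x)) = 0"
    by (simp add: inner_sum_left[symmetric])
  have "expect sampling (\<lambda>i. \<Sum>p=1..P. (norm (stoch_grad x i p))\<^sup>2)
      = (\<Sum>p=1..P. (1 / real N) * (\<Sum>i=1..N. (norm (grad d (f i p) x))\<^sup>2))"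
    unfolding expect_sum[OF finite_pmf_sampling] stoch_grad_def
    by (intro sum.cong refl expect_component_sampling)
  also have "\<dots> = (\<Sum>p=1..P. (1 / real N) * (\<Sum>i=1..N. (norm (gF x))\<^sup>2 + 2 * inner (D i p) (gF x) + (norm (D i p))\<^sup>2))"
    by (intro sum.cong arg_cong2[of _ _ _ _ "(*)"] refl)
       (simp add: D_def power2_norm_eq_inner inner_simps inner_commute)
  also have "\<dots> = real P * (norm (gF x))\<^sup>2 + (2 / real N) * (\<Sum>p=1..P. \<Sum>i=1..N. inner (D i p) (gF x))
      + (\<Sum>p=1..P. (1 / real N) * (\<Sum>i=1..N. (norm (D i p))\<^sup>2))"
    using N_pos by (simp add: sum.distrib sum_distrib_left add_divide_distrib sum_divide_distrib)
  also have "\<dots> \<le> real P * (norm (gF x))\<^sup>2 + real P * V"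
    using sum_variance_le[OF x, folded D_def] by (simp only: 0)
  finally show ?thesis by (simp add: distrib_left)
qed

end

section \<open>One round of the algorithm\<close>

locale snag_run = snag_problem +
  fixes k :: nat and c \<eta> :: real
  assumes k_even: "even k" and k_pos: "1 \<le> k div 2" and k_le: "k div 2 \<le> d"
    and c_pos: "0 < c" and c_le: "c \<le> 1 / 32"
    and eta_pos: "0 < \<eta>"
begin

definition \<gamma> :: real where "\<gamma> = c * real k / real d"
definition lam :: real where "lam = 1 / 2 * sqrt (\<eta> / \<mu>)"
text \<open>Equals sqrt(\<eta> \<mu>)/2, the accelerated rate up to a constant.\<close>

definition a :: real where "a = lam * \<mu>"
definition \<alpha> :: real where "\<alpha> = a / (2 + a)"
definition \<beta> :: real where "\<beta> = a / (1 + a)"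
text \<open>Relative variance bound of one compression; each of the two messages of a worker gets
  half of the budget \<open>k\<close>.\<close>

definition \<omega> :: real where "\<omega> = real d / real (k div 2)"

lemma lam_pos: "0 < lam"
  using eta_pos mu_pos by (simp add: lam_def)

lemma a_pos: "0 < a"
  using lam_pos mu_pos by (simp add: a_def)

lemma lam_sq: "lam\<^sup>2 * \<mu> = \<eta> / 4"
  using eta_pos mu_pos by (simp add: lam_def power_mult_distrib power2_eq_square)

lemma eta_eq: "\<eta> = 4 * lam * a"
  using lam_sq by (simp add: a_def power2_eq_square)

lemma omega_pos: "0 < \<omega>"
  using k_pos d_pos by (simp add: \<omega>_def)

text \<open>Evenness of \<open>k\<close> makes \<open>k div 2\<close> an exact half, so d/k cancels
  and an absolute constant is left.\<close>

lemma gamma_omega: "\<gamma> * \<omega> = 2 * c"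
proof -
  have "real k = 2 * real (k div 2)" using k_even by (auto elim!: evenE)
  then show ?thesis using k_pos d_pos by (simp add: \<gamma>_def \<omega>_def)
qed

lemma gamma_pos: "0 < \<gamma>"
  using k_pos d_pos c_pos by (auto simp: \<gamma>_def intro!: divide_pos_pos mult_pos_pos Nat.gr0I)

lemma gamma_le: "\<gamma> \<le> 1 / 16"
proof -
  have "1 \<le> \<omega>" using k_pos k_le by (simp add: \<omega>_def)
  then have "\<gamma> * 1 \<le> \<gamma> * \<omega>" using gamma_pos by (intro mult_left_mono) auto
  then show ?thesis using gamma_omega c_le by simp
qed

lemma alpha_bounds: "0 < \<alpha>" "\<alpha> \<le> a / 2" "\<alpha> \<le> 1"
  using a_pos by (auto simp: \<alpha>_def field_simps)

lemma beta_bounds: "0 < \<beta>" "\<beta> \<le> a" "\<beta> \<le> 1"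
  using a_pos by (auto simp: \<beta>_def field_simps)

text \<open>The z-noise enters \<open>err\<close> with amplitude \<open>\<alpha> * lam\<close>.
  Although \<open>lam\<close> exceeds \<open>\<eta>\<close> for small \<open>a\<close>, the mixing
  weight brings it back to the scale of \<open>\<eta>\<close>, since \<eta> = 4 lam a.\<close>

lemma alpha_lam: "0 < \<alpha> * lam" "\<alpha> * lam \<le> \<eta> / 8"
proof -
  show "0 < \<alpha> * lam" using alpha_bounds lam_pos by simp
  have "\<alpha> * lam \<le> a / 2 * lam" using alpha_bounds lam_pos by (intro mult_right_mono) auto
  also have "\<dots> = 4 * lam * a / 8" by simp
  also have "\<dots> = \<eta> / 8" by (simp only: eta_eq[symmetric])
  finally show "\<alpha> * lam \<le> \<eta> / 8" .
qed

definition err_mix :: "snag_state \<Rightarrow> nat \<Rightarrow> fvec" where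
  "err_mix s = (\<lambda>p. (1 - \<beta>) *\<^sub>R err_z s p + \<beta> *\<^sub>R err s p)"

definition send_y :: "snag_state \<Rightarrow> (nat \<Rightarrow> fvec) \<Rightarrow> nat \<Rightarrow> fvec" where
  "send_y s h = (\<lambda>p. h p + (\<gamma> / \<eta>) *\<^sub>R err s p)"

definition send_z :: "snag_state \<Rightarrow> (nat \<Rightarrow> fvec) \<Rightarrow> nat \<Rightarrow> fvec" where
  "send_z s h = (\<lambda>p. h p + (\<gamma> / lam) *\<^sub>R err_mix s p)"

definition next_state ::
  "snag_state \<Rightarrow> (nat \<Rightarrow> fvec) \<Rightarrow> (nat \<Rightarrow> fvec) \<Rightarrow> (nat \<Rightarrow> fvec) \<Rightarrow> snag_state" where
  "next_state s h gy gz =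
    (let m_y = (\<lambda>p. err s p - \<eta> *\<^sub>R (gy p - h p));
         m_z = (\<lambda>p. err_mix s p - lam *\<^sub>R (gz p - h p));
         y = sol_x s - \<eta> *\<^sub>R fam_avg P gy;
         z = (1 - \<beta>) *\<^sub>R sol_z s + \<beta> *\<^sub>R sol_x s - lam *\<^sub>R fam_avg P gz
     in \<lparr>sol_x = (1 - \<alpha>) *\<^sub>R y + \<alpha> *\<^sub>R z, sol_y = y, sol_z = z,
          err = (\<lambda>p. (1 - \<alpha>) *\<^sub>R m_y p + \<alpha> *\<^sub>R m_z p), err_y = m_y, err_z = m_z\<rparr>)"

definition comp_pmf :: "(nat \<Rightarrow> fvec) \<Rightarrow> (nat \<Rightarrow> fvec) pmf" where
  "comp_pmf g = Pi_pmf {1..P} 0 (\<lambda>p. rand_comp d (g p) (k div 2))"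

abbreviation step :: "snag_state \<Rightarrow> snag_state pmf" where
  "step \<equiv> snag_step d N P f k \<gamma> \<eta> lam \<alpha> \<beta>"

lemma step_eq:
  "step s = sampling \<bind> (\<lambda>i. comp_pmf (send_y s (stoch_grad (sol_x s) i)) \<bind>
     (\<lambda>gy. comp_pmf (send_z s (stoch_grad (sol_x s) i)) \<bind>
     (\<lambda>gz. return_pmf (next_state s (stoch_grad (sol_x s) i) gy gz))))"
  unfolding snag_step_def sampling_def comp_pmf_def stoch_grad_def send_y_def send_z_def
    next_state_def err_mix_def fam_avg_def Let_def ..

lemma finite_pmf_comp_pmf: "finite_pmf (comp_pmf g)"
  unfolding comp_pmf_def by (intro finite_pmf_Pi_pmf finite_pmf_rand_comp k_pos k_le) auto

lemma finite_pmf_step: "finite_pmf (step s)"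
  unfolding step_eq by (simp add: finite_pmf_sampling finite_pmf_comp_pmf)

lemma expect_step:
  "expect (step s) \<psi> = expect sampling (\<lambda>i. expect (comp_pmf (send_y s (stoch_grad (sol_x s) i)))
     (\<lambda>gy. expect (comp_pmf (send_z s (stoch_grad (sol_x s) i)))
     (\<lambda>gz. \<psi> (next_state s (stoch_grad (sol_x s) i) gy gz))))"
  unfolding step_eq
  by (simp add: expect_bind finite_pmf_sampling finite_pmf_comp_pmf)

lemma comp_pmf_Rd:
  assumes "\<And>p. p \<in> {1..P} \<Longrightarrow> g p \<in> Rd d" "y \<in> set_pmf (comp_pmf g)" "p \<in> {1..P}"
  shows "y p \<in> Rd d"
proof -
  have "y \<in> PiE_dflt {1..P} 0 (set_pmf \<circ> (\<lambda>p. rand_comp d (g p) (k div 2)))"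
    using assms(2) by (simp add: comp_pmf_def set_Pi_pmf)
  then have "y p \<in> set_pmf (rand_comp d (g p) (k div 2))"
    using assms(3) by (auto simp: PiE_dflt_def)
  then show ?thesis
    using rand_comp_Rd[OF k_pos k_le] assms(1,3) by blast
qed

text \<open>The two convex combinations belong to the invariant because \<open>virt_x_eq\<close>
  needs \<open>sol_x\<close> and \<open>err\<close> to be mixed with the same weight. Membership in
  \<open>Rd d\<close> is what unbiasedness of \<open>rand_comp\<close> and the inequalities for
  \<open>F\<close> are stated for.\<close>

definition valid_state :: "snag_state \<Rightarrow> bool" where
  "valid_state s \<longleftrightarrow> sol_y s \<in> Rd d \<and> sol_z s \<in> Rd d
     \<and> (\<forall>p\<in>{1..P}. err_y s p \<in> Rd d \<and> err_z s p \<in> Rd d)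
     \<and> sol_x s = (1 - \<alpha>) *\<^sub>R sol_y s + \<alpha> *\<^sub>R sol_z s
     \<and> err s = (\<lambda>p. (1 - \<alpha>) *\<^sub>R err_y s p + \<alpha> *\<^sub>R err_z s p)"

lemma valid_state_Rd:
  assumes "valid_state s"
  shows "sol_x s \<in> Rd d" "sol_y s \<in> Rd d" "sol_z s \<in> Rd d"
    "\<And>p. p \<in> {1..P} \<Longrightarrow> err s p \<in> Rd d" "\<And>p. p \<in> {1..P} \<Longrightarrow> err_y s p \<in> Rd d"
    "\<And>p. p \<in> {1..P} \<Longrightarrow> err_z s p \<in> Rd d" "\<And>p. p \<in> {1..P} \<Longrightarrow> err_mix s p \<in> Rd d"
  using assms unfolding valid_state_def err_mix_def
  by (auto intro!: subspace_add subspace_scale subspace_Rd)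

lemma valid_state_init: "x \<in> Rd d \<Longrightarrow> valid_state (snag_init x)"
  using subspace_0[OF subspace_Rd, of d]
  by (simp add: valid_state_def snag_init_def scaleR_add_left[symmetric])

lemma send_Rd:
  assumes "valid_state s" "i \<in> set_pmf sampling" "p \<in> {1..P}"
  shows "send_y s (stoch_grad (sol_x s) i) p \<in> Rd d" "send_z s (stoch_grad (sol_x s) i) p \<in> Rd d"
  unfolding send_y_def send_z_def
  by (intro subspace_add subspace_scale subspace_Rd stoch_grad_Rd valid_state_Rd assms)+

lemma valid_state_step:
  assumes s: "valid_state s" and "s' \<in> set_pmf (step s)"
  shows "valid_state s'"
proof -
  obtain i gy gz where i: "i \<in> set_pmf sampling"
    and gy: "gy \<in> set_pmf (comp_pmf (send_y s (stoch_grad (sol_x s) i)))"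
    and gz: "gz \<in> set_pmf (comp_pmf (send_z s (stoch_grad (sol_x s) i)))"
    and s': "s' = next_state s (stoch_grad (sol_x s) i) gy gz"
    using assms(2) unfolding step_eq by auto
  have gyRd: "gy p \<in> Rd d" if "p \<in> {1..P}" for p
    using comp_pmf_Rd[OF send_Rd(1)[OF s i] gy that] .
  have gzRd: "gz p \<in> Rd d" if "p \<in> {1..P}" for p
    using comp_pmf_Rd[OF send_Rd(2)[OF s i] gz that] .
  show ?thesis
    unfolding valid_state_def s' next_state_def Let_def snag_state.simps
    by (intro conjI ballI refl subspace_diff subspace_add subspace_scale subspace_Rd
        valid_state_Rd[OF s] fam_avg_Rd gyRd gzRd stoch_grad_Rd i)
qed

text \<open>
  The virtual solutions are the solutions without compression errors; they follow an accelerated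
  gradient method whose gradients are evaluated at the perturbed points \<open>sol_x\<close>.
\<close>

definition virt_x :: "snag_state \<Rightarrow> fvec" where "virt_x s = sol_x s - fam_avg P (err s)"
definition virt_y :: "snag_state \<Rightarrow> fvec" where "virt_y s = sol_y s - fam_avg P (err_y s)"
definition virt_z :: "snag_state \<Rightarrow> fvec" where "virt_z s = sol_z s - fam_avg P (err_z s)"

lemma virt_Rd:
  assumes "valid_state s"
  shows "virt_x s \<in> Rd d" "virt_y s \<in> Rd d" "virt_z s \<in> Rd d"
  unfolding virt_x_def virt_y_def virt_z_def
  by (intro subspace_diff subspace_Rd fam_avg_Rd valid_state_Rd assms; assumption)+

lemma virt_x_eq:
  assumes "valid_state s"
  shows "virt_x s = (1 - \<alpha>) *\<^sub>R virt_y s + \<alpha> *\<^sub>R virt_z s"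
proof -
  have x: "sol_x s = (1 - \<alpha>) *\<^sub>R sol_y s + \<alpha> *\<^sub>R sol_z s"
    and e: "err s = (\<lambda>p. (1 - \<alpha>) *\<^sub>R err_y s p + \<alpha> *\<^sub>R err_z s p)"
    using assms by (auto simp: valid_state_def)
  show ?thesis
    unfolding virt_x_def virt_y_def virt_z_def x e
    by (simp only: fam_avg_add fam_avg_scaleR) (simp add: algebra_simps)
qed

text \<open>\<open>sol_y\<close> and \<open>err_y\<close> contain the compressed message with the
  same coefficient, so it cancels in their difference. What survives is a step with the uncompressed
  gradients.\<close>

lemma virt_y_next: "virt_y (next_state s h gy gz) = virt_x s - \<eta> *\<^sub>R fam_avg P h"
  by (simp add: virt_y_def virt_x_def next_state_def Let_def fam_avg_diff fam_avg_scaleR)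
     (simp add: algebra_simps)

lemma virt_z_next:
  "virt_z (next_state s h gy gz) = (1 - \<beta>) *\<^sub>R virt_z s + \<beta> *\<^sub>R virt_x s - lam *\<^sub>R fam_avg P h"
  by (simp add: virt_z_def virt_x_def next_state_def Let_def err_mix_def
      fam_avg_diff fam_avg_add fam_avg_scaleR)
     (simp add: algebra_simps)

subsection \<open>The compression errors\<close>

text \<open>Adding (\<gamma>/lam) \<open>err_mix\<close> to the message removes the fraction
  \<gamma> of the error in expectation; the rest is centred compression noise.\<close>

lemma err_z_next:
  "err_z (next_state s h gy gz)
     = (\<lambda>p. (1 - \<gamma>) *\<^sub>R err_mix s p + (- lam) *\<^sub>R (gz p - send_z s h p))"
  using lam_pos by (simp add: next_state_def Let_def send_z_def fun_eq_iff algebra_simps)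

text \<open>The brackets separate the noise of \<open>gz\<close> from a base that already contains
  the noise of \<open>gy\<close>, the shape in which \<open>expect_comp_fam_sq\<close> applies once
  per compression.\<close>

lemma err_next:
  "err (next_state s h gy gz)
     = (\<lambda>p. ((1 - \<gamma>) *\<^sub>R ((1 - \<alpha>) *\<^sub>R err s p + \<alpha> *\<^sub>R err_mix s p)
          + (- ((1 - \<alpha>) * \<eta>)) *\<^sub>R (gy p - send_y s h p))
          + (- (\<alpha> * lam)) *\<^sub>R (gz p - send_z s h p))"
  using lam_pos eta_pos
  by (simp add: next_state_def Let_def send_z_def send_y_def fun_eq_iff algebra_simps)

lemma expect_comp_fam_sq:
  assumes "\<And>p. p \<in> {1..P} \<Longrightarrow> g p \<in> Rd d"
  shows "expect (comp_pmf g) (\<lambda>y. fam_sq P (\<lambda>p. C p + r *\<^sub>R (y p - g p)))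
     \<le> fam_sq P C + 2 * r\<^sup>2 * \<omega> * (1 / (real P)\<^sup>2 * (\<Sum>p=1..P. (norm (g p))\<^sup>2))"
proof -
  let ?R = "\<lambda>p. rand_comp d (g p) (k div 2)"
  have "expect (comp_pmf g) (\<lambda>y. fam_sq P (\<lambda>p. C p + r *\<^sub>R (y p - g p)))
     = fam_sq P C + 2 / (real P)\<^sup>2 * (\<Sum>p=1..P. expect (?R p) (\<lambda>y. (norm (r *\<^sub>R (y - g p)))\<^sup>2))"
    unfolding comp_pmf_def using assms
    by (intro expect_fam_sq finite_pmf_rand_comp k_pos k_le)
       (simp add: expect_inner_rand_comp_error[OF k_pos k_le])
  also have "(\<Sum>p=1..P. expect (?R p) (\<lambda>y. (norm (r *\<^sub>R (y - g p)))\<^sup>2))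
      \<le> (\<Sum>p=1..P. r\<^sup>2 * (\<omega> * (norm (g p))\<^sup>2))"
  proof (intro sum_mono)
    fix p assume "p \<in> {1..P}"
    then have "expect (?R p) (\<lambda>y. (norm (y - g p))\<^sup>2) \<le> \<omega> * (norm (g p))\<^sup>2"
      unfolding \<omega>_def by (intro expect_norm_rand_comp_error[OF k_pos k_le] assms)
    then show "expect (?R p) (\<lambda>y. (norm (r *\<^sub>R (y - g p)))\<^sup>2) \<le> r\<^sup>2 * (\<omega> * (norm (g p))\<^sup>2)"
      by (simp add: power_mult_distrib mult_left_mono)
  qed
  finally show ?thesis
    by (simp add: sum_distrib_left[symmetric] mult_ac divide_right_mono)
qed

lemma sum_norm_send_le:
  "(\<Sum>p=1..P. (norm (h p + r *\<^sub>R M p))\<^sup>2)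
     \<le> 2 * (\<Sum>p=1..P. (norm (h p))\<^sup>2) + 2 * r\<^sup>2 * (\<Sum>p=1..P. (norm (M p :: fvec))\<^sup>2)"
proof -
  have "(norm (h p + r *\<^sub>R M p))\<^sup>2 \<le> 2 * (norm (h p))\<^sup>2 + 2 * r\<^sup>2 * (norm (M p))\<^sup>2" for p
    using norm_add_young[of 1 "h p" "r *\<^sub>R M p"] by (simp add: power_mult_distrib)
  then have "(\<Sum>p=1..P. (norm (h p + r *\<^sub>R M p))\<^sup>2)
     \<le> (\<Sum>p=1..P. 2 * (norm (h p))\<^sup>2 + 2 * r\<^sup>2 * (norm (M p))\<^sup>2)"
    by (rule sum_mono)
  then show ?thesis by (simp add: sum.distrib sum_distrib_left)
qed

text \<open>The choice \<open>\<gamma> = \<Theta>(k/d)\<close> makes the noise that is proportional to the error itself negligible.\<close>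

lemma send_noise_le:
  assumes "0 < r" "0 \<le> t"
  shows "2 * (t * r)\<^sup>2 * \<omega> * (1 / (real P)\<^sup>2 * (\<Sum>p=1..P. (norm (h p + (\<gamma> / r) *\<^sub>R M p))\<^sup>2))
     \<le> t\<^sup>2 * (\<gamma> / 4) * fam_sq P M + 4 * \<omega> * (t * r)\<^sup>2 * (1 / (real P)\<^sup>2 * (\<Sum>p=1..P. (norm (h p))\<^sup>2))"
proof -
  let ?H = "\<Sum>p=1..P. (norm (h p))\<^sup>2" and ?M = "\<Sum>p=1..P. (norm (M p))\<^sup>2"
  have "2 * (t * r)\<^sup>2 * \<omega> * (1 / (real P)\<^sup>2 * (\<Sum>p=1..P. (norm (h p + (\<gamma> / r) *\<^sub>R M p))\<^sup>2))
     \<le> 2 * (t * r)\<^sup>2 * \<omega> * (1 / (real P)\<^sup>2 * (2 * ?H + 2 * (\<gamma> / r)\<^sup>2 * ?M))"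
    using omega_pos by (intro mult_left_mono sum_norm_send_le) auto
  also have "\<dots> = 4 * \<omega> * ((t * r)\<^sup>2 * (\<gamma> / r)\<^sup>2) * (1 / (real P)\<^sup>2 * ?M)
      + 4 * \<omega> * (t * r)\<^sup>2 * (1 / (real P)\<^sup>2 * ?H)"
    by (simp add: algebra_simps)
  \<comment> \<open>The step size \<open>r\<close> cancels between the noise amplitude
    \<open>t * r\<close> and the feedback \<open>\<gamma> / r\<close>, so one bound serves both
    messages. The value \<open>t = \<alpha>\<close> is for the z-noise inside
    \<open>err\<close>.\<close>
  also have "(t * r)\<^sup>2 * (\<gamma> / r)\<^sup>2 = t\<^sup>2 * \<gamma>\<^sup>2"
    using assms(1) by (simp add: power_mult_distrib power_divide)
  also have "4 * \<omega> * (t\<^sup>2 * \<gamma>\<^sup>2) * (1 / (real P)\<^sup>2 * ?M)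
      = 4 * t\<^sup>2 * (\<gamma> * \<omega>) * \<gamma> * (1 / (real P)\<^sup>2 * ?M)"
    by (simp add: power2_eq_square)
  also have "4 * t\<^sup>2 * (\<gamma> * \<omega>) * \<gamma> * (1 / (real P)\<^sup>2 * ?M) \<le> 4 * t\<^sup>2 * (1 / 16) * \<gamma> * fam_sq P M"
    using gamma_omega c_pos c_le gamma_pos omega_pos
    by (intro mult_mono sum_norm_le_fam_sq fam_sq_nonneg mult_nonneg_nonneg) (auto intro!: sum_nonneg)
  finally show ?thesis by simp
qed

context
  fixes s :: snag_state and i :: "nat \<Rightarrow> nat"
  assumes s: "valid_state s" and i: "i \<in> set_pmf sampling"
begin

lemma expect_err_z_comp:
  fixes h defines "h \<equiv> stoch_grad (sol_x s) i"
  shows "expect (comp_pmf (send_y s h)) (\<lambda>gy. expect (comp_pmf (send_z s h))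
      (\<lambda>gz. fam_sq P (err_z (next_state s h gy gz))))
    \<le> ((1 - \<gamma>)\<^sup>2 + \<gamma> / 4) * fam_sq P (err_mix s)
      + 4 * \<omega> * lam\<^sup>2 * (1 / (real P)\<^sup>2 * (\<Sum>p=1..P. (norm (h p))\<^sup>2))"
proof -
  define H where "H = 1 / (real P)\<^sup>2 * (\<Sum>p=1..P. (norm (h p))\<^sup>2)"
  have noise: "2 * (- lam)\<^sup>2 * \<omega> * (1 / (real P)\<^sup>2 * (\<Sum>p=1..P. (norm (send_z s h p))\<^sup>2))
    \<le> \<gamma> / 4 * fam_sq P (err_mix s) + 4 * \<omega> * lam\<^sup>2 * H"
    using send_noise_le[OF lam_pos, of 1 h "err_mix s"] by (simp add: send_z_def H_def)
  have le: "expect (comp_pmf (send_z s h)) (\<lambda>gz. fam_sq P (err_z (next_state s h gy gz)))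
    \<le> (1 - \<gamma>)\<^sup>2 * fam_sq P (err_mix s) + (\<gamma> / 4 * fam_sq P (err_mix s) + 4 * \<omega> * lam\<^sup>2 * H)" for gy
  proof -
    have "expect (comp_pmf (send_z s h)) (\<lambda>gz. fam_sq P (err_z (next_state s h gy gz)))
      \<le> fam_sq P (\<lambda>p. (1 - \<gamma>) *\<^sub>R err_mix s p)
      + 2 * (- lam)\<^sup>2 * \<omega> * (1 / (real P)\<^sup>2 * (\<Sum>p=1..P. (norm (send_z s h p))\<^sup>2))"
      unfolding err_z_next h_def by (intro expect_comp_fam_sq send_Rd s i)
    with noise show ?thesis unfolding fam_sq_scaleR by linarith
  qed
  have "expect (comp_pmf (send_y s h)) (\<lambda>gy. expect (comp_pmf (send_z s h))
      (\<lambda>gz. fam_sq P (err_z (next_state s h gy gz))))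
    \<le> expect (comp_pmf (send_y s h)) (\<lambda>_. (1 - \<gamma>)\<^sup>2 * fam_sq P (err_mix s)
         + (\<gamma> / 4 * fam_sq P (err_mix s) + 4 * \<omega> * lam\<^sup>2 * H))"
    by (intro expect_mono finite_pmf_comp_pmf le)
  then show ?thesis by (simp add: H_def algebra_simps)
qed

text \<open>The two compressions are independent given the gradients: \<open>gz\<close> is averaged
  first, with the noise of \<open>gy\<close> frozen in the base family, and \<open>gy\<close>
  afterwards.\<close>

lemma expect_err_comp:
  fixes h defines "h \<equiv> stoch_grad (sol_x s) i"
  shows "expect (comp_pmf (send_y s h)) (\<lambda>gy. expect (comp_pmf (send_z s h))
      (\<lambda>gz. fam_sq P (err (next_state s h gy gz))))
    \<le> (1 - \<gamma>)\<^sup>2 * fam_sq P (\<lambda>p. (1 - \<alpha>) *\<^sub>R err s p + \<alpha> *\<^sub>R err_mix s p)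
      + \<gamma> / 4 * fam_sq P (err s) + \<alpha>\<^sup>2 * (\<gamma> / 4) * fam_sq P (err_mix s)
      + 5 * \<omega> * \<eta>\<^sup>2 * (1 / (real P)\<^sup>2 * (\<Sum>p=1..P. (norm (h p))\<^sup>2))" (is "?lhs \<le> _")
proof -
  define H where "H = 1 / (real P)\<^sup>2 * (\<Sum>p=1..P. (norm (h p))\<^sup>2)"
  have H: "0 \<le> H" by (simp add: H_def sum_nonneg)
  define C where "C p = (1 - \<gamma>) *\<^sub>R ((1 - \<alpha>) *\<^sub>R err s p + \<alpha> *\<^sub>R err_mix s p)" for p
  have noise_z: "2 * (- (\<alpha> * lam))\<^sup>2 * \<omega> * (1 / (real P)\<^sup>2 * (\<Sum>p=1..P. (norm (send_z s h p))\<^sup>2))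
    \<le> \<alpha>\<^sup>2 * (\<gamma> / 4) * fam_sq P (err_mix s) + 4 * \<omega> * (\<alpha> * lam)\<^sup>2 * H"
    using send_noise_le[OF lam_pos, of \<alpha> h "err_mix s"] alpha_bounds by (simp add: send_z_def H_def)
  have inner_le: "expect (comp_pmf (send_z s h)) (\<lambda>gz. fam_sq P (err (next_state s h gy gz)))
    \<le> fam_sq P (\<lambda>p. C p + (- ((1 - \<alpha>) * \<eta>)) *\<^sub>R (gy p - send_y s h p))
      + (\<alpha>\<^sup>2 * (\<gamma> / 4) * fam_sq P (err_mix s) + 4 * \<omega> * (\<alpha> * lam)\<^sup>2 * H)" for gy
  proof -
    have "expect (comp_pmf (send_z s h)) (\<lambda>gz. fam_sq P (err (next_state s h gy gz)))
      \<le> fam_sq P (\<lambda>p. C p + (- ((1 - \<alpha>) * \<eta>)) *\<^sub>R (gy p - send_y s h p))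
      + 2 * (- (\<alpha> * lam))\<^sup>2 * \<omega> * (1 / (real P)\<^sup>2 * (\<Sum>p=1..P. (norm (send_z s h p))\<^sup>2))"
      unfolding err_next h_def C_def by (intro expect_comp_fam_sq send_Rd s i)
    with noise_z show ?thesis by linarith
  qed
  have "?lhs \<le> expect (comp_pmf (send_y s h))
      (\<lambda>gy. fam_sq P (\<lambda>p. C p + (- ((1 - \<alpha>) * \<eta>)) *\<^sub>R (gy p - send_y s h p))
      + (\<alpha>\<^sup>2 * (\<gamma> / 4) * fam_sq P (err_mix s) + 4 * \<omega> * (\<alpha> * lam)\<^sup>2 * H))"
    by (intro expect_mono finite_pmf_comp_pmf inner_le)
  also have "\<dots> = expect (comp_pmf (send_y s h))
        (\<lambda>gy. fam_sq P (\<lambda>p. C p + (- ((1 - \<alpha>) * \<eta>)) *\<^sub>R (gy p - send_y s h p)))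
      + (\<alpha>\<^sup>2 * (\<gamma> / 4) * fam_sq P (err_mix s) + 4 * \<omega> * (\<alpha> * lam)\<^sup>2 * H)"
    by (simp only: expect_add[OF finite_pmf_comp_pmf]) simp
  also have "expect (comp_pmf (send_y s h))
        (\<lambda>gy. fam_sq P (\<lambda>p. C p + (- ((1 - \<alpha>) * \<eta>)) *\<^sub>R (gy p - send_y s h p)))
      \<le> fam_sq P C
      + 2 * (- ((1 - \<alpha>) * \<eta>))\<^sup>2 * \<omega> * (1 / (real P)\<^sup>2 * (\<Sum>p=1..P. (norm (send_y s h p))\<^sup>2))"
    unfolding h_def by (intro expect_comp_fam_sq send_Rd s i)
  also have "2 * (- ((1 - \<alpha>) * \<eta>))\<^sup>2 * \<omega> * (1 / (real P)\<^sup>2 * (\<Sum>p=1..P. (norm (send_y s h p))\<^sup>2))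
    \<le> 2 * (1 * \<eta>)\<^sup>2 * \<omega> * (1 / (real P)\<^sup>2 * (\<Sum>p=1..P. (norm (send_y s h p))\<^sup>2))"
  proof (intro mult_right_mono mult_left_mono)
    show "(- ((1 - \<alpha>) * \<eta>))\<^sup>2 \<le> (1 * \<eta>)\<^sup>2"
      unfolding power2_minus using alpha_bounds eta_pos
      by (intro power_mono mult_right_mono mult_nonneg_nonneg) auto
  qed (use omega_pos in \<open>auto simp: sum_nonneg\<close>)
  also have "\<dots> \<le> \<gamma> / 4 * fam_sq P (err s) + 4 * \<omega> * \<eta>\<^sup>2 * H"
    using send_noise_le[OF eta_pos, of 1 h "err s"] by (simp add: send_y_def H_def)
  also have "fam_sq P C = (1 - \<gamma>)\<^sup>2 * fam_sq P (\<lambda>p. (1 - \<alpha>) *\<^sub>R err s p + \<alpha> *\<^sub>R err_mix s p)"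
    unfolding C_def by (rule fam_sq_scaleR)
  finally have le: "?lhs \<le> (1 - \<gamma>)\<^sup>2 * fam_sq P (\<lambda>p. (1 - \<alpha>) *\<^sub>R err s p + \<alpha> *\<^sub>R err_mix s p)
      + \<gamma> / 4 * fam_sq P (err s) + \<alpha>\<^sup>2 * (\<gamma> / 4) * fam_sq P (err_mix s)
      + (4 * \<omega> * \<eta>\<^sup>2 * H + 4 * \<omega> * (\<alpha> * lam)\<^sup>2 * H)"
    by simp
  \<comment> \<open>The z-noise is at most 4/64 of \<omega> \<eta>^2 H, which the passage from 4 to
    5 covers.\<close>
  have "(\<alpha> * lam)\<^sup>2 \<le> (\<eta> / 8)\<^sup>2" using alpha_lam by (intro power_mono) auto
  then have "4 * \<omega> * (\<alpha> * lam)\<^sup>2 * H \<le> 4 * \<omega> * (\<eta> / 8)\<^sup>2 * H"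
    using omega_pos H by (intro mult_right_mono mult_left_mono) auto
  also have "\<dots> \<le> \<omega> * \<eta>\<^sup>2 * H" using omega_pos H by (simp add: power_divide)
  finally show ?thesis using le by (simp add: H_def)
qed

end

end

section \<open>Contraction of the compression errors for small step sizes\<close>

locale snag_run_tuned = snag_run +
  assumes a_le: "a \<le> \<gamma> / 2" and eta_L: "\<eta> * L \<le> 1 / 4"
begin

text \<open>The weight \<open>\<rho>\<close> balances the leakage \<open>\<alpha>\<^sup>2/\<gamma>\<close> from \<open>err_z\<close> into \<open>err\<close> against the contraction rate \<open>\<gamma>\<close>.\<close>

definition \<rho> :: real where "\<rho> = 2 * a\<^sup>2 / \<gamma>\<^sup>2"

definition pot_err :: "snag_state \<Rightarrow> real" where
  "pot_err s = fam_sq P (err s) + \<rho> * fam_sq P (err_z s)"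

text \<open>The factor 1/\<gamma>^3 combines \<open>\<omega>\<close>, of order 1/\<gamma>, with the
  weighted z-noise: \<rho> lam^2 = \<eta>^2/(8 \<gamma>^2).\<close>

definition b :: real where "b = \<eta>\<^sup>2 / (2 * \<gamma> ^ 3 * real P)"

lemma rho_pos: "0 < \<rho>"
  using a_pos gamma_pos by (simp add: \<rho>_def)

lemma b_pos: "0 < b"
  using eta_pos gamma_pos P_pos by (simp add: b_def)

lemma fam_sq_err_le_pot_err: "fam_sq P (err s) \<le> pot_err s"
  using rho_pos by (simp add: pot_err_def fam_sq_nonneg)

lemma expect_sampling_sum_norm:
  assumes "x \<in> Rd d"
  shows "expect sampling (\<lambda>i. A + B * (1 / (real P)\<^sup>2 * (\<Sum>p=1..P. (norm (stoch_grad x i p))\<^sup>2)))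
    \<le> A + \<bar>B\<bar> * (((norm (gF x))\<^sup>2 + V) / real P)"
proof -
  have "expect sampling (\<lambda>i. A + B * (1 / (real P)\<^sup>2 * (\<Sum>p=1..P. (norm (stoch_grad x i p))\<^sup>2)))
     = A + B * (1 / (real P)\<^sup>2 * expect sampling (\<lambda>i. \<Sum>p=1..P. (norm (stoch_grad x i p))\<^sup>2))"
    by (simp add: expect_add[OF finite_pmf_sampling])
  also have "\<dots> \<le> A + \<bar>B\<bar> * (1 / (real P)\<^sup>2 * expect sampling (\<lambda>i. \<Sum>p=1..P. (norm (stoch_grad x i p))\<^sup>2))"
    by (intro add_left_mono mult_right_mono mult_nonneg_nonneg Bochner_Integration.integral_nonneg)
       (auto intro!: sum_nonneg)
  also have "\<dots> \<le> A + \<bar>B\<bar> * (1 / (real P)\<^sup>2 * (real P * ((norm (gF x))\<^sup>2 + V)))"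
    by (intro add_left_mono mult_left_mono expect_sum_norm_stoch_grad assms) auto
  also have "1 / (real P)\<^sup>2 * (real P * ((norm (gF x))\<^sup>2 + V)) = ((norm (gF x))\<^sup>2 + V) / real P"
    using P_pos by (simp add: power2_eq_square)
  finally show ?thesis .
qed

lemma expect_err_step:
  assumes s: "valid_state s"
  shows "expect (step s) (\<lambda>s'. fam_sq P (err s'))
    \<le> (1 - \<gamma>)\<^sup>2 * fam_sq P (\<lambda>p. (1 - \<alpha>) *\<^sub>R err s p + \<alpha> *\<^sub>R err_mix s p)
      + \<gamma> / 4 * fam_sq P (err s) + \<alpha>\<^sup>2 * (\<gamma> / 4) * fam_sq P (err_mix s)
      + 5 * \<omega> * \<eta>\<^sup>2 * (((norm (gF (sol_x s)))\<^sup>2 + V) / real P)"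
proof -
  have "expect (step s) (\<lambda>s'. fam_sq P (err s')) \<le> expect sampling (\<lambda>i.
      ((1 - \<gamma>)\<^sup>2 * fam_sq P (\<lambda>p. (1 - \<alpha>) *\<^sub>R err s p + \<alpha> *\<^sub>R err_mix s p)
      + \<gamma> / 4 * fam_sq P (err s) + \<alpha>\<^sup>2 * (\<gamma> / 4) * fam_sq P (err_mix s))
      + 5 * \<omega> * \<eta>\<^sup>2 * (1 / (real P)\<^sup>2 * (\<Sum>p=1..P. (norm (stoch_grad (sol_x s) i p))\<^sup>2)))"
    unfolding expect_step using expect_err_comp[OF s]
    by (intro expect_mono finite_pmf_sampling) auto
  also note expect_sampling_sum_norm[OF valid_state_Rd(1)[OF s]]
  finally show ?thesis using omega_pos by (simp add: abs_mult)
qed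

lemma expect_err_z_step:
  assumes s: "valid_state s"
  shows "expect (step s) (\<lambda>s'. fam_sq P (err_z s'))
    \<le> ((1 - \<gamma>)\<^sup>2 + \<gamma> / 4) * fam_sq P (err_mix s)
      + 4 * \<omega> * lam\<^sup>2 * (((norm (gF (sol_x s)))\<^sup>2 + V) / real P)"
proof -
  have "expect (step s) (\<lambda>s'. fam_sq P (err_z s')) \<le> expect sampling (\<lambda>i.
      ((1 - \<gamma>)\<^sup>2 + \<gamma> / 4) * fam_sq P (err_mix s)
      + 4 * \<omega> * lam\<^sup>2 * (1 / (real P)\<^sup>2 * (\<Sum>p=1..P. (norm (stoch_grad (sol_x s) i p))\<^sup>2)))"
    unfolding expect_step using expect_err_z_comp[OF s]
    by (intro expect_mono finite_pmf_sampling) auto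
  also note expect_sampling_sum_norm[OF valid_state_Rd(1)[OF s]]
  finally show ?thesis using omega_pos by (simp add: abs_mult)
qed

lemma fam_sq_err_mix_le: "fam_sq P (err_mix s) \<le> fam_sq P (err_z s) + a * fam_sq P (err s)"
proof -
  have "fam_sq P (err_mix s) \<le> (1 - \<beta>) * fam_sq P (err_z s) + \<beta> * fam_sq P (err s)"
    unfolding err_mix_def using beta_bounds by (intro fam_sq_convex_comb) auto
  also have "\<dots> \<le> 1 * fam_sq P (err_z s) + a * fam_sq P (err s)"
    using beta_bounds by (intro add_mono mult_right_mono fam_sq_nonneg) auto
  finally show ?thesis by simp
qed

lemma a_small: "a \<le> 1 / 32"
  using a_le gamma_le by simp

lemma a_cube_le: "a ^ 3 \<le> a * \<gamma>\<^sup>2 / 4"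
proof -
  have "a\<^sup>2 \<le> (\<gamma> / 2)\<^sup>2" using a_le a_pos by (intro power_mono) auto
  then have "a * a\<^sup>2 \<le> a * (\<gamma> / 2)\<^sup>2" using a_pos by (intro mult_left_mono) auto
  then show ?thesis by (simp add: power2_eq_square power3_eq_cube)
qed

text \<open>Young's inequality with parameter \<gamma>/2 keeps the rate \<gamma>, since
  (1-\<gamma>)^2 (1+\<gamma>/2) = 1 - 3\<gamma>/2 + \<gamma>^3/2, and costs 2/\<gamma> on the
  mixed-in error. Of this rate one quarter pays for the compression noise proportional to
  \<open>err\<close>, and another for the share of \<open>err\<close> in
  \<open>err_mix\<close>.\<close>

lemma expect_err_step_le:
  assumes s: "valid_state s"
  shows "expect (step s) (\<lambda>s'. fam_sq P (err s'))
    \<le> (1 - \<gamma> / 2) * fam_sq P (err s) + a\<^sup>2 / \<gamma> * fam_sq P (err_z s)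
      + 5 * \<omega> * \<eta>\<^sup>2 * (((norm (gF (sol_x s)))\<^sup>2 + V) / real P)"
proof -
  let ?u = "fam_sq P (err s)" and ?v = "fam_sq P (err_z s)" and ?e = "fam_sq P (err_mix s)"
  note nonneg = fam_sq_nonneg[of P "err s"] fam_sq_nonneg[of P "err_z s"] fam_sq_nonneg[of P "err_mix s"]
  have cube: "(1 - \<gamma>)\<^sup>2 * (1 + \<gamma> / 2) \<le> 1 - \<gamma>"
  proof -
    have "0 \<le> \<gamma> * (1 - \<gamma>\<^sup>2)" using gamma_pos gamma_le by (simp add: power_le_one)
    then show ?thesis by (simp add: power2_eq_square algebra_simps)
  qed
  have leak: "(1 - \<gamma>)\<^sup>2 * (1 + 1 / (\<gamma> / 2)) \<le> 2 / \<gamma>"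
  proof -
    have "0 \<le> \<gamma> * (3 - \<gamma>\<^sup>2)" using gamma_pos gamma_le power_le_one[of \<gamma> 2] by simp
    then have "(1 - \<gamma>)\<^sup>2 * (\<gamma> + 2) \<le> 2" by (simp add: power2_eq_square algebra_simps)
    moreover have "1 + 1 / (\<gamma> / 2) = (\<gamma> + 2) / \<gamma>" using gamma_pos by (simp add: field_simps)
    ultimately show ?thesis using gamma_pos
      by (simp add: divide_right_mono)
  qed
  have alpha_sq: "\<alpha>\<^sup>2 \<le> a\<^sup>2 / 4"
    using power_mono[OF alpha_bounds(2), of 2] alpha_bounds(1) by (simp add: power_divide)
  have alpha1: "(1 - \<alpha>)\<^sup>2 \<le> 1" using alpha_bounds by (intro power_le_one) auto
  have "(1 - \<gamma>)\<^sup>2 * fam_sq P (\<lambda>p. (1 - \<alpha>) *\<^sub>R err s p + \<alpha> *\<^sub>R err_mix s p)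
    \<le> (1 - \<gamma>)\<^sup>2 * ((1 + \<gamma> / 2) * (1 - \<alpha>)\<^sup>2 * ?u + (1 + 1 / (\<gamma> / 2)) * \<alpha>\<^sup>2 * ?e)"
    using gamma_pos by (intro mult_left_mono fam_sq_young) auto
  also have "\<dots> = (1 - \<gamma>)\<^sup>2 * (1 + \<gamma> / 2) * (1 - \<alpha>)\<^sup>2 * ?u + (1 - \<gamma>)\<^sup>2 * (1 + 1 / (\<gamma> / 2)) * \<alpha>\<^sup>2 * ?e"
    by (simp add: algebra_simps)
  also have "\<dots> \<le> (1 - \<gamma>) * 1 * ?u + 2 / \<gamma> * (a\<^sup>2 / 4) * ?e"
    using gamma_pos gamma_le nonneg
    by (intro add_mono mult_mono cube leak alpha1 alpha_sq mult_nonneg_nonneg) auto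
  finally have 1: "(1 - \<gamma>)\<^sup>2 * fam_sq P (\<lambda>p. (1 - \<alpha>) *\<^sub>R err s p + \<alpha> *\<^sub>R err_mix s p)
    \<le> (1 - \<gamma>) * ?u + 2 / \<gamma> * (a\<^sup>2 / 4) * ?e" by simp
  have 2: "\<alpha>\<^sup>2 * (\<gamma> / 4) * ?e \<le> a\<^sup>2 / 4 * (1 / \<gamma>) * ?e"
  proof (intro mult_right_mono mult_mono alpha_sq)
    have "\<gamma> * \<gamma> \<le> 1 * 1" using gamma_pos gamma_le by (intro mult_mono) auto
    then show "\<gamma> / 4 \<le> 1 / \<gamma>" using gamma_pos by (simp add: field_simps)
  qed (use gamma_pos nonneg in auto)
  have "2 / \<gamma> * (a\<^sup>2 / 4) * ?e + a\<^sup>2 / 4 * (1 / \<gamma>) * ?e = 3 / 4 * a\<^sup>2 / \<gamma> * ?e"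
    by (simp add: field_simps)
  also have "\<dots> \<le> 3 / 4 * a\<^sup>2 / \<gamma> * (?v + a * ?u)"
    using gamma_pos by (intro mult_left_mono fam_sq_err_mix_le) auto
  also have "\<dots> = 3 / 4 * a\<^sup>2 / \<gamma> * ?v + (3 / 4 * a ^ 3 / \<gamma>) * ?u"
    by (simp add: algebra_simps add_divide_distrib diff_divide_distrib power2_eq_square power3_eq_cube)
  also have "\<dots> \<le> a\<^sup>2 / \<gamma> * ?v + (\<gamma> / 4) * ?u"
  proof (intro add_mono mult_right_mono nonneg)
    show "3 / 4 * a\<^sup>2 / \<gamma> \<le> a\<^sup>2 / \<gamma>" using gamma_pos by (intro divide_right_mono) auto
    have "3 * a ^ 3 \<le> 3 * (a * \<gamma>\<^sup>2 / 4)" using a_cube_le by simp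
    also have "\<dots> = (3 * a / 4) * \<gamma>\<^sup>2" by simp
    also have "\<dots> \<le> 1 * \<gamma>\<^sup>2" using a_small by (intro mult_right_mono) auto
    finally show "3 / 4 * a ^ 3 / \<gamma> \<le> \<gamma> / 4"
      using gamma_pos by (simp add: field_simps power2_eq_square)
  qed
  finally have 3: "2 / \<gamma> * (a\<^sup>2 / 4) * ?e + a\<^sup>2 / 4 * (1 / \<gamma>) * ?e \<le> a\<^sup>2 / \<gamma> * ?v + (\<gamma> / 4) * ?u" .
  have "(1 - \<gamma>) * ?u + \<gamma> / 4 * ?u + \<gamma> / 4 * ?u = (1 - \<gamma> / 2) * ?u"
    by (simp add: algebra_simps)
  with expect_err_step[OF s] 1 2 3 show ?thesis by linarith
qed

lemma expect_err_z_step_le: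
  assumes s: "valid_state s"
  shows "expect (step s) (\<lambda>s'. fam_sq P (err_z s'))
    \<le> (1 - \<gamma>) * fam_sq P (err_z s) + a * fam_sq P (err s)
      + 4 * \<omega> * lam\<^sup>2 * (((norm (gF (sol_x s)))\<^sup>2 + V) / real P)"
proof -
  let ?u = "fam_sq P (err s)" and ?v = "fam_sq P (err_z s)" and ?e = "fam_sq P (err_mix s)"
  have "\<gamma> * \<gamma> \<le> \<gamma> * (3 / 4)" using gamma_pos gamma_le by (intro mult_left_mono) auto
  then have "(1 - \<gamma>)\<^sup>2 + \<gamma> / 4 \<le> 1 - \<gamma>" by (simp add: power2_eq_square algebra_simps)
  then have "((1 - \<gamma>)\<^sup>2 + \<gamma> / 4) * ?e \<le> (1 - \<gamma>) * ?e"
    by (intro mult_right_mono fam_sq_nonneg)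
  also have "\<dots> \<le> (1 - \<gamma>) * (?v + a * ?u)"
    using gamma_le by (intro mult_left_mono fam_sq_err_mix_le) auto
  also have "\<dots> \<le> (1 - \<gamma>) * ?v + 1 * (a * ?u)"
    unfolding distrib_left using gamma_pos a_pos
    by (intro add_left_mono mult_right_mono mult_nonneg_nonneg fam_sq_nonneg) auto
  finally show ?thesis using expect_err_z_step[OF s] by simp
qed

lemma noise_coeff_le: "5 * \<omega> * \<eta>\<^sup>2 + \<rho> * (4 * \<omega> * lam\<^sup>2) \<le> b * real P"
proof -
  have "\<rho> * lam\<^sup>2 = 2 * (lam * a)\<^sup>2 / \<gamma>\<^sup>2" by (simp add: \<rho>_def power_mult_distrib)
  also have "lam * a = \<eta> / 4" using eta_eq by simp
  finally have 1: "\<rho> * lam\<^sup>2 = \<eta>\<^sup>2 / (8 * \<gamma>\<^sup>2)" by (simp add: power_divide)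
  have "\<omega> * \<gamma> \<le> 1 / 16" using gamma_omega c_le by (simp add: mult.commute)
  then have 2: "\<omega> \<le> 1 / (16 * \<gamma>)" using gamma_pos by (simp add: field_simps)
  have "\<gamma>\<^sup>2 \<le> (1 / 16)\<^sup>2" using gamma_pos gamma_le by (intro power_mono) auto
  then have 3: "5 \<le> 5 / 256 / \<gamma>\<^sup>2" using gamma_pos by (simp add: field_simps power_divide)
  have "5 * \<omega> * \<eta>\<^sup>2 + \<rho> * (4 * \<omega> * lam\<^sup>2) = \<omega> * \<eta>\<^sup>2 * 5 + 4 * \<omega> * (\<rho> * lam\<^sup>2)" by simp
  also have "\<dots> = \<omega> * \<eta>\<^sup>2 * (5 + 1 / (2 * \<gamma>\<^sup>2))" unfolding 1 by (simp add: algebra_simps)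
  also have "\<dots> \<le> 1 / (16 * \<gamma>) * \<eta>\<^sup>2 * (5 / 256 / \<gamma>\<^sup>2 + 1 / (2 * \<gamma>\<^sup>2))"
    using 2 3 gamma_pos omega_pos by (intro mult_mono) auto
  also have "\<dots> \<le> \<eta>\<^sup>2 / (2 * \<gamma> ^ 3)"
    using gamma_pos by (simp add: field_simps power2_eq_square power3_eq_cube)
  finally show ?thesis using P_pos by (simp add: b_def)
qed

text \<open>The two errors feed each other. The leak a^2/\<gamma> into \<open>err\<close> is exactly
  half of the contraction \<rho> \<gamma> of the weighted \<open>err_z\<close>, while the return
  flow \<rho> a is at most a/2, hence at most \<gamma>/4 by \<open>a_le\<close>.\<close>

lemma expect_pot_err_step:
  assumes s: "valid_state s"
  shows "expect (step s) pot_err \<le> (1 - \<gamma> / 4) * pot_err s + b * ((norm (gF (sol_x s)))\<^sup>2 + V)"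
proof -
  let ?u = "fam_sq P (err s)" and ?v = "fam_sq P (err_z s)"
  define G where "G = ((norm (gF (sol_x s)))\<^sup>2 + V) / real P"
  have G: "0 \<le> G" using V_nonneg by (simp add: G_def)
  have "expect (step s) pot_err
      = expect (step s) (\<lambda>s'. fam_sq P (err s')) + \<rho> * expect (step s) (\<lambda>s'. fam_sq P (err_z s'))"
    unfolding pot_err_def by (simp add: expect_add[OF finite_pmf_step])
  also have "\<dots> \<le> ((1 - \<gamma> / 2) * ?u + a\<^sup>2 / \<gamma> * ?v + 5 * \<omega> * \<eta>\<^sup>2 * G)
      + \<rho> * ((1 - \<gamma>) * ?v + a * ?u + 4 * \<omega> * lam\<^sup>2 * G)"
    unfolding G_def using rho_pos
    by (intro add_mono mult_left_mono expect_err_step_le expect_err_z_step_le s) auto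
  also have "\<dots> = (1 - \<gamma> / 2 + \<rho> * a) * ?u + (a\<^sup>2 / \<gamma> + \<rho> * (1 - \<gamma>)) * ?v
      + (5 * \<omega> * \<eta>\<^sup>2 + \<rho> * (4 * \<omega> * lam\<^sup>2)) * G"
    by (simp add: algebra_simps)
  also have "\<dots> \<le> (1 - \<gamma> / 4) * ?u + (1 - \<gamma> / 4) * \<rho> * ?v + b * real P * G"
  proof (intro add_mono mult_right_mono fam_sq_nonneg noise_coeff_le G)
    have "\<rho> * a = 2 * a ^ 3 / \<gamma>\<^sup>2" by (simp add: \<rho>_def power2_eq_square power3_eq_cube)
    also have "\<dots> \<le> 2 * (a * \<gamma>\<^sup>2 / 4) / \<gamma>\<^sup>2"
      by (intro divide_right_mono mult_left_mono a_cube_le) auto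
    also have "\<dots> = a / 2" using gamma_pos by simp
    finally show "1 - \<gamma> / 2 + \<rho> * a \<le> 1 - \<gamma> / 4" using a_le by simp
    have "a\<^sup>2 / \<gamma> = \<rho> * (\<gamma> / 2)" using gamma_pos by (simp add: \<rho>_def power2_eq_square)
    moreover have "0 \<le> \<rho> * \<gamma>" using rho_pos gamma_pos by simp
    ultimately show "a\<^sup>2 / \<gamma> + \<rho> * (1 - \<gamma>) \<le> (1 - \<gamma> / 4) * \<rho>" by (simp add: algebra_simps)
  qed
  also have "\<dots> = (1 - \<gamma> / 4) * pot_err s + b * ((norm (gF (sol_x s)))\<^sup>2 + V)"
  proof -
    have "real P * G = (norm (gF (sol_x s)))\<^sup>2 + V" using P_pos by (simp add: G_def)
    then show ?thesis by (simp add: pot_err_def distrib_left mult.assoc)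
  qed
  finally show ?thesis .
qed

subsection \<open>The virtual accelerated gradient method\<close>

text \<open>
  This weight makes the coefficients of \<open>F virt_x - F x_star\<close> and \<open>F virt_x - F virt_y\<close> that the momentum
  step produces add up to exactly 1.
\<close>

definition w :: real where "w = \<mu> * (1 + a) / (2 * (2 + a + a\<^sup>2))"

definition pot_sol :: "snag_state \<Rightarrow> real" where
  "pot_sol s = F (virt_y s) - F x_star + w * (norm (virt_z s - x_star))\<^sup>2"

lemma w_bounds: "\<mu> / 4 \<le> w" "w \<le> \<mu> / 2" "0 < w"
proof -
  have q: "0 < 2 * (2 + a + a\<^sup>2)" using a_pos by (simp add: add_pos_nonneg)
  have "a\<^sup>2 \<le> a" using a_pos a_small by (simp add: power2_eq_square mult_left_le)
  then have "\<mu> * (2 * (2 + a + a\<^sup>2)) \<le> \<mu> * (4 * (1 + a))" using mu_pos by (intro mult_left_mono) auto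
  then show 1: "\<mu> / 4 \<le> w" using q by (simp add: w_def pos_le_divide_eq field_simps)
  have "1 + a \<le> 2 + a + a\<^sup>2" by simp
  then have "\<mu> * (1 + a) \<le> \<mu> * (2 + a + a\<^sup>2)" using mu_pos by (intro mult_left_mono) auto
  then show "w \<le> \<mu> / 2" by (simp only: w_def pos_divide_le_eq[OF q])
  show "0 < w" using 1 mu_pos by simp
qed

lemma w_lam: "2 * w * lam = a * (1 + a) / (2 + a + a\<^sup>2)"
proof -
  have "2 * (\<mu> * (1 + a) / (2 * r)) * lam = lam * \<mu> * (1 + a) / r" for r by simp
  then show ?thesis unfolding w_def a_def[symmetric] .
qed

lemma w_lam_sq: "w * lam\<^sup>2 \<le> \<eta> / 8"
proof -
  have "w * lam\<^sup>2 \<le> \<mu> / 2 * lam\<^sup>2" using w_bounds by (intro mult_right_mono) auto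
  also have "\<dots> = \<eta> / 8" using lam_sq by (simp add: mult.commute)
  finally show ?thesis .
qed

text \<open>Eliminating \<open>Z\<close> shows that the gradient step for z starts at
  \<open>X\<close> extrapolated along \<open>X - Y\<close>. Inner products with the gradient at
  \<open>X\<close> then need values of F at \<open>X\<close>, \<open>Y\<close> and
  \<open>x_star\<close> only, never at \<open>Z\<close>.\<close>

lemma momentum_point:
  assumes "X = (1 - \<alpha>) *\<^sub>R Y + \<alpha> *\<^sub>R Z"
  shows "(1 - \<beta>) *\<^sub>R Z + \<beta> *\<^sub>R X = X + (2 / (a * (1 + a))) *\<^sub>R (X - (Y::fvec))"
proof -
  have *: "(2 + a) *\<^sub>R X = 2 *\<^sub>R Y + a *\<^sub>R Z"
  proof -
    have "(2 + a) *\<^sub>R X = ((2 + a) * (1 - \<alpha>)) *\<^sub>R Y + ((2 + a) * \<alpha>) *\<^sub>R Z"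
      unfolding assms by (simp add: scaleR_add_right)
    also have "(2 + a) * (1 - \<alpha>) = 2" using a_pos by (simp add: \<alpha>_def field_simps)
    also have "(2 + a) * \<alpha> = a" using a_pos by (simp add: \<alpha>_def)
    finally show ?thesis .
  qed
  have "a *\<^sub>R Z = a *\<^sub>R X + 2 *\<^sub>R (X - Y)" using * by (simp add: algebra_simps)
  then have "(1 / a) *\<^sub>R (a *\<^sub>R Z) = (1 / a) *\<^sub>R (a *\<^sub>R X + 2 *\<^sub>R (X - Y))" by simp
  then have Z: "Z = X + (2 / a) *\<^sub>R (X - Y)" using a_pos by (simp add: scaleR_add_right)
  have "(1 - \<beta>) * (2 / a) = 2 / (a * (1 + a))" using a_pos by (simp add: \<beta>_def field_simps)
  moreover have "(1 - \<beta>) *\<^sub>R (X + (2 / a) *\<^sub>R (X - Y)) + \<beta> *\<^sub>R X = X + ((1 - \<beta>) * (2 / a)) *\<^sub>R (X - Y)"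
    by (simp add: algebra_simps)
  ultimately show ?thesis unfolding Z by simp
qed

text \<open>The part towards \<open>x_star\<close> is estimated by strong convexity, the part
  towards \<open>Y\<close> by convexity. The quadratic gain is kept, as A \<mu>/2 = w a; it later
  pays for the share of \<open>X\<close> in the new distance.\<close>

lemma momentum_inner_ge:
  assumes X: "X \<in> Rd d" and Y: "Y \<in> Rd d" and XYZ: "X = (1 - \<alpha>) *\<^sub>R Y + \<alpha> *\<^sub>R Z"
  shows "F X - F x_star + w * a * (norm (X - x_star))\<^sup>2 - 2 / (2 + a + a\<^sup>2) * (F Y - F x_star)
     \<le> 2 * w * lam * inner (gF X) ((1 - \<beta>) *\<^sub>R Z + \<beta> *\<^sub>R X - x_star)"
proof -
  define A where "A = 2 * w * lam"
  define B where "B = 2 / (2 + a + a\<^sup>2)"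
  have q: "0 < 2 + a + a\<^sup>2" using a_pos by (simp add: add_pos_nonneg)
  have A: "0 \<le> A" using w_bounds lam_pos by (simp add: A_def)
  have B: "0 \<le> B" using q by (simp add: B_def)
  have "A + B = (a * (1 + a) + 2) / (2 + a + a\<^sup>2)"
    unfolding A_def B_def w_lam by (simp add: add_divide_distrib)
  also have "\<dots> = 1" using q by (simp add: power2_eq_square algebra_simps)
  finally have AB: "A + B = 1" .
  define r where "r = 2 / (a * (1 + a))"
  have Ar: "A * r = B"
    unfolding r_def A_def B_def w_lam using a_pos by simp
  have "A * inner (gF X) ((1 - \<beta>) *\<^sub>R Z + \<beta> *\<^sub>R X - x_star)
      = A * inner (gF X) (X - x_star) + B * inner (gF X) (X - Y)"
    unfolding momentum_point[OF XYZ] r_def[symmetric] Ar[symmetric]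
    by (simp add: inner_simps algebra_simps)
  moreover have "A * (F X - F x_star + \<mu> / 2 * (norm (X - x_star))\<^sup>2) \<le> A * inner (gF X) (X - x_star)"
    using F_strongly_convex[OF X x_star_Rd] A by (intro mult_left_mono) (auto simp: inner_simps)
  moreover have "B * (F X - F Y) \<le> B * inner (gF X) (X - Y)"
    using F_convex[OF X Y] B by (intro mult_left_mono) (auto simp: inner_simps)
  moreover have "A * (F X - F x_star + \<mu> / 2 * (norm (X - x_star))\<^sup>2) + B * (F X - F Y)
      = (A + B) * (F X - F x_star) + w * a * (norm (X - x_star))\<^sup>2 - B * (F Y - F x_star)"
    by (simp add: A_def a_def algebra_simps)
  ultimately show ?thesis by (simp add: AB A_def[symmetric] B_def[symmetric])
qed

text \<open>The factor 1 + a/2 anticipates the term w a/2 |u|^2 by which the inexact gradient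
  enlarges the distance; a rate of a/4 is left.\<close>

lemma contraction_coeffs: "2 / (2 + a + a\<^sup>2) \<le> 1 - a / 4" "(1 + a / 2) * (1 - \<beta>) \<le> 1 - a / 4"
  "(1 + a / 2) * \<beta> \<le> a"
proof -
  have q: "0 < 2 + a + a\<^sup>2" using a_pos by (simp add: add_pos_nonneg)
  have "0 \<le> a * (1 / 2 + a * (3 / 4 - a / 4))" using a_pos a_small by simp
  then have "2 \<le> (1 - a / 4) * (2 + a + a\<^sup>2)" by (simp add: algebra_simps power2_eq_square)
  then show "2 / (2 + a + a\<^sup>2) \<le> 1 - a / 4" using q by (simp add: pos_divide_le_eq)
  have "0 \<le> a * (1 / 4 - a / 4)" using a_pos a_small by simp
  then have "1 + a / 2 \<le> (1 - a / 4) * (1 + a)" by (simp add: algebra_simps add_divide_distrib diff_divide_distrib)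
  moreover have "1 - \<beta> = 1 / (1 + a)" using a_pos by (simp add: \<beta>_def field_simps)
  ultimately show "(1 + a / 2) * (1 - \<beta>) \<le> 1 - a / 4" using a_pos by (simp add: pos_divide_le_eq)
  have "(1 + a / 2) * a \<le> (1 + a) * a" using a_pos by (intro mult_right_mono) auto
  then have "(1 + a / 2) * a / (1 + a) \<le> (1 + a) * a / (1 + a)" using a_pos by (intro divide_right_mono) auto
  then show "(1 + a / 2) * \<beta> \<le> a" using a_pos by (simp add: \<beta>_def)
qed

text \<open>Polarization of \<open>inner (gF x) (gF X)\<close> yields a gain of \<eta>/2 |gF x|^2.
  Of it, \<eta>/4 is reserved for the curvature of F along the y-step and \<eta>/8 for the square of
  the z-step; the last \<eta>/8 is kept against the compression noise.\<close>

lemma virtual_descent: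
  assumes X: "X \<in> Rd d" and Y: "Y \<in> Rd d" and XYZ: "X = (1 - \<alpha>) *\<^sub>R Y + \<alpha> *\<^sub>R Z"
    and x: "x \<in> Rd d"
  defines "u \<equiv> (1 - \<beta>) *\<^sub>R Z + \<beta> *\<^sub>R X - x_star"
  shows "F X - F x_star + w * (norm u)\<^sup>2 + inner (gF x) ((- \<eta>) *\<^sub>R gF X - (2 * w * lam) *\<^sub>R u)
      + (\<eta> / 4 + \<eta> / 8) * (norm (gF x))\<^sup>2
    \<le> (1 - a / 4) * (F Y - F x_star + w * (norm (Z - x_star))\<^sup>2)
      - \<eta> / 8 * (norm (gF x))\<^sup>2 + 3 / 2 * lam * L\<^sup>2 * (norm (x - X))\<^sup>2"
proof -
  define D where "D = norm (x - X)"
  have gD: "norm (gF x - gF X) \<le> L * D" unfolding D_def by (rule gF_lipschitz[OF x X])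
  have gD2: "(norm (gF x - gF X))\<^sup>2 \<le> L\<^sup>2 * D\<^sup>2"
    using power_mono[OF gD, of 2] by (simp add: power_mult_distrib)
  have grad_part: "- \<eta> * inner (gF x) (gF X) \<le> - \<eta> / 2 * (norm (gF x))\<^sup>2 + \<eta> / 2 * L\<^sup>2 * D\<^sup>2"
  proof -
    have "(norm (gF x))\<^sup>2 - 2 * inner (gF x) (gF X) + (norm (gF X))\<^sup>2 = (norm (gF x - gF X))\<^sup>2"
      by (simp add: power2_norm_eq_inner inner_simps inner_commute)
    then have "- inner (gF x) (gF X) \<le> - (norm (gF x))\<^sup>2 / 2 + L\<^sup>2 * D\<^sup>2 / 2"
      using gD2 zero_le_power2[of "norm (gF X)"] by linarith
    then have "\<eta> * (- inner (gF x) (gF X)) \<le> \<eta> * (- (norm (gF x))\<^sup>2 / 2 + L\<^sup>2 * D\<^sup>2 / 2)"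
      using eta_pos by (intro mult_left_mono) auto
    then show ?thesis by (simp add: algebra_simps)
  qed
  \<comment> \<open>Young's inequality with weight \<mu>/4 on |u|^2 costs w a/2 there, which the
    contraction can afford; w \<le> \<mu>/2 then leaves lam L^2 D^2 for the error.\<close>
  have inexact: "- (2 * w * lam) * inner (gF x) u
      \<le> - (2 * w * lam) * inner (gF X) u + w * a / 2 * (norm u)\<^sup>2 + lam * L\<^sup>2 * D\<^sup>2"
  proof -
    have "- inner (gF x - gF X) u \<le> norm (gF x - gF X) * norm u"
      using norm_cauchy_schwarz[of "- (gF x - gF X)" u] by (simp add: norm_minus_commute inner_simps)
    also have "\<dots> \<le> L * D * norm u" by (intro mult_right_mono gD) auto
    also have "\<dots> \<le> \<mu> / 4 * (norm u)\<^sup>2 + L\<^sup>2 * D\<^sup>2 / \<mu>"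
    proof -
      have "0 \<le> (\<mu> / 2 * norm u - L * D)\<^sup>2 / \<mu>" using mu_pos by simp
      also have "\<dots> = \<mu> / 4 * (norm u)\<^sup>2 - L * D * norm u + L\<^sup>2 * D\<^sup>2 / \<mu>"
        using mu_pos by (simp add: power2_eq_square field_simps)
      finally show ?thesis by simp
    qed
    finally have "(2 * w * lam) * (- inner (gF x - gF X) u)
        \<le> (2 * w * lam) * (\<mu> / 4 * (norm u)\<^sup>2 + L\<^sup>2 * D\<^sup>2 / \<mu>)"
      using w_bounds lam_pos by (intro mult_left_mono) auto
    also have "\<dots> = w * a / 2 * (norm u)\<^sup>2 + (w / \<mu> * 2) * (lam * L\<^sup>2 * D\<^sup>2)"
      by (simp add: a_def algebra_simps)
    also have "(w / \<mu> * 2) * (lam * L\<^sup>2 * D\<^sup>2) \<le> 1 * (lam * L\<^sup>2 * D\<^sup>2)"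
      using w_bounds mu_pos lam_pos by (intro mult_right_mono) (auto simp: field_simps)
    finally show ?thesis by (simp add: inner_diff_left algebra_simps)
  qed
  have momentum: "F X - F x_star + w * a * (norm (X - x_star))\<^sup>2 - 2 / (2 + a + a\<^sup>2) * (F Y - F x_star)
      \<le> 2 * w * lam * inner (gF X) u"
    unfolding u_def by (rule momentum_inner_ge[OF X Y XYZ])
  have "u = (1 - \<beta>) *\<^sub>R (Z - x_star) + \<beta> *\<^sub>R (X - x_star)"
    by (simp add: u_def algebra_simps)
  then have "(norm u)\<^sup>2 \<le> (1 - \<beta>) * (norm (Z - x_star))\<^sup>2 + \<beta> * (norm (X - x_star))\<^sup>2"
    using norm_convex_comb[of \<beta> "Z - x_star" "X - x_star"] beta_bounds by simp
  then have "w * (1 + a / 2) * (norm u)\<^sup>2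
      \<le> w * (1 + a / 2) * ((1 - \<beta>) * (norm (Z - x_star))\<^sup>2 + \<beta> * (norm (X - x_star))\<^sup>2)"
    using w_bounds a_pos by (intro mult_left_mono) auto
  also have "\<dots> = w * (((1 + a / 2) * (1 - \<beta>)) * (norm (Z - x_star))\<^sup>2)
      + w * (((1 + a / 2) * \<beta>) * (norm (X - x_star))\<^sup>2)"
    by (simp add: algebra_simps add_divide_distrib diff_divide_distrib)
  also have "\<dots> \<le> w * ((1 - a / 4) * (norm (Z - x_star))\<^sup>2) + w * (a * (norm (X - x_star))\<^sup>2)"
    using w_bounds by (intro add_mono mult_left_mono mult_right_mono contraction_coeffs) auto
  finally have dist: "w * (norm u)\<^sup>2 + w * a / 2 * (norm u)\<^sup>2
      \<le> (1 - a / 4) * (w * (norm (Z - x_star))\<^sup>2) + w * a * (norm (X - x_star))\<^sup>2"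
    by (simp add: algebra_simps)
  have gap: "2 / (2 + a + a\<^sup>2) * (F Y - F x_star) \<le> (1 - a / 4) * (F Y - F x_star)"
    using minimizer[OF Y] by (intro mult_right_mono contraction_coeffs) auto
  \<comment> \<open>From \<eta> \<le> lam, the \<eta>/2 of \<open>grad_part\<close> and the lam of
    \<open>inexact\<close> merge into 3/2 lam.\<close>
  have "lam * a \<le> lam * (1 / 4)" using lam_pos a_small by (intro mult_left_mono) auto
  then have "\<eta> \<le> lam" using eta_eq by linarith
  then have lam_part: "\<eta> * (L\<^sup>2 * D\<^sup>2) \<le> lam * (L\<^sup>2 * D\<^sup>2)" by (intro mult_right_mono) auto
  \<comment> \<open>Naming every nonlinear product leaves a purely linear combination of six
    inequalities.\<close>
  define E1 E2 E3 where "E1 = \<eta> * inner (gF x) (gF X)" and "E2 = (2 * w * lam) * inner (gF x) u"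
    and "E3 = (2 * w * lam) * inner (gF X) u"
  define G K0 K1 where "G = \<eta> * (norm (gF x))\<^sup>2" and "K0 = \<eta> * (L\<^sup>2 * D\<^sup>2)" and "K1 = lam * (L\<^sup>2 * D\<^sup>2)"
  define H1 H2 M where "H1 = w * (norm u)\<^sup>2" and "H2 = w * a / 2 * (norm u)\<^sup>2"
    and "M = w * a * (norm (X - x_star))\<^sup>2"
  define B1 B2 B3 where "B1 = 2 / (2 + a + a\<^sup>2) * (F Y - F x_star)"
    and "B2 = (1 - a / 4) * (F Y - F x_star)" and "B3 = (1 - a / 4) * (w * (norm (Z - x_star))\<^sup>2)"
  have "- E1 \<le> - G / 2 + K0 / 2" using grad_part by (simp add: E1_def G_def K0_def)
  moreover have "- E2 \<le> - E3 + H2 + K1"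
    using inexact by (simp add: E2_def E3_def H2_def K1_def mult.assoc)
  moreover have "F X - F x_star + M - B1 \<le> E3" using momentum by (simp only: M_def B1_def E3_def)
  moreover have "H1 + H2 \<le> B3 + M" using dist by (simp only: H1_def H2_def B3_def M_def)
  moreover have "B1 \<le> B2" using gap by (simp only: B1_def B2_def)
  moreover have "K0 \<le> K1" using lam_part by (simp only: K0_def K1_def)
  ultimately have main: "F X - F x_star + H1 - E1 - E2 + (G / 4 + G / 8) \<le> B2 + B3 - G / 8 + 3 / 2 * K1" by linarith
  have e1: "inner (gF x) ((- \<eta>) *\<^sub>R gF X - (2 * w * lam) *\<^sub>R u) = - E1 - E2"
    by (simp add: E1_def E2_def inner_simps)
  have e2: "(1 - a / 4) * (F Y - F x_star + w * (norm (Z - x_star))\<^sup>2) = B2 + B3"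
    unfolding B2_def B3_def by (rule distrib_left)
  have e3: "(\<eta> / 4 + \<eta> / 8) * (norm (gF x))\<^sup>2 = G / 4 + G / 8" "\<eta> / 8 * (norm (gF x))\<^sup>2 = G / 8"
    by (simp_all add: G_def distrib_right)
  have e4: "3 / 2 * lam * L\<^sup>2 * (norm (x - X))\<^sup>2 = 3 / 2 * K1"
    by (simp add: K1_def D_def)
  show ?thesis unfolding e1 e2 e3 e4 H1_def[symmetric] using main by linarith
qed

text \<open>The pointwise bound is free of \<open>gy\<close> and \<open>gz\<close>, so both
  compression expectations collapse. The gradient drawn at \<open>sol_x\<close> has mean
  \<open>gF x\<close>, while F is expanded at \<open>X\<close>; \<open>virtual_descent\<close>
  bridges the two.\<close>

lemma expect_pot_sol_step:
  assumes s: "valid_state s"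
  shows "expect (step s) pot_sol \<le> (1 - a / 4) * pot_sol s - \<eta> / 8 * (norm (gF (sol_x s)))\<^sup>2
     + 3 / 2 * lam * L\<^sup>2 * fam_sq P (err s) + \<eta> * V / real P"
proof -
  define X Y Z x where "X = virt_x s" and "Y = virt_y s" and "Z = virt_z s" and "x = sol_x s"
  note defs = X_def Y_def Z_def x_def
  define u where "u = (1 - \<beta>) *\<^sub>R Z + \<beta> *\<^sub>R X - x_star"
  define C where "C = F X - F x_star + w * (norm u)\<^sup>2"
  define v where "v = (- \<eta>) *\<^sub>R gF X - (2 * w * lam) *\<^sub>R u"
  have Rd: "X \<in> Rd d" "Y \<in> Rd d" "x \<in> Rd d"
    unfolding defs using virt_Rd[OF s] valid_state_Rd[OF s] by auto
  have pointwise: "pot_sol (next_state s (stoch_grad x i) gy gz)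
      \<le> C + inner (fam_avg P (stoch_grad x i)) v + (\<eta> / 4 + \<eta> / 8) * (norm (fam_avg P (stoch_grad x i)))\<^sup>2"
    if "i \<in> set_pmf sampling" for i gy gz
  proof -
    define h where "h = fam_avg P (stoch_grad x i)"
    have h: "h \<in> Rd d"
      unfolding h_def by (intro fam_avg_Rd stoch_grad_Rd that Rd)
    have "F (X - \<eta> *\<^sub>R h) \<le> F X + inner (gF X) (X - \<eta> *\<^sub>R h - X) + L * (norm (X - \<eta> *\<^sub>R h - X))\<^sup>2"
      by (intro F_descent Rd subspace_diff subspace_scale subspace_Rd h)
    also have "\<dots> = F X - \<eta> * inner h (gF X) + (\<eta> * L) * \<eta> * (norm h)\<^sup>2"
      by (simp add: power_mult_distrib inner_commute power2_eq_square)
    also have "(\<eta> * L) * \<eta> * (norm h)\<^sup>2 \<le> (1 / 4) * \<eta> * (norm h)\<^sup>2"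
      using eta_pos by (intro mult_right_mono eta_L) auto
    finally have F_le: "F (X - \<eta> *\<^sub>R h) \<le> F X - \<eta> * inner h (gF X) + \<eta> / 4 * (norm h)\<^sup>2" by simp
    have "w * (norm (u - lam *\<^sub>R h))\<^sup>2 = w * (norm u)\<^sup>2 - 2 * w * lam * inner h u + (w * lam\<^sup>2) * (norm h)\<^sup>2"
      unfolding power2_norm_eq_inner
      by (simp add: inner_simps inner_commute algebra_simps power2_eq_square)
    also have "(w * lam\<^sup>2) * (norm h)\<^sup>2 \<le> \<eta> / 8 * (norm h)\<^sup>2"
      by (intro mult_right_mono w_lam_sq) auto
    finally have z_le: "w * (norm (u - lam *\<^sub>R h))\<^sup>2
        \<le> w * (norm u)\<^sup>2 - 2 * w * lam * inner h u + \<eta> / 8 * (norm h)\<^sup>2" by simp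
    have "virt_z (next_state s (stoch_grad x i) gy gz) - x_star = u - lam *\<^sub>R h"
      unfolding virt_z_next by (simp add: u_def defs h_def)
    moreover have "virt_y (next_state s (stoch_grad x i) gy gz) = X - \<eta> *\<^sub>R h"
      unfolding virt_y_next by (simp add: defs h_def)
    moreover have "inner h v = - \<eta> * inner h (gF X) - 2 * w * lam * inner h u"
      by (simp add: v_def inner_simps)
    ultimately show ?thesis
      unfolding pot_sol_def h_def[symmetric] C_def distrib_right using F_le z_le by simp
  qed
  have "expect (step s) pot_sol \<le> expect sampling (\<lambda>i.
      C + inner (fam_avg P (stoch_grad x i)) v + (\<eta> / 4 + \<eta> / 8) * (norm (fam_avg P (stoch_grad x i)))\<^sup>2)"
    unfolding expect_step x_def[symmetric]
  proof (intro expect_mono finite_pmf_sampling)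
    fix i assume "i \<in> set_pmf sampling"
    note le = pointwise[OF this]
    let ?B = "C + inner (fam_avg P (stoch_grad x i)) v
      + (\<eta> / 4 + \<eta> / 8) * (norm (fam_avg P (stoch_grad x i)))\<^sup>2"
    have "expect (comp_pmf (send_y s (stoch_grad x i))) (\<lambda>gy. expect (comp_pmf (send_z s (stoch_grad x i)))
        (\<lambda>gz. pot_sol (next_state s (stoch_grad x i) gy gz)))
      \<le> expect (comp_pmf (send_y s (stoch_grad x i))) (\<lambda>gy. expect (comp_pmf (send_z s (stoch_grad x i))) (\<lambda>gz. ?B))"
      by (intro expect_mono finite_pmf_comp_pmf le)
    then show "expect (comp_pmf (send_y s (stoch_grad x i))) (\<lambda>gy. expect (comp_pmf (send_z s (stoch_grad x i)))
        (\<lambda>gz. pot_sol (next_state s (stoch_grad x i) gy gz))) \<le> ?B" by simp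
  qed
  also have "\<dots> = C + inner (gF x) v
      + (\<eta> / 4 + \<eta> / 8) * expect sampling (\<lambda>i. (norm (fam_avg P (stoch_grad x i)))\<^sup>2)"
    by (simp add: expect_add[OF finite_pmf_sampling] expect_inner_stoch_grad[OF Rd(3)])
  also have "\<dots> \<le> C + inner (gF x) v + (\<eta> / 4 + \<eta> / 8) * ((norm (gF x))\<^sup>2 + V / real P)"
    using eta_pos by (intro add_left_mono mult_left_mono expect_norm_stoch_grad_avg Rd) auto
  also have "\<dots> = C + inner (gF x) v + (\<eta> / 4 + \<eta> / 8) * (norm (gF x))\<^sup>2 + (\<eta> / 4 + \<eta> / 8) * (V / real P)"
    by (simp only: distrib_left add.assoc)
  also have "(\<eta> / 4 + \<eta> / 8) * (V / real P) \<le> \<eta> * (V / real P)"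
    using eta_pos V_nonneg by (intro mult_right_mono) auto
  also have "C + inner (gF x) v + (\<eta> / 4 + \<eta> / 8) * (norm (gF x))\<^sup>2
      \<le> (1 - a / 4) * pot_sol s - \<eta> / 8 * (norm (gF x))\<^sup>2 + 3 / 2 * lam * L\<^sup>2 * (norm (x - X))\<^sup>2"
    unfolding C_def v_def u_def pot_sol_def Y_def[symmetric] Z_def[symmetric]
    by (intro virtual_descent Rd) (unfold defs, rule virt_x_eq[OF s])
  also have "x - X = fam_avg P (err s)" by (simp add: defs virt_x_def)
  also have "3 / 2 * lam * L\<^sup>2 * (norm (fam_avg P (err s)))\<^sup>2 \<le> 3 / 2 * lam * L\<^sup>2 * fam_sq P (err s)"
    using lam_pos by (intro mult_left_mono norm_fam_avg_le_fam_sq) auto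
  finally show ?thesis by (simp add: x_def)
qed

text \<open>Convexity towards \<open>Z\<close> would leave F at \<open>Z\<close> with a weight of
  first order in \<open>a\<close>. Going towards \<open>Y\<close> and \<open>x_star\<close> instead
  leaves only an inner product with \<alpha> (Z - x_star), whose quadratic cost 2 L \<alpha>^2 \<le>
  \<eta> L \<mu>/8 \<le> \<mu>/32 lies below \<open>w\<close>.\<close>

lemma gap_le_potentials:
  assumes s: "valid_state s"
  shows "F (sol_x s) - F x_star \<le> 4 * pot_sol s + 2 * L * pot_err s"
proof -
  define X Y Z x where "X = virt_x s" and "Y = virt_y s" and "Z = virt_z s" and "x = sol_x s"
  note defs = X_def Y_def Z_def x_def
  have Rd: "X \<in> Rd d" "Y \<in> Rd d" "x \<in> Rd d"
    unfolding defs using virt_Rd[OF s] valid_state_Rd[OF s] by auto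
  have X: "X = (1 - \<alpha>) *\<^sub>R Y + \<alpha> *\<^sub>R Z" unfolding defs by (rule virt_x_eq[OF s])
  have young: "inner g v \<le> (norm g)\<^sup>2 / (4 * r) + r * (norm v)\<^sup>2" if "r > 0" for g v :: fvec and r
  proof -
    have "0 \<le> (1 / r) * (norm ((1 / 2) *\<^sub>R g - r *\<^sub>R v))\<^sup>2" using that by simp
    also have "\<dots> = (norm g)\<^sup>2 / (4 * r) - inner g v + r * (norm v)\<^sup>2"
      using that by (simp add: power2_norm_eq_inner inner_simps inner_commute field_simps)
    finally show ?thesis by simp
  qed
  have gX: "(norm (gF X))\<^sup>2 / (4 * L) \<le> F X - F x_star"
    using norm_gF_le[OF Rd(1)] L_pos by (simp add: field_simps)
  have "F x \<le> F X + inner (gF X) (x - X) + L * (norm (x - X))\<^sup>2" by (rule F_descent) fact+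
  also have "inner (gF X) (x - X) \<le> (norm (gF X))\<^sup>2 / (4 * L) + L * (norm (x - X))\<^sup>2" by (rule young) (rule L_pos)
  finally have 1: "F x - F x_star \<le> 2 * (F X - F x_star) + 2 * L * (norm (x - X))\<^sup>2" using gX by simp
  have "(1 - \<alpha>) * (F X + inner (gF X) (Y - X)) + \<alpha> * (F X + inner (gF X) (x_star - X))
      \<le> (1 - \<alpha>) * F Y + \<alpha> * F x_star"
    using alpha_bounds by (intro add_mono mult_left_mono F_convex Rd x_star_Rd) auto
  moreover have "(1 - \<alpha>) * (F X + inner (gF X) (Y - X)) + \<alpha> * (F X + inner (gF X) (x_star - X))
      = F X - inner (gF X) (\<alpha> *\<^sub>R (Z - x_star))"
  proof -
    have "(1 - \<alpha>) *\<^sub>R (Y - X) + \<alpha> *\<^sub>R (x_star - X) = - (\<alpha> *\<^sub>R (Z - x_star))"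
      by (simp add: X algebra_simps)
    from arg_cong[OF this, of "inner (gF X)"] show ?thesis
      by (simp add: inner_add_right algebra_simps)
  qed
  moreover have "inner (gF X) (\<alpha> *\<^sub>R (Z - x_star))
      \<le> (norm (gF X))\<^sup>2 / (4 * (2 * L)) + 2 * L * (norm (\<alpha> *\<^sub>R (Z - x_star)))\<^sup>2"
    using L_pos by (intro young) auto
  moreover have "2 * L * (norm (\<alpha> *\<^sub>R (Z - x_star)))\<^sup>2 \<le> w * (norm (Z - x_star))\<^sup>2"
  proof -
    have "\<alpha>\<^sup>2 \<le> (a / 2)\<^sup>2" using alpha_bounds by (intro power_mono) auto
    also have "(a / 2)\<^sup>2 = (lam\<^sup>2 * \<mu>) * \<mu> / 4" by (simp add: a_def power2_eq_square)
    finally have "2 * L * \<alpha>\<^sup>2 \<le> 2 * L * (\<eta> / 4 * \<mu> / 4)"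
      unfolding lam_sq using L_pos by (intro mult_left_mono) auto
    also have "\<dots> = (\<eta> * L) * (\<mu> / 8)" by simp
    also have "\<dots> \<le> 1 / 4 * (\<mu> / 8)" using mu_pos by (intro mult_right_mono eta_L) auto
    also have "\<dots> \<le> w" using w_bounds mu_pos by simp
    finally have "2 * L * \<alpha>\<^sup>2 * (norm (Z - x_star))\<^sup>2 \<le> w * (norm (Z - x_star))\<^sup>2"
      by (intro mult_right_mono) auto
    then show ?thesis by (simp add: power_mult_distrib mult.assoc)
  qed
  moreover have "(1 - \<alpha>) * (F Y - F x_star) \<le> 1 * (F Y - F x_star)"
    using alpha_bounds minimizer[OF Rd(2)] by (intro mult_right_mono) auto
  ultimately have 2: "F X - F x_star \<le> 2 * pot_sol s"
    using gX unfolding pot_sol_def Y_def[symmetric] Z_def[symmetric]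
    by (simp add: algebra_simps)
  have "(norm (x - X))\<^sup>2 \<le> pot_err s"
    using norm_fam_avg_le_fam_sq[of P "err s"] fam_sq_err_le_pot_err[of s] by (simp add: defs virt_x_def)
  then have "2 * L * (norm (x - X))\<^sup>2 \<le> 2 * L * pot_err s" using L_pos by (intro mult_left_mono) auto
  with 1 2 show ?thesis by (simp add: x_def)
qed

end

section \<open>Iterating the two potentials\<close>

text \<open>
  The constant part \<open>b V / s\<close> of the error \<open>W\<close> is split off first: it enters the potential only through
  \<open>K\<close>, not through the much larger weight that absorbs the gradient terms.
\<close>

lemma coupled_recursion:
  fixes \<phi> W g :: "nat \<Rightarrow> real"
  assumes \<phi>: "\<And>t. \<phi> (Suc t) \<le> (1 - r) * \<phi> t - \<delta> * g t + K * W t + n"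
    and W: "\<And>t. W (Suc t) \<le> (1 - s) * W t + b * (g t + V)" and W0: "W 0 = 0"
    and g: "\<And>t. 0 \<le> g t"
    and r: "0 < r" "r \<le> s / 2" and s: "s \<le> 1"
    and nonneg: "0 \<le> K" "0 \<le> M" "0 \<le> b" "0 \<le> V" "0 \<le> n"
    and absorb: "(2 * K / s + M) * b \<le> \<delta>"
  shows "\<phi> T + M * W T \<le> (1 - r) ^ T * \<phi> 0 + (K * (b * V / s) + n) / r + M * (b * V / s)"
proof -
  have s_pos: "0 < s" using r by simp
  define W' where "W' = rec_nat 0 (\<lambda>t w. (1 - s) * w + b * g t)"
  have W'_simps: "W' 0 = 0" "W' (Suc t) = (1 - s) * W' t + b * g t" for t
    by (simp_all add: W'_def)
  define c where "c = b * V / s"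
  have c: "0 \<le> c" "s * c = b * V" using nonneg s_pos by (simp_all add: c_def)
  have W'_nonneg: "0 \<le> W' t" for t
    by (induction t) (use s nonneg g in \<open>auto simp: W'_simps\<close>)
  have W_le: "W t \<le> W' t + c" for t
  proof (induction t)
    case (Suc t)
    have "W (Suc t) \<le> (1 - s) * W t + b * (g t + V)" by (rule W)
    also have "\<dots> \<le> (1 - s) * (W' t + c) + b * (g t + V)"
      using s Suc by (intro add_right_mono mult_left_mono) auto
    also have "\<dots> = W' (Suc t) + c" using c(2) by (simp add: W'_simps algebra_simps)
    finally show ?case .
  qed (use W0 c in \<open>simp add: W'_simps\<close>)
  \<comment> \<open>The part 2K/s lets K W' fit between the rates s and r \<le> s/2; the part M
    keeps M W' available for the conclusion. By \<open>absorb\<close>, gradient noise injected with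
    this weight stays below \<delta>.\<close>
  define \<kappa> where "\<kappa> = 2 * K / s + M"
  define R where "R = (K * c + n) / r"
  have R: "0 \<le> R" "r * R = K * c + n" using nonneg c r by (simp_all add: R_def)
  have kappa: "K \<le> \<kappa> * (s / 2)" "M \<le> \<kappa>" "0 \<le> \<kappa>"
    using nonneg s_pos by (simp_all add: \<kappa>_def distrib_right)
  have main: "\<phi> t + \<kappa> * W' t \<le> (1 - r) ^ t * \<phi> 0 + R" for t
  proof (induction t)
    case (Suc t)
    have "\<kappa> * (1 - s) + K \<le> \<kappa> * (1 - s / 2)" using kappa by (simp add: algebra_simps)
    also have "\<dots> \<le> \<kappa> * (1 - r)" using kappa r by (intro mult_left_mono) auto
    finally have k: "(\<kappa> * (1 - s) + K) * W' t \<le> \<kappa> * (1 - r) * W' t"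
      by (intro mult_right_mono W'_nonneg)
    have d: "\<kappa> * b * g t \<le> \<delta> * g t" using absorb g by (intro mult_right_mono) (auto simp: \<kappa>_def)
    have "\<phi> (Suc t) + \<kappa> * W' (Suc t)
        \<le> ((1 - r) * \<phi> t - \<delta> * g t + K * (W' t + c) + n) + \<kappa> * ((1 - s) * W' t + b * g t)"
      using \<phi>[of t] mult_left_mono[OF W_le[of t] nonneg(1)] by (simp add: W'_simps)
    also have "\<dots> = (1 - r) * \<phi> t + (\<kappa> * (1 - s) + K) * W' t + (\<kappa> * b * g t - \<delta> * g t) + r * R"
      using R(2) by (simp add: algebra_simps)
    also have "\<dots> \<le> (1 - r) * \<phi> t + \<kappa> * (1 - r) * W' t + 0 + r * R"
      using k d by (intro add_mono) auto
    also have "\<dots> = (1 - r) * (\<phi> t + \<kappa> * W' t) + r * R" by (simp add: algebra_simps)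
    also have "\<dots> \<le> (1 - r) * ((1 - r) ^ t * \<phi> 0 + R) + r * R"
      using r s Suc by (intro add_right_mono mult_left_mono) auto
    also have "\<dots> = (1 - r) ^ Suc t * \<phi> 0 + R" by (simp add: algebra_simps)
    finally show ?case .
  qed (simp add: W'_simps R)
  have "M * W T \<le> M * (W' T + c)" using nonneg by (intro mult_left_mono W_le)
  also have "\<dots> \<le> \<kappa> * W' T + M * c"
    unfolding distrib_left using kappa by (intro add_right_mono mult_right_mono W'_nonneg)
  finally show ?thesis using main[of T] by (simp add: R_def c_def)
qed

section \<open>The expected gap after T rounds\<close>

context snag_run_tuned
begin

definition run :: "fvec \<Rightarrow> nat \<Rightarrow> snag_state pmf" where
  "run x_in = s_snag_ef d N P f x_in k \<gamma> (\<lambda>_. \<eta>) (\<lambda>_. lam) (\<lambda>_. \<alpha>) (\<lambda>_. \<beta>)"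

lemma run_simps: "run x_in 0 = return_pmf (snag_init x_in)" "run x_in (Suc t) = run x_in t \<bind> step"
  by (simp_all add: run_def)

lemma finite_pmf_run: "finite_pmf (run x_in t)"
  by (induction t) (simp_all add: run_simps finite_pmf_step)

lemma valid_state_run:
  assumes "x_in \<in> Rd d" "s \<in> set_pmf (run x_in t)"
  shows "valid_state s"
  using assms(2)
proof (induction t arbitrary: s)
  case 0
  then show ?case using valid_state_init[OF assms(1)] by (simp add: run_simps)
next
  case (Suc t)
  then show ?case using valid_state_step by (auto simp: run_simps)
qed

lemma expect_run_Suc: "expect (run x_in (Suc t)) \<psi> = expect (run x_in t) (\<lambda>s. expect (step s) \<psi>)"
  by (simp add: run_simps expect_bind finite_pmf_run finite_pmf_step)

text \<open>The recursion is run with M = L/2, the ratio of the weights 2L and 4 in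
  \<open>gap_le_potentials\<close>. Of the gradient gain \<eta>/8, \<open>step1\<close> allots one
  half to the weight 12 lam L^2/\<gamma> of the error and \<open>step2\<close> the other half to
  M.\<close>

lemma expected_gap:
  assumes x_in: "x_in \<in> Rd d"
    and step1: "96 * lam * \<eta> * L\<^sup>2 \<le> \<gamma> ^ 4 * real P" and step2: "4 * L * \<eta> \<le> \<gamma> ^ 3 * real P"
  shows "expect (run x_in T) (\<lambda>s. F (sol_x s) - F x_star)
    \<le> 8 * (1 - a / 4) ^ T * (L * (norm (x_in - x_star))\<^sup>2)
      + 52 * (L\<^sup>2 * \<eta>\<^sup>2 * V / (\<mu> * \<gamma> ^ 4 * real P)) + 64 * lam * V / real P"
proof -
  define \<phi> where "\<phi> t = expect (run x_in t) pot_sol" for t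
  define W where "W t = expect (run x_in t) pot_err" for t
  define g where "g t = expect (run x_in t) (\<lambda>s. (norm (gF (sol_x s)))\<^sup>2)" for t
  note fin = finite_pmf_run[of x_in]
  note expect_simps = expect_add[OF fin] expect_diff[OF fin]
  define Q where "Q = L\<^sup>2 * \<eta>\<^sup>2 * V / (\<mu> * \<gamma> ^ 4 * real P)"
  have rec: "\<phi> T + (L / 2) * W T \<le> (1 - a / 4) ^ T * \<phi> 0
      + ((3 / 2 * lam * L\<^sup>2) * (b * V / (\<gamma> / 4)) + \<eta> * V / real P) / (a / 4) + (L / 2) * (b * V / (\<gamma> / 4))"
  proof (rule coupled_recursion[where g = g and \<delta> = "\<eta> / 8"])
    fix t
    have "\<phi> (Suc t) \<le> expect (run x_in t) (\<lambda>s. (1 - a / 4) * pot_sol s - \<eta> / 8 * (norm (gF (sol_x s)))\<^sup>2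
        + 3 / 2 * lam * L\<^sup>2 * pot_err s + \<eta> * V / real P)"
      unfolding \<phi>_def expect_run_Suc
    proof (intro expect_mono fin)
      fix s assume "s \<in> set_pmf (run x_in t)"
      note expect_pot_sol_step[OF valid_state_run[OF x_in this]]
      also have "3 / 2 * lam * L\<^sup>2 * fam_sq P (err s) \<le> 3 / 2 * lam * L\<^sup>2 * pot_err s"
        using lam_pos by (intro mult_left_mono fam_sq_err_le_pot_err) auto
      finally show "expect (step s) pot_sol \<le> (1 - a / 4) * pot_sol s
        - \<eta> / 8 * (norm (gF (sol_x s)))\<^sup>2 + 3 / 2 * lam * L\<^sup>2 * pot_err s + \<eta> * V / real P" by simp
    qed
    also have "\<dots> = (1 - a / 4) * \<phi> t - \<eta> / 8 * g t + (3 / 2 * lam * L\<^sup>2) * W t + \<eta> * V / real P"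
      by (simp only: expect_simps) (simp add: \<phi>_def W_def g_def)
    finally show "\<phi> (Suc t) \<le> \<dots>" .
    have "W (Suc t) \<le> expect (run x_in t) (\<lambda>s. (1 - \<gamma> / 4) * pot_err s + b * ((norm (gF (sol_x s)))\<^sup>2 + V))"
      unfolding W_def expect_run_Suc
      by (intro expect_mono fin expect_pot_err_step valid_state_run[OF x_in])
    also have "\<dots> = (1 - \<gamma> / 4) * W t + b * (g t + V)"
      by (simp add: expect_simps W_def g_def)
    finally show "W (Suc t) \<le> \<dots>" .
    show "0 \<le> g t" by (simp add: g_def Bochner_Integration.integral_nonneg)
  next
    show "W 0 = 0"
      by (simp add: W_def run_simps pot_err_def snag_init_def fam_sq_zero)
    have "12 * lam * L\<^sup>2 / \<gamma> * b = (96 * lam * \<eta> * L\<^sup>2) * (\<eta> / (16 * \<gamma> ^ 4 * real P))"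
      by (simp add: b_def power2_eq_square eval_nat_numeral)
    also have "\<dots> \<le> (\<gamma> ^ 4 * real P) * (\<eta> / (16 * \<gamma> ^ 4 * real P))"
      using eta_pos gamma_pos by (intro mult_right_mono step1) auto
    also have "\<dots> = \<eta> / 16" using gamma_pos P_pos by simp
    finally have 1: "12 * lam * L\<^sup>2 / \<gamma> * b \<le> \<eta> / 16" .
    have "L / 2 * b = (4 * L * \<eta>) * (\<eta> / (16 * \<gamma> ^ 3 * real P))"
      by (simp add: b_def power2_eq_square)
    also have "\<dots> \<le> (\<gamma> ^ 3 * real P) * (\<eta> / (16 * \<gamma> ^ 3 * real P))"
      using eta_pos gamma_pos by (intro mult_right_mono step2) auto
    also have "\<dots> = \<eta> / 16" using gamma_pos P_pos by simp
    finally have 2: "L / 2 * b \<le> \<eta> / 16" .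
    have "2 * (3 / 2 * lam * L\<^sup>2) / (\<gamma> / 4) = 12 * lam * L\<^sup>2 / \<gamma>" by simp
    then show "(2 * (3 / 2 * lam * L\<^sup>2) / (\<gamma> / 4) + L / 2) * b \<le> \<eta> / 8"
      unfolding distrib_right using 1 2 by simp
  qed (use a_pos a_le gamma_pos gamma_le lam_pos L_pos b_pos V_nonneg eta_pos in auto)
  have gap: "expect (run x_in T) (\<lambda>s. F (sol_x s) - F x_star) \<le> 4 * \<phi> T + 2 * L * W T"
  proof -
    have "expect (run x_in T) (\<lambda>s. F (sol_x s) - F x_star)
        \<le> expect (run x_in T) (\<lambda>s. 4 * pot_sol s + 2 * L * pot_err s)"
      by (intro expect_mono fin gap_le_potentials valid_state_run[OF x_in])
    also have "\<dots> = 4 * \<phi> T + 2 * L * W T"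
      by (simp only: expect_simps) (simp add: \<phi>_def W_def)
    finally show ?thesis .
  qed
  have "\<phi> 0 \<le> 2 * (L * (norm (x_in - x_star))\<^sup>2)"
  proof -
    have avg0: "fam_avg P (\<lambda>_. 0) = 0" by (simp add: fam_avg_def)
    have "\<phi> 0 = F x_in - F x_star + w * (norm (x_in - x_star))\<^sup>2"
      by (simp add: \<phi>_def run_simps pot_sol_def virt_y_def virt_z_def snag_init_def avg0)
    also have "\<dots> \<le> L * (norm (x_in - x_star))\<^sup>2 + L * (norm (x_in - x_star))\<^sup>2"
      using w_bounds mu_le_L mu_pos by (intro add_mono F_upper x_in mult_right_mono) auto
    finally show ?thesis by simp
  qed
  then have "(1 - a / 4) ^ T * \<phi> 0 \<le> (1 - a / 4) ^ T * (2 * (L * (norm (x_in - x_star))\<^sup>2))"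
    using a_small by (intro mult_left_mono) auto
  then have start: "4 * ((1 - a / 4) ^ T * \<phi> 0) \<le> 8 * (1 - a / 4) ^ T * (L * (norm (x_in - x_star))\<^sup>2)"
    by (simp add: mult_ac)
  \<comment> \<open>Dividing by the rate a/4 uses lam/a = 1/\<mu> for the error noise and \<eta>/a =
    4 lam for the sampling noise.\<close>
  have steady: "((3 / 2 * lam * L\<^sup>2) * (b * V / (\<gamma> / 4)) + \<eta> * V / real P) / (a / 4)
      = 12 * Q + 16 * lam * V / real P"
  proof -
    have "(3 / 2 * lam * L\<^sup>2) * (b * V / (\<gamma> / 4)) / (a / 4)
        = 12 * Q"
      using lam_pos mu_pos gamma_pos P_pos by (simp add: Q_def a_def b_def field_simps eval_nat_numeral)
    moreover have "\<eta> * V / real P / (a / 4) = 16 * lam * V / real P"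
    proof -
      have "\<eta> / (a / 4) = 16 * lam"
        using a_pos arg_cong[OF eta_eq, of "\<lambda>z. z / (a / 4)"] by (simp only:) simp
      then show ?thesis by (metis times_divide_eq_left divide_divide_eq_left mult.commute)
    qed
    ultimately show ?thesis by (simp only: add_divide_distrib)
  qed
  have err_part: "(L / 2) * (b * V / (\<gamma> / 4)) \<le> Q"
  proof -
    have "(L / 2) * (b * V / (\<gamma> / 4)) = L * (\<eta>\<^sup>2 * V / (\<gamma> ^ 4 * real P))"
      using gamma_pos P_pos by (simp add: b_def field_simps eval_nat_numeral)
    also have "\<dots> \<le> (L\<^sup>2 / \<mu>) * (\<eta>\<^sup>2 * V / (\<gamma> ^ 4 * real P))"
    proof (intro mult_right_mono)
      have "L * \<mu> \<le> L * L" using mu_le_L L_pos by (intro mult_left_mono) auto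
      then show "L \<le> L\<^sup>2 / \<mu>" using mu_pos by (simp add: field_simps power2_eq_square)
    qed (use gamma_pos V_nonneg in auto)
    finally show ?thesis by (simp add: Q_def mult.assoc)
  qed
  have "expect (run x_in T) (\<lambda>s. F (sol_x s) - F x_star) \<le> 4 * (\<phi> T + (L / 2) * W T)"
    using gap by simp
  also have "\<dots> \<le> 4 * ((1 - a / 4) ^ T * \<phi> 0 + (12 * Q + 16 * lam * V / real P) + Q)"
    using rec err_part unfolding steady by simp
  also have "\<dots> = 4 * ((1 - a / 4) ^ T * \<phi> 0) + 52 * Q + 64 * lam * V / real P"
    by simp
  finally show ?thesis using start unfolding Q_def by linarith
qed

end

section \<open>The choice of the step size\<close>

lemma powr_inverse_power:
  assumes "0 \<le> (x::real)" "0 < n" "0 < m"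
  shows "(x powr (real m / real n)) ^ n = x ^ m"
proof (cases "x = 0")
  case True
  then show ?thesis using assms by (simp add: zero_power)
next
  case False
  then have "0 < x" using assms by simp
  then have "(x powr (real m / real n)) ^ n = x powr (real m / real n * real n)"
    by (simp add: powr_realpow[symmetric] powr_powr)
  then show ?thesis using \<open>0 < x\<close> assms by (simp add: powr_realpow)
qed

text \<open>Every term of a sum of nonnegative terms obeys the bound on the sum. Raising to the
  powers 2, 3 and 4 clears the roots, so that the comparison with powers of \<gamma> becomes
  polynomial.\<close>

lemma step_size_bounds:
  fixes L \<mu> V \<epsilon> s \<delta> :: real and d k P :: nat
  assumes pos: "d > 0" "k > 0" "P > 0" "L > 0" "\<mu> > 0" "0 \<le> V" "\<epsilon> > 0" "s > 0"
    and s: "s * complexity L \<mu> V P d k \<epsilon> \<le> \<delta>"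
  shows "s\<^sup>2 * L / \<mu> \<le> \<delta>\<^sup>2" "s * V / (real P * \<mu>) \<le> \<delta> * \<epsilon>" "s * real d / real k \<le> \<delta>"
    "s\<^sup>2 * (real d ^ 3 * L) \<le> \<delta>\<^sup>2 * (real k ^ 3 * real P * \<mu>)"
    "s ^ 3 * (real d ^ 4 * L\<^sup>2) \<le> \<delta> ^ 3 * (real k ^ 4 * real P * \<mu>\<^sup>2)"
    "s ^ 4 * (real d ^ 4 * (L\<^sup>2 * V)) \<le> \<delta> ^ 4 * (real k ^ 4 * real P * \<mu> ^ 3 * \<epsilon>)"
proof -
  define t1 where "t1 = sqrt (L / \<mu>)"
  define t2 where "t2 = V / real P * (1 / (\<mu> * \<epsilon>))"
  define t3 where "t3 = real d / real k"
  define t4 where "t4 = real d powr (3/2) / (real k powr (3/2) * sqrt (real P)) * sqrt (L / \<mu>)"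
  define t5 where "t5 = real d powr (4/3) / (real k powr (4/3) * real P powr (1/3)) * (L powr (2/3) / \<mu> powr (2/3))"
  define t6 where "t6 = real d / (real k * real P powr (1/4))
         * ((L\<^sup>2 * V) powr (1/4) / (\<mu> powr (3/4) * \<epsilon> powr (1/4)))"
  have nonneg: "0 \<le> t1" "0 \<le> t2" "0 \<le> t3" "0 \<le> t4" "0 \<le> t5" "0 \<le> t6"
    using pos by (simp_all add: t1_def t2_def t3_def t4_def t5_def t6_def)
  have "complexity L \<mu> V P d k \<epsilon> = t1 + t2 + t3 + t4 + t5 + t6"
    by (simp add: complexity_def t1_def t2_def t3_def t4_def t5_def t6_def)
  then have term_le: "s * t \<le> \<delta>" if "t \<in> {t1, t2, t3, t4, t5, t6}" for t
  proof -
    have "t \<le> complexity L \<mu> V P d k \<epsilon>"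
      using that nonneg \<open>complexity L \<mu> V P d k \<epsilon> = _\<close> by auto
    then have "s * t \<le> s * complexity L \<mu> V P d k \<epsilon>" using pos by (intro mult_left_mono) auto
    then show ?thesis using s by (rule order_trans)
  qed
  have pow: "s ^ n * t ^ n \<le> \<delta> ^ n" if "t \<in> {t1, t2, t3, t4, t5, t6}" for t n
    using power_mono[OF term_le[OF that], of n] that nonneg pos by (auto simp: power_mult_distrib)
  have "t1\<^sup>2 = L / \<mu>" using pos by (simp add: t1_def)
  then show "s\<^sup>2 * L / \<mu> \<le> \<delta>\<^sup>2" using pow[of t1 2] by simp
  show "s * V / (real P * \<mu>) \<le> \<delta> * \<epsilon>"
    using term_le[of t2] pos by (simp add: t2_def field_simps)
  show "s * real d / real k \<le> \<delta>" using term_le[of t3] by (simp add: t3_def)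
  have "t4\<^sup>2 = real d ^ 3 * L / (real k ^ 3 * real P * \<mu>)"
    using pos powr_inverse_power[of "real d" 2 3] powr_inverse_power[of "real k" 2 3]
    by (simp add: t4_def power_mult_distrib power_divide)
  then show "s\<^sup>2 * (real d ^ 3 * L) \<le> \<delta>\<^sup>2 * (real k ^ 3 * real P * \<mu>)"
    using pow[of t4 2] pos by (simp add: pos_divide_le_eq)
  have "t5 ^ 3 = real d ^ 4 * L\<^sup>2 / (real k ^ 4 * real P * \<mu>\<^sup>2)"
    using pos powr_inverse_power[of "real d" 3 4] powr_inverse_power[of "real k" 3 4]
      powr_inverse_power[of "real P" 3 1] powr_inverse_power[of L 3 2] powr_inverse_power[of \<mu> 3 2]
    by (simp add: t5_def power_mult_distrib power_divide)
  then show "s ^ 3 * (real d ^ 4 * L\<^sup>2) \<le> \<delta> ^ 3 * (real k ^ 4 * real P * \<mu>\<^sup>2)"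
    using pow[of t5 3] pos by (simp add: pos_divide_le_eq)
  have "t6 ^ 4 = real d ^ 4 * (L\<^sup>2 * V) / (real k ^ 4 * real P * (\<mu> ^ 3 * \<epsilon>))"
    using pos powr_inverse_power[of "real P" 4 1] powr_inverse_power[of "L\<^sup>2 * V" 4 1]
      powr_inverse_power[of \<mu> 4 3] powr_inverse_power[of \<epsilon> 4 1]
    by (simp add: t6_def power_mult_distrib power_divide)
  then show "s ^ 4 * (real d ^ 4 * (L\<^sup>2 * V)) \<le> \<delta> ^ 4 * (real k ^ 4 * real P * \<mu> ^ 3 * \<epsilon>)"
    using pow[of t6 4] pos by (simp add: pos_divide_le_eq mult.assoc)
qed

text \<open>The step size \<open>\<eta> = s\<^sup>2/\<mu>\<close> makes the contraction rate \<open>a/4\<close> equal to \<open>s/8\<close>.\<close>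

lemma (in snag_problem) expected_gap_le_eps:
  assumes k: "even k" "1 \<le> k div 2" "k div 2 \<le> d" and c: "0 < c" "c \<le> 1 / 32"
    and x_in: "x_in \<in> Rd d" and eps: "\<epsilon> > 0" and s_pos: "s > 0"
    and s: "s * complexity L \<mu> V P d k \<epsilon> \<le> c\<^sup>2 / 100"
    and T: "ln (1 + 16 * L * (norm (x_in - x_star))\<^sup>2 / \<epsilon>) \<le> s * real T / 8"
    and eta: "\<eta> = s\<^sup>2 / \<mu>" and gam: "gam = c * real k / real d" and l: "l = 1 / 2 * sqrt (\<eta> / \<mu>)"
    and al: "al = l * \<mu> / (2 + l * \<mu>)" and be: "be = l * \<mu> / (1 + l * \<mu>)"
  shows "expect (s_snag_ef d N P f x_in k gam (\<lambda>_. \<eta>) (\<lambda>_. l) (\<lambda>_. al) (\<lambda>_. be) T)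
     (\<lambda>s. F (sol_x s) - F x_star) \<le> \<epsilon>"
proof -
  have eta_pos: "0 < \<eta>" using s_pos mu_pos by (simp add: eta)
  interpret R: snag_run d N P L \<mu> V f x_star k c \<eta>
    by unfold_locales (use k c eta_pos in auto)
  have k_pos: "k > 0" using k by (auto intro: Nat.gr0I)
  have "\<eta> / \<mu> = (s / \<mu>)\<^sup>2" by (simp add: eta power2_eq_square)
  then have lam: "R.lam = s / (2 * \<mu>)" using s_pos mu_pos by (simp add: R.lam_def)
  then have a: "R.a = s / 2" using mu_pos by (simp add: R.a_def)
  note bounds = step_size_bounds[OF d_pos k_pos P_pos L_pos mu_pos V_nonneg eps s_pos s]
  \<comment> \<open>The budget is quadratic in c because \<gamma>^3 and \<gamma>^4 carry c^3 and
    c^4: its square has to stay below a multiple of c^3 and its cube below one of c^4, and 2 is the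
    least integer exponent for that.\<close>
  have c_small: "c\<^sup>2 / 100 \<le> c" "(c\<^sup>2 / 100)\<^sup>2 \<le> 1 / 4"
  proof -
    have "c * c \<le> c * 1" using c by (intro mult_left_mono) auto
    then show "c\<^sup>2 / 100 \<le> c" using c by (simp add: power2_eq_square)
    have "(c\<^sup>2 / 100)\<^sup>2 \<le> (1 / 2)\<^sup>2" using c \<open>c\<^sup>2 / 100 \<le> c\<close> by (intro power_mono) auto
    then show "(c\<^sup>2 / 100)\<^sup>2 \<le> 1 / 4" by (simp add: power_divide)
  qed
  have "s * real d / real k \<le> c" using bounds(3) c_small(1) by (rule order_trans)
  then have "R.a \<le> R.\<gamma> / 2" unfolding a R.\<gamma>_def using d_pos k_pos by (simp add: field_simps)
  moreover have "\<eta> * L \<le> 1 / 4" using order_trans[OF bounds(1) c_small(2)] by (simp add: eta)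
  ultimately interpret R: snag_run_tuned d N P L \<mu> V f x_star k c \<eta>
    by unfold_locales
  have g4: "R.\<gamma> ^ 4 = c ^ 4 * real k ^ 4 / real d ^ 4" and g3: "R.\<gamma> ^ 3 = c ^ 3 * real k ^ 3 / real d ^ 3"
    by (simp_all add: R.\<gamma>_def power_mult_distrib power_divide)
  have step1: "96 * R.lam * \<eta> * L\<^sup>2 \<le> R.\<gamma> ^ 4 * real P"
  proof -
    have "96 * R.lam * \<eta> * L\<^sup>2 = 48 * (s ^ 3 * (real d ^ 4 * L\<^sup>2)) / (\<mu>\<^sup>2 * real d ^ 4)"
      unfolding lam unfolding eta using mu_pos d_pos by (simp add: field_simps eval_nat_numeral)
    also have "\<dots> \<le> 48 * ((c\<^sup>2 / 100) ^ 3 * (real k ^ 4 * real P * \<mu>\<^sup>2)) / (\<mu>\<^sup>2 * real d ^ 4)"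
      by (intro divide_right_mono mult_left_mono bounds(5)) auto
    also have "\<dots> = (48 / 100 ^ 3 * c\<^sup>2) * (R.\<gamma> ^ 4 * real P)"
      unfolding g4 using mu_pos d_pos by (simp add: field_simps eval_nat_numeral)
    also have "\<dots> \<le> 1 * (R.\<gamma> ^ 4 * real P)"
      using c R.gamma_pos power_le_one[of c 2] by (intro mult_right_mono) auto
    finally show ?thesis by simp
  qed
  have step2: "4 * L * \<eta> \<le> R.\<gamma> ^ 3 * real P"
  proof -
    have "4 * L * \<eta> = 4 * (s\<^sup>2 * (real d ^ 3 * L)) / (\<mu> * real d ^ 3)"
      unfolding eta using mu_pos d_pos by (simp add: field_simps)
    also have "\<dots> \<le> 4 * ((c\<^sup>2 / 100)\<^sup>2 * (real k ^ 3 * real P * \<mu>)) / (\<mu> * real d ^ 3)"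
      using mu_pos by (intro divide_right_mono mult_left_mono bounds(4)) auto
    also have "\<dots> = (4 / 100\<^sup>2 * c) * (R.\<gamma> ^ 3 * real P)"
      unfolding g3 using mu_pos d_pos by (simp add: field_simps eval_nat_numeral)
    also have "\<dots> \<le> 1 * (R.\<gamma> ^ 3 * real P)"
      using c R.gamma_pos by (intro mult_right_mono) auto
    finally show ?thesis by simp
  qed
  have err_term: "52 * (L\<^sup>2 * \<eta>\<^sup>2 * V / (\<mu> * R.\<gamma> ^ 4 * real P)) \<le> \<epsilon> / 4"
  proof -
    have "52 * (L\<^sup>2 * \<eta>\<^sup>2 * V / (\<mu> * R.\<gamma> ^ 4 * real P))
        = 52 * (s ^ 4 * (real d ^ 4 * (L\<^sup>2 * V))) / (\<mu> ^ 3 * c ^ 4 * real k ^ 4 * real P)"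
      unfolding eta g4 using mu_pos d_pos by (simp add: field_simps eval_nat_numeral)
    also have "\<dots> \<le> 52 * ((c\<^sup>2 / 100) ^ 4 * (real k ^ 4 * real P * \<mu> ^ 3 * \<epsilon>)) / (\<mu> ^ 3 * c ^ 4 * real k ^ 4 * real P)"
      using mu_pos c by (intro divide_right_mono mult_left_mono bounds(6)) auto
    also have "\<dots> = (52 / 100 ^ 4 * c ^ 4) * \<epsilon>"
      using mu_pos c k_pos P_pos by (simp add: field_simps eval_nat_numeral)
    also have "\<dots> \<le> 1 / 4 * \<epsilon>"
      using c eps power_le_one[of c 4] by (intro mult_right_mono) auto
    finally show ?thesis by simp
  qed
  have var_term: "64 * R.lam * V / real P \<le> \<epsilon> / 4"
  proof -
    have "64 * R.lam * V / real P = 32 * (s * V / (real P * \<mu>))" by (simp add: lam mult_ac)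
    also have "\<dots> \<le> 32 * (c\<^sup>2 / 100 * \<epsilon>)" by (intro mult_left_mono bounds(2)) auto
    also have "\<dots> = (32 / 100 * c\<^sup>2) * \<epsilon>" by simp
    also have "\<dots> \<le> 1 / 4 * \<epsilon>"
    proof (intro mult_right_mono)
      have "c\<^sup>2 \<le> (1 / 32)\<^sup>2" using c by (intro power_mono) auto
      then show "32 / 100 * c\<^sup>2 \<le> 1 / 4" by (simp add: power_divide)
    qed (use eps in auto)
    finally show ?thesis by simp
  qed
  define D where "D = L * (norm (x_in - x_star))\<^sup>2"
  have D: "0 \<le> D" using L_pos by (simp add: D_def)
  \<comment> \<open>The initial gap receives half of the accuracy, the two noise floors a quarter
    each. The 16 in the logarithm gives 8 D \<epsilon>/(\<epsilon> + 16 D) \<le> \<epsilon>/2, and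
    the summand 1 covers D = 0.\<close>
  have start_term: "8 * (1 - R.a / 4) ^ T * D \<le> \<epsilon> / 2"
  proof -
    have "1 - R.a / 4 \<le> exp (- s / 8)"
      using exp_ge_add_one_self[of "- s / 8"] by (simp add: a)
    then have "(1 - R.a / 4) ^ T \<le> exp (- s / 8) ^ T"
      using R.a_small by (intro power_mono) auto
    also have "\<dots> = exp (- (s * real T / 8))" by (simp add: exp_of_nat_mult[symmetric])
    also have "\<dots> \<le> exp (- ln (1 + 16 * D / \<epsilon>))" using T by (simp add: D_def mult.assoc)
    also have "\<dots> = 1 / (1 + 16 * D / \<epsilon>)" using D eps by (simp add: exp_minus add_pos_nonneg field_simps)
    finally have "8 * (1 - R.a / 4) ^ T * D \<le> 8 * (1 / (1 + 16 * D / \<epsilon>)) * D"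
      using D by (intro mult_right_mono) auto
    also have "\<dots> = 8 * D * \<epsilon> / (\<epsilon> + 16 * D)" using D eps by (simp add: field_simps)
    also have "\<dots> \<le> \<epsilon> / 2" using D eps by (simp add: field_simps add_pos_nonneg)
    finally show ?thesis .
  qed
  have "expect (R.run x_in T) (\<lambda>s. F (sol_x s) - F x_star) \<le> \<epsilon>"
    using R.expected_gap[OF x_in step1 step2, of T] start_term err_term var_term
    unfolding D_def by linarith
  moreover have "R.run x_in T = s_snag_ef d N P f x_in k gam (\<lambda>_. \<eta>) (\<lambda>_. l) (\<lambda>_. al) (\<lambda>_. be) T"
    by (simp only: R.run_def R.\<gamma>_def R.\<alpha>_def R.\<beta>_def R.a_def R.lam_def gam al be l)
  ultimately show ?thesis by simp
qed

section \<open>The logarithmic factor, rounding and the final constants\<close>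

lemma log_factor_bound:
  assumes "L > 0" "\<mu> > 0" "0 \<le> V" "\<epsilon> > 0" "0 \<le> R"
  shows "1 \<le> log_factor L \<mu> V P d k \<epsilon> R"
    "ln (1 + 16 * L * R\<^sup>2 / \<epsilon>) \<le> 9 * log_factor L \<mu> V P d k \<epsilon> R"
proof -
  define S where "S = exp 1 + L + \<mu> + 1 / \<mu> + V + real P + real d + real k + 1 / \<epsilon> + R"
  have lf: "log_factor L \<mu> V P d k \<epsilon> R = ln S" by (simp add: log_factor_def S_def)
  have S_ge: "exp 1 \<le> S" "L \<le> S" "1 / \<epsilon> \<le> S" "R \<le> S"
    using assms by (simp_all add: S_def add_nonneg_nonneg add_increasing add_increasing2)
  have S2: "2 \<le> S" using S_ge(1) exp_ge_add_one_self[of 1] by simp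
  then have S_pos: "0 < S" by simp
  show "1 \<le> log_factor L \<mu> V P d k \<epsilon> R"
    unfolding lf using S_ge(1) S_pos by (simp add: ln_ge_iff)
  \<comment> \<open>The factors L, R, R and 1/\<epsilon> are each at most S, and 16 = 2^4 is at most
    S^4; absorbing the summand 1 costs a ninth factor.\<close>
  have "16 * L * R\<^sup>2 / \<epsilon> = 2 ^ 4 * (L * (R * R) * (1 / \<epsilon>))" by (simp add: power2_eq_square)
  also have "\<dots> \<le> S ^ 4 * (S * (S * S) * S)"
    using assms S_ge S2 by (intro mult_mono power_mono mult_nonneg_nonneg) auto
  also have "\<dots> = S ^ 8" by (simp add: eval_nat_numeral)
  finally have "1 + 16 * L * R\<^sup>2 / \<epsilon> \<le> 1 + S ^ 8" by simp
  also have "\<dots> \<le> 2 * S ^ 8" using S2 one_le_power[of S 8] by simp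
  also have "\<dots> \<le> S * S ^ 8" using S2 by (intro mult_right_mono) auto
  also have "\<dots> = S ^ 9" by (simp add: eval_nat_numeral)
  finally have "ln (1 + 16 * L * R\<^sup>2 / \<epsilon>) \<le> ln (S ^ 9)"
    using assms S_pos by (subst ln_le_cancel_iff) (auto intro!: add_pos_nonneg)
  also have "\<dots> = 9 * ln S" using S_pos by (simp add: ln_realpow)
  finally show "ln (1 + 16 * L * R\<^sup>2 / \<epsilon>) \<le> 9 * log_factor L \<mu> V P d k \<epsilon> R" unfolding lf .
qed

text \<open>A constant lower bound is what absorbs the rounding of the iteration count; it comes
  from k \<le> 2d in the term d/k.\<close>

lemma complexity_ge_half:
  assumes "L > 0" "\<mu> > 0" "0 \<le> V" "\<epsilon> > 0" "even k" "k > 0" "k div 2 \<le> d"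
  shows "1 / 2 \<le> complexity L \<mu> V P d k \<epsilon>"
proof -
  have "real k \<le> 2 * real d" using assms by (auto elim!: evenE)
  then have "1 / 2 \<le> real d / real k" using assms by (simp add: field_simps)
  then show ?thesis
    unfolding complexity_def using assms
    by (intro add_increasing2 add_increasing) auto
qed

theorem theorem4p3:
  shows "\<exists>c\<^sub>0>0::real. \<forall>c::real. 0 < c \<and> c \<le> c\<^sub>0 \<longrightarrow>
    (\<exists>C>0::real. \<exists>r::nat.
      \<forall>(d::nat) (N::nat) (P::nat) (k::nat) (L::real) (\<mu>::real) (V::real)
        (f :: nat \<Rightarrow> nat \<Rightarrow> fvec \<Rightarrow> real) (x_star::fvec) (x_in::fvec).
        d > 0 \<and> N > 0 \<and> P > 0 \<and> L > 0 \<and> \<mu> > 0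
        \<and> even k \<and> 1 \<le> k div 2 \<and> k div 2 \<le> d
        \<and> (\<forall>i\<in>{1..N}. \<forall>p\<in>{1..P}. f i p differentiable_on Rd d)
        \<and> x_star \<in> Rd d
        \<and> (\<forall>x\<in>Rd d. objective N P f x_star \<le> objective N P f x)
        \<and> smooth d L (objective N P f)
        \<and> bounded_variance d N P V f
        \<and> strongly_convex d \<mu> (objective N P f)
        \<and> x_in \<in> Rd d
        \<longrightarrow>
        (\<forall>\<epsilon>>0. \<exists>\<eta>>0. \<exists>T::nat.
          real T \<le> C * log_factor L \<mu> V P d k \<epsilon> (norm (x_in - x_star)) ^ r
                      * complexity L \<mu> V P d k \<epsilon>
          \<and> (let \<gamma> = c * real k / real d;
                 lam = 1 / 2 * sqrt (\<eta> / \<mu>);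
                 \<alpha> = lam * \<mu> / (2 + lam * \<mu>);
                 \<beta> = lam * \<mu> / (1 + lam * \<mu>)
             in measure_pmf.expectation
                  (s_snag_ef d N P f x_in k \<gamma> (\<lambda>_. \<eta>) (\<lambda>_. lam) (\<lambda>_. \<alpha>) (\<lambda>_. \<beta>) T)
                  (\<lambda>s. objective N P f (sol_x s) - objective N P f x_star) \<le> \<epsilon>)))"
proof (rule exI[of _ "1 / 32"], intro conjI allI impI)
  fix c :: real assume c: "0 < c \<and> c \<le> 1 / 32"
  define C1 where "C1 = 100 / c\<^sup>2"
  have C1: "0 < C1" using c by (simp add: C1_def)
  show "\<exists>C>0::real. \<exists>r::nat.
      \<forall>(d::nat) (N::nat) (P::nat) (k::nat) (L::real) (\<mu>::real) (V::real)
        (f :: nat \<Rightarrow> nat \<Rightarrow> fvec \<Rightarrow> real) (x_star::fvec) (x_in::fvec).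
        d > 0 \<and> N > 0 \<and> P > 0 \<and> L > 0 \<and> \<mu> > 0
        \<and> even k \<and> 1 \<le> k div 2 \<and> k div 2 \<le> d
        \<and> (\<forall>i\<in>{1..N}. \<forall>p\<in>{1..P}. f i p differentiable_on Rd d)
        \<and> x_star \<in> Rd d
        \<and> (\<forall>x\<in>Rd d. objective N P f x_star \<le> objective N P f x)
        \<and> smooth d L (objective N P f)
        \<and> bounded_variance d N P V f
        \<and> strongly_convex d \<mu> (objective N P f)
        \<and> x_in \<in> Rd d
        \<longrightarrow>
        (\<forall>\<epsilon>>0. \<exists>\<eta>>0. \<exists>T::nat.
          real T \<le> C * log_factor L \<mu> V P d k \<epsilon> (norm (x_in - x_star)) ^ r
                      * complexity L \<mu> V P d k \<epsilon>
          \<and> (let \<gamma> = c * real k / real d;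
                 lam = 1 / 2 * sqrt (\<eta> / \<mu>);
                 \<alpha> = lam * \<mu> / (2 + lam * \<mu>);
                 \<beta> = lam * \<mu> / (1 + lam * \<mu>)
             in measure_pmf.expectation
                  (s_snag_ef d N P f x_in k \<gamma> (\<lambda>_. \<eta>) (\<lambda>_. lam) (\<lambda>_. \<alpha>) (\<lambda>_. \<beta>) T)
                  (\<lambda>s. objective N P f (sol_x s) - objective N P f x_star) \<le> \<epsilon>))"
  \<comment> \<open>72 is 8, from the rate s/8, times 9, from \<open>log_factor_bound\<close>; the 2
    pays for rounding \<open>T\<close> up, because \<open>lf * X\<close> is at least 1/2.\<close>
  proof (rule exI[of _ "72 * C1 + 2"], rule conjI, use C1 in simp, rule exI[of _ 1],
      intro allI impI, elim conjE)
    fix d N P k :: nat and L \<mu> V :: real and f :: "nat \<Rightarrow> nat \<Rightarrow> fvec \<Rightarrow> real"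
      and x_star x_in :: fvec and \<epsilon> :: real
    assume pos: "d > 0" "N > 0" "P > 0" "L > 0" "\<mu> > 0"
      and k: "even k" "1 \<le> k div 2" "k div 2 \<le> d"
      and f: "\<forall>i\<in>{1..N}. \<forall>p\<in>{1..P}. f i p differentiable_on Rd d"
      and x_star: "x_star \<in> Rd d" "\<forall>x\<in>Rd d. objective N P f x_star \<le> objective N P f x"
      and F: "smooth d L (objective N P f)" "bounded_variance d N P V f"
        "strongly_convex d \<mu> (objective N P f)"
      and x_in: "x_in \<in> Rd d" and eps: "\<epsilon> > 0"
    interpret snag_problem d N P L \<mu> V f x_star
      by unfold_locales (use pos f x_star F in auto)
    define X where "X = complexity L \<mu> V P d k \<epsilon>"
    define lf where "lf = log_factor L \<mu> V P d k \<epsilon> (norm (x_in - x_star))"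
    define lr where "lr = ln (1 + 16 * L * (norm (x_in - x_star))\<^sup>2 / \<epsilon>)"
    have "k > 0" using k by (auto intro: Nat.gr0I)
    then have X: "1 / 2 \<le> X" unfolding X_def using pos V_nonneg eps k by (intro complexity_ge_half)
    have lf: "1 \<le> lf" "lr \<le> 9 * lf"
      unfolding lf_def lr_def by (intro log_factor_bound pos V_nonneg eps; simp)+
    have lr: "0 \<le> lr" using pos eps by (simp add: lr_def)
    \<comment> \<open>The budget c^2/100 is used up exactly, so 1/s is proportional to the
      complexity.\<close>
    define s where "s = 1 / (C1 * X)"
    have s: "s > 0" "s * X = c\<^sup>2 / 100" "1 / s = C1 * X"
      using C1 X by (simp_all add: s_def C1_def)
    define T where "T = nat \<lceil>8 / s * lr\<rceil>"
    have T: "8 / s * lr \<le> real T" "real T \<le> 8 / s * lr + 1"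
      using lr s by (simp_all add: T_def of_nat_nat)
    have lr_le: "lr \<le> s * real T / 8" using T(1) s(1) by (simp add: field_simps)
    have "8 / s * lr = 8 * C1 * X * lr" using s(3) by (simp add: divide_inverse)
    also have "\<dots> \<le> 8 * C1 * X * (9 * lf)" using C1 X lf by (intro mult_left_mono) auto
    finally have "real T \<le> 72 * C1 * (lf * X) + 1" using T(2) by (simp add: mult_ac)
    moreover have "1 * (1 / 2) \<le> lf * X" using lf X by (intro mult_mono) auto
    ultimately have T_le: "real T \<le> (72 * C1 + 2) * lf ^ 1 * X" by (simp add: algebra_simps)
    show "\<exists>\<eta>>0. \<exists>T::nat.
          real T \<le> (72 * C1 + 2) * log_factor L \<mu> V P d k \<epsilon> (norm (x_in - x_star)) ^ 1
                      * complexity L \<mu> V P d k \<epsilon>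
          \<and> (let \<gamma> = c * real k / real d;
                 lam = 1 / 2 * sqrt (\<eta> / \<mu>);
                 \<alpha> = lam * \<mu> / (2 + lam * \<mu>);
                 \<beta> = lam * \<mu> / (1 + lam * \<mu>)
             in measure_pmf.expectation
                  (s_snag_ef d N P f x_in k \<gamma> (\<lambda>_. \<eta>) (\<lambda>_. lam) (\<lambda>_. \<alpha>) (\<lambda>_. \<beta>) T)
                  (\<lambda>s. objective N P f (sol_x s) - objective N P f x_star) \<le> \<epsilon>)"
      unfolding Let_def
    proof (intro exI conjI)
      show "0 < s\<^sup>2 / \<mu>" using s pos by simp
    qed (use T_le in \<open>simp only: lf_def X_def\<close>,
        rule expected_gap_le_eps[where s = s and c = c],
        use k c x_in eps s lr_le in \<open>simp_all add: X_def lr_def\<close>)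
  qed
qed simp

end
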